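(* Let $n\ge1$, and let $\Delta$, $v_1$, $M$, $T$, $\Phi$, $\mathcal{F}_t$, $\mathcal{B}_t$ be as defined in the context. Let $p\in\Delta$. Then: (i) the following are equivalent: $p$ is rational; $\mathrm{EPO}_M(p)=\{v_1\}$; $p$ is a vertex of some $\mathcal{F}_t$, $t\ge0$; (ii) the following are equivalent: $p$ is dyadic; $\mathrm{EPO}_T(p)=\{v_1\}$; $p$ is a vertex of some $\mathcal{B}_t$, $t\ge0$. In particular, the set of rational points of $\Delta$, which equals $\mathrm{GO}_M(v_1)$, is mapped bijectively by $\Phi$ to the set of dyadic points of $\Delta$, which equals $\mathrm{GO}_T(v_1)$. Moreover: (iii) if $p$ is $M$-preperiodic, then $[\mathbb{Q}(p):\mathbb{Q}]\le n+1$; (iv) $p$ is rational if and only if $p$ is $T$-preperiodic.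
   Context: Fix an integer $n\ge1$ and identify $\mathbb{R}^n$ with the hyperplane $\{x_{n+1}=1\}$ of $\mathbb{R}^{n+1}$. A vector $(\alpha_1,\ldots,\alpha_{n+1})\in\mathbb{R}^{n+1}$ with $\alpha_{n+1}>0$ gives, in projective coordinates, the point $(\alpha_1/\alpha_{n+1},\ldots,\alpha_n/\alpha_{n+1})$ of $\mathbb{R}^n$. Let $V$ be the $(n+1)\times(n+1)$ matrix all of whose entries are $0$, except $V_{ij}=1$ whenever $i=n+1$, or $j\ge2$ and $i+j\le n+2$. Let $\Delta$ be the $n$-simplex whose vertices $v_1,\ldots,v_{n+1}$ are given in projective coordinates by the columns of $V$ (so $\Delta=\{1\ge x_1\ge x_2\ge\cdots\ge x_n\ge0\}$ and $v_1$ is the origin). Let $A_0$ be the $(n+1)\times(n+1)$ matrix whose entries are $0$ except for entries $1$ in positions $(1,1)$, $(1,n+1)$, $(2,n+1)$ and $(j+1,j)$ for $2\le j\le n$; let $A_1$ be the same matrix except that the $1$ in position $(1,1)$ is moved to position $(2,1)$. For $a=0,1$ let $\Delta_a$ be the simplex whose vertices are given in projective coordinates by the columns of $VA_a$; one has $\Delta=\Delta_0\cup\Delta_1$. For $a=0,1$ the matrix $M_a=VA_a^{-1}V^{-1}\in\mathrm{GL}_{n+1}(\mathbb{Z})$ induces a fractional-linear homeomorphism, also denoted $M_a$, from $\Delta_a$ to $\Delta$: the projective coordinates of $M_a(x)$ are $M_a(x_1\cdots x_n\,1)^{tr}$. The maps $M_0,M_1$ agree on $\Delta_0\cap\Delta_1$,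 and the Mönkemeyer map $M:\Delta\to\Delta$ is the continuous map with $M(x)=M_a(x)$ for $x\in\Delta_a$. In affine coordinates, $M(x_1,\ldots,x_n)=\bigl(\frac{x_1}{1-x_n},\frac{x_1-x_n}{1-x_n},\ldots,\frac{x_{n-1}-x_n}{1-x_n}\bigr)$ if $x_1+x_n\le1$ (i.e. on $\Delta_0$), and $M(x_1,\ldots,x_n)=\bigl(\frac{1-x_n}{x_1},\frac{x_1-x_n}{x_1},\ldots,\frac{x_{n-1}-x_n}{x_1}\bigr)$ if $x_1+x_n\ge1$ (i.e. on $\Delta_1$). For $a=0,1$ let $B_a$ be the matrix identical to $A_a$ except that the two $1$'s in the last column are replaced by $1/2$. The matrix $T_a=VB_a^{-1}V^{-1}$ has last row $(0\cdots0\,1)$ and induces an affine homeomorphism, also denoted $T_a$, from $\Delta_a$ to $\Delta$, by $T_a(x_1\cdots x_n\,1)^{tr}=(y_1\cdots y_n\,1)^{tr}$. The maps $T_0,T_1$ agree on $\Delta_0\cap\Delta_1$, and the tent map $T:\Delta\to\Delta$ is the continuous map with $T(x)=T_a(x)$ for $x\in\Delta_a$. In affine coordinates, $T(x_1,\ldots,x_n)=(x_1+x_n,x_1-x_n,\ldots,x_{n-1}-x_n)$ if $x_1+x_n\le1$, and $T(x_1,\ldots,x_n)=(2-x_1-x_n,x_1-x_n,\ldots,x_{n-1}-x_n)$ if $x_1+x_n\ge1$. (For $n=1$ only the first coordinate is present in these formulas.) For $a_0,\ldots,a_{t-1}\in\{0,1\}$ let $\Delta_{a_0\ldots a_{t-1}}=\{x\in\Delta:M^i(x)\in\Delta_{a_i}\text{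 for }0\le i\le t-1\}$ and $\Gamma_{a_0\ldots a_{t-1}}=\{x\in\Delta:T^i(x)\in\Delta_{a_i}\text{ for }0\le i\le t-1\}$ (both equal to $\Delta$ for $t=0$). These are $n$-simplexes; $\mathcal{F}_t$ (respectively $\mathcal{B}_t$) is the simplicial complex, supported on $\Delta$, consisting of all $\Delta_{a_0\ldots a_{t-1}}$ (respectively all $\Gamma_{a_0\ldots a_{t-1}}$) and all their faces. For an infinite sequence $\bar a=a_0a_1a_2\ldots\in\{0,1\}^{\mathbb{N}}$, let $\varphi(\bar a)$ be the unique point of $\bigcap_{t\ge0}\Delta_{a_0\ldots a_{t-1}}$ and $\upsilon(\bar a)$ the unique point of $\bigcap_{t\ge0}\Gamma_{a_0\ldots a_{t-1}}$. The map $\Phi:\Delta\to\Delta$ is defined by $\Phi(p)=\upsilon(\bar a)$ for any $\bar a$ with $\varphi(\bar a)=p$; this is a well-defined homeomorphism, and it is the unique homeomorphism of $\Delta$ such that $T=\Phi\circ M\circ\Phi^{-1}$. For $p\in\Delta$ and $R\in\{M,T\}$: the grand orbit is $\mathrm{GO}_R(p)=\{q\in\Delta:R^t(p)=R^s(q)\text{ for some }t,s\ge0\}$; the eventual periodic orbit is $\mathrm{EPO}_R(p)=\{q\in\Delta:q=R^t(p)=R^s(p)\text{ for some }0\le t<s\}$; $p$ is $R$-preperiodic if $\mathrm{EPO}_R(p)\ne\emptyset$. Let $\mathbb{Z}[1/2]$ be the ring of dyadic rationals. A point $p=(\alpha_1,\ldots,\alpha_n)\in\Delta$ is rational if all $\alpha_i\in\mathbb{Q}$,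 and dyadic if all $\alpha_i\in\mathbb{Z}[1/2]$; $\mathbb{Q}(p)$ denotes the field $\mathbb{Q}(\alpha_1,\ldots,\alpha_n)$. *)

theory Defs
  imports
    "HOL-Analysis.Analysis"
    "HOL-Algebra.Generated_Fields"
    "HOL-Algebra.Embedded_Algebras"
    "HOL-Algebra.Algebraic_Closure_Type"
begin

text \<open>
  The dimension \<open>n \<ge> 1\<close> is \<open>CARD('n)\<close> for a finite linearly ordered index type \<open>'n\<close>; the order is
  only used to number the coordinates \<open>1, \<dots>, n\<close>. The type \<open>'n option\<close> indexes the coordinates
  of \<open>\<real>\<^sup>n\<^sup>+\<^sup>1\<close>, with \<open>None\<close> as the last one, \<open>n + 1\<close>.
\<close>

type_synonym 'n point = "real ^ 'n"
type_synonym 'n proj_vector = "real ^ ('n option)"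
type_synonym 'n proj_matrix = "real ^ ('n option) ^ ('n option)"

fun pos :: "'n::{finite,linorder} option \<Rightarrow> nat" where
  "pos (Some i) = card {..i}"
| "pos None = CARD('n) + 1"

definition homogenize :: "'n::{finite,linorder} point \<Rightarrow> 'n proj_vector" where
  "homogenize x = (\<chi> k. case k of Some i \<Rightarrow> x $ i | None \<Rightarrow> 1)"

definition proj_point :: "'n::{finite,linorder} proj_vector \<Rightarrow> 'n point" where
  "proj_point \<alpha> = (\<chi> i. \<alpha> $ Some i / \<alpha> $ None)"

definition proj_action :: "'n::{finite,linorder} proj_matrix \<Rightarrow> 'n point \<Rightarrow> 'n point" where
  "proj_action N x = proj_point (N *v homogenize x)"

definition simplex_of_columns :: "'n::{finite,linorder} proj_matrix \<Rightarrow> 'n point set" where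
  "simplex_of_columns N = convex hull (range (\<lambda>j. proj_point (column j N)))"


section \<open>The matrices\<close>

definition V_mat :: "'n::{finite,linorder} proj_matrix" where
  "V_mat = (\<chi> i j. if pos i = CARD('n) + 1 \<or> (2 \<le> pos j \<and> pos i + pos j \<le> CARD('n) + 2)
                   then 1 else 0)"

text \<open>The binary digits \<open>0\<close> and \<open>1\<close> are rendered as \<open>False\<close> and \<open>True\<close>.\<close>

definition A_mat :: "bool \<Rightarrow> 'n::{finite,linorder} proj_matrix" where
  "A_mat a = (\<chi> i j.
     if (pos i, pos j) \<in> {(if a then 2 else 1, 1), (1, CARD('n) + 1), (2, CARD('n) + 1)}
                         \<union> {(k + 1, k) | k. 2 \<le> k \<and> k \<le> CARD('n)}
     then 1 else 0)"

definition B_mat :: "bool \<Rightarrow> 'n::{finite,linorder} proj_matrix" where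
  "B_mat a = (\<chi> i j. if j = None \<and> A_mat a $ i $ j = 1 then 1 / 2 else A_mat a $ i $ j)"

definition M_mat :: "bool \<Rightarrow> 'n::{finite,linorder} proj_matrix" where
  "M_mat a = V_mat ** matrix_inv (A_mat a) ** matrix_inv V_mat"

definition T_mat :: "bool \<Rightarrow> 'n::{finite,linorder} proj_matrix" where
  "T_mat a = V_mat ** matrix_inv (B_mat a) ** matrix_inv V_mat"


section \<open>The simplex, the Moenkemeyer map and the tent map\<close>

definition Delta :: "'n::{finite,linorder} point set" where
  "Delta = simplex_of_columns V_mat"

definition v1 :: "'n::{finite,linorder} point" where
  "v1 = proj_point (column (Some (Min UNIV)) V_mat)"

definition Delta_half :: "bool \<Rightarrow> 'n::{finite,linorder} point set" where
  "Delta_half a = simplex_of_columns (V_mat ** A_mat a)"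

text \<open>
  Both maps are relevant on \<open>Delta\<close> only, where the branches agree on the overlap of the two halves.
  The last row of \<open>T_mat a\<close> is \<open>(0 \<dots> 0 1)\<close>, so for it the projective action is the affine one.
\<close>

definition M_map :: "'n::{finite,linorder} point \<Rightarrow> 'n point" where
  "M_map x = (if x \<in> Delta_half False then proj_action (M_mat False) x
              else proj_action (M_mat True) x)"

definition T_map :: "'n::{finite,linorder} point \<Rightarrow> 'n point" where
  "T_map x = (if x \<in> Delta_half False then proj_action (T_mat False) x
              else proj_action (T_mat True) x)"


section \<open>Cylinders, simplicial complexes and the conjugacy\<close>

text \<open>
  For the map \<open>R\<close> equal to \<open>M_map\<close> (resp. \<open>T_map\<close>), \<open>cylinder R w\<close> is the simplex
  \<open>\<Delta>\<^sub>w\<close> (resp. \<open>\<Gamma>\<^sub>w\<close>), and \<open>cylinder_complex R t\<close> is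
  the complex \<open>F\<^sub>t\<close> (resp. \<open>B\<^sub>t\<close>).
\<close>

definition cylinder ::
  "('n::{finite,linorder} point \<Rightarrow> 'n point) \<Rightarrow> bool list \<Rightarrow> 'n point set" where
  "cylinder R w = {x \<in> Delta. \<forall>i < length w. (R ^^ i) x \<in> Delta_half (w ! i)}"

definition cylinder_complex ::
  "('n::{finite,linorder} point \<Rightarrow> 'n point) \<Rightarrow> nat \<Rightarrow> 'n point set set" where
  "cylinder_complex R t = {F. \<exists>w. length w = t \<and> F face_of cylinder R w}"

definition complex_vertices :: "'n::{finite,linorder} point set set \<Rightarrow> 'n point set" where
  "complex_vertices K = {p. {p} \<in> K}"

definition coded_point ::
  "('n::{finite,linorder} point \<Rightarrow> 'n point) \<Rightarrow> (nat \<Rightarrow> bool) \<Rightarrow> 'n point" where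
  "coded_point R a = (THE p. p \<in> (\<Inter>t. cylinder R (map a [0..<t])))"

definition Phi :: "'n::{finite,linorder} point \<Rightarrow> 'n point" where
  "Phi p = (THE q. \<exists>a. coded_point M_map a = p \<and> q = coded_point T_map a)"


section \<open>Orbits\<close>

definition GO :: "('n::{finite,linorder} point \<Rightarrow> 'n point) \<Rightarrow> 'n point \<Rightarrow> 'n point set" where
  "GO R p = {q \<in> Delta. \<exists>t s. (R ^^ t) p = (R ^^ s) q}"

definition EPO :: "('n::{finite,linorder} point \<Rightarrow> 'n point) \<Rightarrow> 'n point \<Rightarrow> 'n point set" where
  "EPO R p = {q \<in> Delta. \<exists>t s. t < s \<and> q = (R ^^ t) p \<and> q = (R ^^ s) p}"

definition preperiodic :: "('n::{finite,linorder} point \<Rightarrow> 'n point) \<Rightarrow> 'n point \<Rightarrow> bool" where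
  "preperiodic R p \<longleftrightarrow> EPO R p \<noteq> {}"


section \<open>Arithmetic of points\<close>

definition dyadic_rationals :: "real set" where
  "dyadic_rationals = {of_int k / 2 ^ m | (k :: int) (m :: nat). True}"

definition rational_point :: "'n::{finite,linorder} point \<Rightarrow> bool" where
  "rational_point p \<longleftrightarrow> (\<forall>i. p $ i \<in> \<rat>)"

definition dyadic_point :: "'n::{finite,linorder} point \<Rightarrow> bool" where
  "dyadic_point p \<longleftrightarrow> (\<forall>i. p $ i \<in> dyadic_rationals)"

abbreviation real_ring :: "real ring" where
  "real_ring \<equiv> ring_of_type_algebra"

definition point_field :: "'n::{finite,linorder} point \<Rightarrow> real set" where
  "point_field p = generate_field real_ring (\<rat> \<union> range (\<lambda>i. p $ i))"

definition degree_over_Q_le :: "real set \<Rightarrow> nat \<Rightarrow> bool" where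
  "degree_over_Q_le E m \<longleftrightarrow> (\<exists>d \<le> m. ring.dimension real_ring d \<rat> E)"

end

theory Submission
  imports Defs
begin

text \<open>
  In barycentric coordinates \<open>b\<^sub>0, \<dots>, b\<^sub>n\<close> both maps are the subtractive algorithm
  \<open>b \<mapsto> (\<bar>b\<^sub>0 - b\<^sub>1\<bar>, b\<^sub>2, \<dots>, b\<^sub>n, c * min b\<^sub>0 b\<^sub>1)\<close>, followed by normalization, with \<open>c = 1\<close>
  for \<open>M\<close> and \<open>c = 2\<close> for \<open>T\<close>. For \<open>M\<close> the common denominator of a rational point decreases unless
  \<open>min b\<^sub>0 b\<^sub>1 = 0\<close>, in which case the support shrinks; for \<open>T\<close> a dyadic denominator is halved every
  \<open>n\<close> steps. So these points reach the fixed point \<open>v1\<close>, and the inverse branches send vertices to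
  vertices. Nested cylinders shrink to points because new vertices are mixtures of old ones, all
  vertices share ancestors after boundedly many steps, and the mixing weights stay away from \<open>0\<close>
  for a while after every digit \<open>1\<close> (if \<open>1\<close> occurs finitely often, the vertices converge to the one
  that is never replaced). Which facets contain a coded point depends on the code only, in the same
  way for both maps, so \<open>\<Phi>\<close> is a bijective conjugacy. Finally, a periodic point is an eigenvector of
  a rational matrix, and uniqueness of coded points forces its coordinates into every real field
  containing the eigenvalue.
\<close>

section \<open>Barycentric coordinates\<close>

text \<open>The obstacle is the fixed point \<open>v1\<close>, where \<open>M\<close> is not
  expanding: along the digits 000... one vertex never moves and the denominators of the others grow
  only linearly, so no rate of contraction holds for all codes. For \<open>T\<close> every new
  vertex is a midpoint and the rate is uniform. The constant c is the reciprocal of the last-column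
  entries of the matrices; c = 2 is the value for which a step preserves the coordinate sum, which
  makes \<open>T\<close> affine. Two codes of a point can differ at some time only if the iterate
  lies in both halves, that is, if the next iterate has b_0 = 0. So the ambiguity of the coding is
  entirely a matter of lying on facets. For the degree bound, let E be the rational span of the
  coordinates of the periodic point. The numbers r with r E contained in E form a field that
  contains the eigenvalue, hence the coordinates; so E is itself a field, spanned by n + 1
  numbers.\<close>

lemma pos_Some_less: "pos (Some (i::'n::{finite,linorder})) < CARD('n) + 1"
  by (simp add: card_mono less_Suc_eq_le)

lemma pos_pos: "1 \<le> pos (k::'n::{finite,linorder} option)"
proof (cases k)
  case (Some i)
  have "card {i} \<le> card {..i}" by (rule card_mono) auto
  then show ?thesis using Some by simp
qed simp

lemma inj_pos: "inj (pos :: 'n::{finite,linorder} option \<Rightarrow> nat)"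
proof (rule injI)
  have less: "card {..i} < card {..j}" if "i < j" for i j :: 'n
    using that by (intro psubset_card_mono) auto
  fix x y :: "'n option" assume "pos x = pos y"
  then show "x = y"
  proof (cases x)
    case None
    then show ?thesis using \<open>pos x = pos y\<close> pos_Some_less[where 'n='n] by (cases y) (auto dest: less_not_refl2)
  next
    case (Some i)
    then obtain j where "y = Some j" using \<open>pos x = pos y\<close> pos_Some_less[of i] by (cases y) auto
    then show ?thesis using Some \<open>pos x = pos y\<close> less by (metis less_irrefl linorder_neqE pos.simps(1))
  qed
qed

definition ix :: "'n::{finite,linorder} option \<Rightarrow> nat" where
  "ix k = pos k - 1"

lemma pos_eq_ix: "pos k = Suc (ix k)"
  using pos_pos[of k] by (simp add: ix_def)

lemma bij_ix: "bij_betw ix (UNIV :: 'n::{finite,linorder} option set) {..CARD('n)}"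
proof -
  have inj: "inj (ix :: 'n option \<Rightarrow> nat)"
    using inj_pos by (auto simp: inj_def pos_eq_ix)
  have "range (ix :: 'n option \<Rightarrow> nat) \<subseteq> {..CARD('n)}"
  proof
    fix m assume "m \<in> range (ix :: 'n option \<Rightarrow> nat)"
    then obtain k :: "'n option" where "m = ix k" by auto
    then show "m \<in> {..CARD('n)}"
      using pos_Some_less by (cases k) (auto simp: ix_def less_Suc_eq_le intro: le_trans[OF diff_le_self])
  qed
  moreover have "card (range (ix :: 'n option \<Rightarrow> nat)) = card {..CARD('n)}"
    using card_image[OF inj] by (simp add: card_option)
  ultimately have "range (ix :: 'n option \<Rightarrow> nat) = {..CARD('n)}"
    by (intro card_subset_eq) auto
  with inj show ?thesis by (auto simp: bij_betw_def)
qed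

lemma ix_le: "ix (k::'n::{finite,linorder} option) \<le> CARD('n)"
  using bij_betwE[OF bij_ix] by auto

lemma ix_eq_iff [simp]: "ix k = ix l \<longleftrightarrow> k = l"
  using bij_ix by (metis UNIV_I bij_betw_inv_into_left)

lemma ix_None [simp]: "ix (None :: 'n::{finite,linorder} option) = CARD('n)"
  by (simp add: ix_def)

lemma ix_surj:
  assumes "m \<le> CARD('n)"
  obtains k :: "'n::{finite,linorder} option" where "ix k = m"
  using bij_ix assms by (metis atMost_iff bij_betw_imp_surj_on imageE)

lemma ix_Some_surj:
  assumes "m < CARD('n)"
  obtains i :: "'n::{finite,linorder}" where "ix (Some i) = m"
  by (metis assms ix_None ix_surj less_imp_le_nat not_less_iff_gr_or_eq option.exhaust)

lemma ix_Some_less: "ix (Some (i::'n::{finite,linorder})) < CARD('n)"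
  using ix_le[of "Some i"] ix_eq_iff[of "Some i" None] by (simp add: less_le del: ix_eq_iff)

lemma sum_ix: "(\<Sum>k\<in>(UNIV :: 'n::{finite,linorder} option set). f (ix k)) = (\<Sum>m\<le>CARD('n). f m)"
  by (rule sum.reindex_bij_betw[OF bij_ix])

text \<open>Coordinates become functions on \<open>nat\<close>, so that the shift from b_k to
  b_(k+1) is just \<open>Suc\<close>. Values beyond \<open>CARD('n)\<close> are ignored, which is
  why the congruence lemmas compare arguments up to n only.\<close>

definition vec_of :: "(nat \<Rightarrow> real) \<Rightarrow> 'n::{finite,linorder} proj_vector" where
  "vec_of b = (\<chi> j. b (ix j))"

lemma vec_of_nth [simp]: "vec_of b $ j = b (ix j)"
  by (simp add: vec_of_def)

lemma vec_of_eq_iff: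
  "(vec_of b :: 'n::{finite,linorder} proj_vector) = vec_of b' \<longleftrightarrow> (\<forall>k\<le>CARD('n). b k = b' k)"
  unfolding vec_eq_iff by (metis ix_le ix_surj vec_of_nth)

lemma vec_of_surj:
  obtains b where "v = (vec_of b :: 'n::{finite,linorder} proj_vector)"
proof
  show "v = vec_of (\<lambda>m. v $ (inv_into UNIV ix m))"
    using bij_betw_inv_into_left[OF bij_ix[where 'n='n]] by (simp add: vec_eq_iff)
qed

text \<open>One family for both maps, so that most facts below are proved once, with c as a
  parameter.\<close>

definition K_mat :: "real \<Rightarrow> bool \<Rightarrow> 'n::{finite,linorder} proj_matrix" where
  "K_mat c a = (\<chi> i j. if j = None \<and> A_mat a $ i $ j = 1 then 1 / c else A_mat a $ i $ j)"

lemma K_mat_1: "K_mat 1 a = A_mat a"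
  by (auto simp: K_mat_def vec_eq_iff)

lemma K_mat_2: "K_mat 2 a = B_mat a"
  by (auto simp: K_mat_def B_mat_def vec_eq_iff)

text \<open>\<open>K_mat\<close> and its inverse as coordinate formulas. \<open>step_lin\<close> is
  the step of the overview with absolute value and minimum resolved by the digit: \<open>a\<close>
  stands for the case that b_0 is the smaller one of b_0 and b_1.\<close>

definition inv_lin :: "nat \<Rightarrow> real \<Rightarrow> bool \<Rightarrow> (nat \<Rightarrow> real) \<Rightarrow> nat \<Rightarrow> real" where
  "inv_lin n c a b k = (if 2 \<le> k then b (k - 1) else (if (k = 1) = a then b 0 else 0) + b n / c)"

definition step_lin :: "nat \<Rightarrow> real \<Rightarrow> bool \<Rightarrow> (nat \<Rightarrow> real) \<Rightarrow> nat \<Rightarrow> real" where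
  "step_lin n c a b k = (if k = 0 then if a then b 1 - b 0 else b 0 - b 1
     else if k < n then b (Suc k) else c * (if a then b 0 else b 1))"

lemma step_inv_lin:
  assumes "1 \<le> n" "c \<noteq> 0" "k \<le> n"
  shows "step_lin n c a (inv_lin n c a b) k = b k"
  using assms by (auto simp: step_lin_def inv_lin_def)

lemma inv_step_lin:
  assumes "1 \<le> n" "c \<noteq> 0" "k \<le> n"
  shows "inv_lin n c a (step_lin n c a b) k = b k"
  using assms by (cases "k = 0"; cases "k = 1") (auto simp: step_lin_def inv_lin_def)

section \<open>The matrices acting on coordinate vectors\<close>

lemma V_mat_vec_of:
  "(V_mat *v vec_of b) $ (i :: 'n::{finite,linorder} option) =
    (if i = None then (\<Sum>k\<le>CARD('n). b k) else (\<Sum>k = 1..CARD('n) - ix i. b k))"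
proof -
  let ?n = "CARD('n)"
  have "(V_mat *v vec_of b) $ i =
      (\<Sum>j\<in>(UNIV :: 'n option set). (if ix i = ?n \<or> (1 \<le> ix j \<and> ix i + ix j \<le> ?n) then 1 else 0) * b (ix j))"
    unfolding matrix_vector_mult_def V_mat_def by (simp add: pos_eq_ix)
  also have "\<dots> = (\<Sum>k\<le>?n. (if ix i = ?n \<or> (1 \<le> k \<and> ix i + k \<le> ?n) then 1 else 0) * b k)"
    by (rule sum_ix)
  also have "\<dots> = (\<Sum>k\<in>{k\<in>{..?n}. ix i = ?n \<or> (1 \<le> k \<and> ix i + k \<le> ?n)}. b k)"
    by (subst sum.inter_filter) (auto intro: sum.cong)
  also have "{k\<in>{..?n}. ix i = ?n \<or> (1 \<le> k \<and> ix i + k \<le> ?n)} =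
      (if i = None then {..?n} else {1..?n - ix i})"
    using ix_Some_less[where 'n='n] by (cases i) (auto simp: order_less_imp_not_eq)
  finally show ?thesis by simp
qed

lemma K_mat_vec_of:
  "K_mat c a *v vec_of b = (vec_of (inv_lin CARD('n) c a b) :: 'n::{finite,linorder} proj_vector)"
proof -
  let ?n = "CARD('n)"
  have "(K_mat c a *v vec_of b) $ i = inv_lin ?n c a b (ix i)" for i :: "'n option"
  proof -
    define e where "e k = (if (ix i, k) \<in> {(if a then 1 else 0, 0)} \<union> {(k + 1, k) | k. 1 \<le> k \<and> k < ?n} then 1
       else if (ix i, k) \<in> {(0, ?n), (1, ?n)} then 1 / c else 0)" for k
    have n: "1 \<le> ?n" by (simp add: Suc_leI)
    have "K_mat c a $ i $ j = e (ix j)" for j :: "'n option"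
    proof -
      have jN: "j = None \<longleftrightarrow> ix j = ?n" using ix_eq_iff[of j None] by (simp del: ix_eq_iff)
      have "A_mat a $ i $ j = (if (ix i, ix j) \<in> {(if a then 1 else 0, 0), (0, ?n), (1, ?n)}
              \<union> {(k + 1, k) | k. 1 \<le> k \<and> k < ?n} then 1 else 0)"
        unfolding A_mat_def by (simp add: pos_eq_ix)
      then show ?thesis using n by (auto simp: K_mat_def e_def jN)
    qed
    then have "(K_mat c a *v vec_of b) $ i = (\<Sum>j\<in>(UNIV :: 'n option set). e (ix j) * b (ix j))"
      by (simp add: matrix_vector_mult_def)
    also have "\<dots> = (\<Sum>k\<le>?n. e k * b k)" by (rule sum_ix)
    also have "\<dots> = inv_lin ?n c a b (ix i)"
    proof (cases "2 \<le> ix i")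
      case True
      have "(\<Sum>k\<le>?n. e k * b k) = (\<Sum>k\<in>{ix i - 1}. e k * b k)"
        using True ix_le[of i] by (intro sum.mono_neutral_right) (auto simp: e_def)
      also have "\<dots> = b (ix i - 1)" using True ix_le[of i] by (auto simp: e_def)
      finally show ?thesis using True by (simp add: inv_lin_def)
    next
      case False
      then have i: "ix i = 0 \<or> ix i = 1" by auto
      have "(\<Sum>k\<le>?n. e k * b k) = (\<Sum>k\<in>{0, ?n}. e k * b k)"
        using False by (intro sum.mono_neutral_right) (auto simp: e_def)
      also have "\<dots> = e 0 * b 0 + e ?n * b ?n" using n by simp
      also have "e 0 = (if (ix i = 1) = a then 1 else 0)" using i n by (auto simp: e_def)
      also have "e ?n = 1 / c" using i n by (auto simp: e_def)
      finally show ?thesis using False by (simp add: inv_lin_def)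
    qed
    finally show ?thesis .
  qed
  then show ?thesis by (simp add: vec_eq_iff)
qed

lemma matrix_inv_left_of_inj:
  fixes N :: "real ^ 'm ^ 'm"
  assumes "inj ((*v) N)"
  shows "matrix_inv N *v (N *v v) = v"
proof -
  have "invertible N"
    using assms by (simp add: invertible_left_inverse matrix_left_invertible_injective)
  then have "N ** matrix_inv N = mat 1 \<and> matrix_inv N ** N = mat 1"
    unfolding invertible_def matrix_inv_def by (rule someI_ex)
  then show ?thesis by (simp add: matrix_vector_mul_assoc)
qed

lemma K_mat_inv:
  assumes "c \<noteq> 0"
  shows "matrix_inv (K_mat c a) *v vec_of b = (vec_of (step_lin CARD('n) c a b) :: 'n::{finite,linorder} proj_vector)"
proof -
  have n: "1 \<le> CARD('n)" by (simp add: Suc_leI)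
  have "inj ((*v) (K_mat c a :: 'n proj_matrix))"
  proof (rule injI)
    fix v w :: "'n proj_vector" assume eq: "K_mat c a *v v = K_mat c a *v w"
    obtain b b' where v: "v = vec_of b" and w: "w = vec_of b'" by (meson vec_of_surj)
    have "\<forall>k\<le>CARD('n). inv_lin CARD('n) c a b k = inv_lin CARD('n) c a b' k"
      using eq by (simp add: v w K_mat_vec_of vec_of_eq_iff)
    then have "\<forall>k\<le>CARD('n). step_lin CARD('n) c a (inv_lin CARD('n) c a b) k =
         step_lin CARD('n) c a (inv_lin CARD('n) c a b') k"
      using n by (auto simp: step_lin_def Suc_leI)
    then show "v = w" using n assms by (simp add: v w vec_of_eq_iff step_inv_lin)
  qed
  moreover have "vec_of b = K_mat c a *v (vec_of (step_lin CARD('n) c a b) :: 'n proj_vector)"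
    using n assms by (simp add: K_mat_vec_of vec_of_eq_iff inv_step_lin)
  ultimately show ?thesis by (simp add: matrix_inv_left_of_inj)
qed

text \<open>All rows of \<open>V_mat\<close> but the last form partial sums of b_1, b_2, ..., so
  differencing recovers these coordinates; the last row, the total sum, then gives b_0.\<close>

lemma V_mat_inv: "matrix_inv V_mat *v (V_mat *v v) = (v :: 'n::{finite,linorder} proj_vector)"
proof (rule matrix_inv_left_of_inj, rule injI)
  fix v w :: "'n proj_vector" assume eq: "V_mat *v v = V_mat *v w"
  let ?n = "CARD('n)"
  obtain b b' where v: "v = vec_of b" and w: "w = vec_of b'" by (meson vec_of_surj)
  have part: "(\<Sum>k = 1..m. b k) = (\<Sum>k = 1..m. b' k)" if "m \<le> ?n" for m
  proof (cases m)
    case (Suc l)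
    then have "?n - m < ?n" using that by auto
    then obtain i :: 'n where i: "ix (Some i) = ?n - m" by (rule ix_Some_surj)
    have "(V_mat *v v) $ Some i = (V_mat *v w) $ Some i" using eq by simp
    then show ?thesis using that by (simp add: v w V_mat_vec_of i)
  qed simp
  have b: "b k = b' k" if "1 \<le> k" "k \<le> ?n" for k
  proof -
    obtain l where k: "k = Suc l" using \<open>1 \<le> k\<close> by (cases k) auto
    show ?thesis using part[of k] part[of l] that by (simp add: k)
  qed
  have "(V_mat *v v) $ None = (V_mat *v w) $ None" using eq by simp
  then have "b 0 + (\<Sum>k = 1..?n. b k) = b' 0 + (\<Sum>k = 1..?n. b' k)"
    by (simp add: v w V_mat_vec_of atMost_atLeast0 sum.atLeast_Suc_atMost)
  then have "b 0 = b' 0" using part[of ?n] by simp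
  with b show "v = w" unfolding v w vec_of_eq_iff by (metis One_nat_def Suc_leI gr0I)
qed

text \<open>With positive last entries the columns may be rescaled: coefficients
  \<open>\<beta>\<close> of the cone over the columns and weights \<open>u\<close> of the convex
  hull of their points correspond by \<open>u j = N $ None $ j * \<beta> $ j\<close>. This turns
  membership in a simplex into a linear condition.\<close>

lemma simplex_of_columns_iff:
  fixes N :: "'n::{finite,linorder} proj_matrix"
  assumes pos: "\<And>j. N $ None $ j > 0"
  shows "x \<in> simplex_of_columns N \<longleftrightarrow> (\<exists>\<beta>. (\<forall>j. \<beta> $ j \<ge> 0) \<and> homogenize x = N *v \<beta>)"
proof
  define p where "p j = proj_point (column j N)" for j
  have col: "N $ i $ j = N $ None $ j * homogenize (p j) $ i" for i j
    using pos[of j] by (cases i) (auto simp: homogenize_def p_def proj_point_def column_def)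
  assume "x \<in> simplex_of_columns N"
  moreover have "simplex_of_columns N \<subseteq> {x. \<exists>\<beta>. (\<forall>j. \<beta> $ j \<ge> 0) \<and> homogenize x = N *v \<beta>}"
    unfolding simplex_of_columns_def
  proof (rule hull_minimal)
    show "range (\<lambda>j. proj_point (column j N)) \<subseteq> {x. \<exists>\<beta>. (\<forall>j. \<beta> $ j \<ge> 0) \<and> homogenize x = N *v \<beta>}"
    proof clarify
      fix j :: "'n option"
      show "\<exists>\<beta>::'n proj_vector. (\<forall>j. 0 \<le> \<beta> $ j) \<and> homogenize (proj_point (column j N)) = N *v \<beta>"
      proof (intro exI conjI allI)
        show "0 \<le> vec_lambda (\<lambda>i. if i = j then 1 / N $ None $ j else 0) $ i" for i
          using pos[of j] by auto
        have "homogenize (p j) $ i = N $ i $ j * (1 / N $ None $ j)" for i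
          using pos[of j] col[of i j] by simp
        then show "homogenize (proj_point (column j N)) = N *v vec_lambda (\<lambda>i. if i = j then 1 / N $ None $ j else 0)"
          by (simp add: vec_eq_iff matrix_vector_mult_def p_def[symmetric]
              if_distrib[of "\<lambda>x. _ * x"] sum.delta' cong: if_cong)
      qed
    qed
    show "convex {x. \<exists>\<beta>. (\<forall>j. \<beta> $ j \<ge> 0) \<and> homogenize x = N *v \<beta>}"
    proof (rule convexI; clarify)
      fix x y :: "'n point" and \<beta> \<gamma> :: "'n proj_vector" and u v :: real
      assume uv: "0 \<le> u" "0 \<le> v" "u + v = 1" and \<beta>: "\<forall>j. 0 \<le> \<beta> $ j" "homogenize x = N *v \<beta>"
        and \<gamma>: "\<forall>j. 0 \<le> \<gamma> $ j" "homogenize y = N *v \<gamma>"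
      have "homogenize (u *\<^sub>R x + v *\<^sub>R y) = u *\<^sub>R homogenize x + v *\<^sub>R homogenize y"
        using uv by (auto simp: homogenize_def vec_eq_iff split: option.split)
      also have "\<dots> = N *v (u *\<^sub>R \<beta> + v *\<^sub>R \<gamma>)"
        by (simp add: \<beta> \<gamma> matrix_vector_right_distrib matrix_vector_mult_scaleR)
      finally show "\<exists>\<beta>::'n proj_vector. (\<forall>j. 0 \<le> \<beta> $ j) \<and> homogenize (u *\<^sub>R x + v *\<^sub>R y) = N *v \<beta>"
        using uv \<beta> \<gamma> by (intro exI[of _ "u *\<^sub>R \<beta> + v *\<^sub>R \<gamma>"]) auto
    qed
  qed
  ultimately show "\<exists>\<beta>. (\<forall>j. \<beta> $ j \<ge> 0) \<and> homogenize x = N *v \<beta>" by auto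
next
  assume "\<exists>\<beta>. (\<forall>j. \<beta> $ j \<ge> 0) \<and> homogenize x = N *v \<beta>"
  then obtain \<beta> :: "'n proj_vector" where \<beta>: "\<forall>j. \<beta> $ j \<ge> 0" "homogenize x = N *v \<beta>" by auto
  define u where "u j = N $ None $ j * \<beta> $ j" for j
  have u0: "u j \<ge> 0" for j using \<beta> pos[of j] by (simp add: u_def)
  have "homogenize x $ None = (\<Sum>j\<in>UNIV. u j)"
    unfolding \<beta> by (simp add: matrix_vector_mult_def u_def)
  then have u1: "(\<Sum>j\<in>UNIV. u j) = 1" by (simp add: homogenize_def)
  have "x = (\<Sum>j\<in>UNIV. u j *\<^sub>R proj_point (column j N))"
  proof -
    have "x $ i = (\<Sum>j\<in>UNIV. u j * (N $ Some i $ j / N $ None $ j))" for i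
    proof -
      have "x $ i = homogenize x $ Some i" by (simp add: homogenize_def)
      also have "\<dots> = (\<Sum>j\<in>UNIV. N $ Some i $ j * \<beta> $ j)" unfolding \<beta> by (simp add: matrix_vector_mult_def)
      also have "\<dots> = (\<Sum>j\<in>UNIV. u j * (N $ Some i $ j / N $ None $ j))"
        using pos by (intro sum.cong) (auto simp: u_def less_imp_neq[symmetric])
      finally show ?thesis .
    qed
    then show ?thesis by (simp add: vec_eq_iff proj_point_def column_def)
  qed
  also have "\<dots> \<in> simplex_of_columns N"
    unfolding simplex_of_columns_def
    using u0 u1 by (intro convex_sum) (auto intro: hull_inc)
  finally show "x \<in> simplex_of_columns N" .
qed

text \<open>
  \<open>bary x k\<close> is the barycentric coordinate of \<open>x\<close> at the vertex \<open>v\<^sub>k\<^sub>+\<^sub>1\<close>. The columns of \<open>V\<close> list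
  the vertices other than the origin with decreasing number of ones, which reverses the order of
  the affine coordinates.
\<close>

definition coord :: "'n::{finite,linorder} point \<Rightarrow> nat \<Rightarrow> real" where
  "coord x m = (if m = 0 then 1 else if m \<le> CARD('n) then homogenize x $ (inv_into UNIV ix (m - 1)) else 0)"

definition bary :: "'n::{finite,linorder} point \<Rightarrow> nat \<Rightarrow> real" where
  "bary x k = (if k = 0 then 1 - coord x 1 else coord x (CARD('n) + 1 - k) - coord x (CARD('n) + 2 - k))"

definition point_of :: "(nat \<Rightarrow> real) \<Rightarrow> 'n::{finite,linorder} point" where
  "point_of b = (\<chi> i. \<Sum>k = 1..CARD('n) - ix (Some i). b k)"

lemma coord_ix: "coord x (Suc (ix (Some i))) = x $ i"
  using ix_Some_less[of i] bij_betw_inv_into_left[OF bij_ix, of "Some i"]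
  by (simp add: coord_def homogenize_def Suc_le_eq)

text \<open>\<open>coord\<close> pads the affine coordinates by 1 in front and 0 behind, so the
  barycentric coordinates are the differences along the chain 1, x_1, ..., x_n, 0 and their sums
  telescope.\<close>

lemma sum_bary_part:
  fixes x :: "'n::{finite,linorder} point"
  assumes "m \<le> CARD('n)"
  shows "(\<Sum>k = 1..m. bary x k) = coord x (CARD('n) + 1 - m)"
  using assms
proof (induction m)
  case 0
  then show ?case by (simp add: coord_def)
next
  case (Suc m)
  have "CARD('n) + 2 - Suc m = CARD('n) + 1 - m" by simp
  then show ?case using Suc by (simp add: bary_def)
qed

lemma sum_bary [simp]: "(\<Sum>k\<le>CARD('n). bary (x :: 'n::{finite,linorder} point) k) = 1"
proof -
  have "(\<Sum>k\<le>CARD('n). bary x k) = bary x 0 + (\<Sum>k = 1..CARD('n). bary x k)"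
    by (simp add: atMost_atLeast0 sum.atLeast_Suc_atMost)
  then show ?thesis by (subst (asm) sum_bary_part) (simp_all add: bary_def)
qed

lemma homogenize_bary: "homogenize x = V_mat *v (vec_of (bary x) :: 'n::{finite,linorder} proj_vector)"
proof -
  have "homogenize x $ i = (V_mat *v vec_of (bary x)) $ i" for i :: "'n option"
  proof (cases i)
    case None
    then show ?thesis by (simp add: V_mat_vec_of homogenize_def)
  next
    case (Some j)
    have "(V_mat *v vec_of (bary x)) $ i = coord x (CARD('n) + 1 - (CARD('n) - ix i))"
      using Some by (simp only: V_mat_vec_of) (subst sum_bary_part, simp_all)
    also have "CARD('n) + 1 - (CARD('n) - ix i) = Suc (ix (Some j))"
      using ix_Some_less[of j] Some by simp
    finally show ?thesis by (simp only: coord_ix) (simp add: Some homogenize_def)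
  qed
  then show ?thesis by (simp add: vec_eq_iff)
qed

lemma homogenize_point_of:
  assumes "(\<Sum>k\<le>CARD('n). b k) = 1"
  shows "homogenize (point_of b) = V_mat *v (vec_of b :: 'n::{finite,linorder} proj_vector)"
  using assms by (auto simp: vec_eq_iff V_mat_vec_of homogenize_def point_of_def split: option.split)

lemma bary_unique:
  assumes "homogenize x = V_mat *v (vec_of b :: 'n::{finite,linorder} proj_vector)" "k \<le> CARD('n)"
  shows "bary x k = b k"
proof -
  have "V_mat *v vec_of (bary x) = V_mat *v (vec_of b :: 'n proj_vector)"
    using assms homogenize_bary by metis
  then have "(vec_of (bary x) :: 'n proj_vector) = vec_of b"
    by (metis V_mat_inv)
  then show ?thesis using assms by (simp add: vec_of_eq_iff)
qed

lemma bary_point_of: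
  assumes "(\<Sum>k\<le>CARD('n). b k) = 1" "k \<le> CARD('n)"
  shows "bary (point_of b :: 'n::{finite,linorder} point) k = b k"
  using homogenize_point_of[OF assms(1)] assms(2) by (rule bary_unique)

lemma bary_eqI:
  assumes "\<And>k. k \<le> CARD('n) \<Longrightarrow> bary (x :: 'n::{finite,linorder} point) k = bary y k"
  shows "x = y"
proof -
  have "homogenize x = homogenize y"
    using assms vec_of_eq_iff[of "bary x" "bary y", where 'n='n] by (simp add: homogenize_bary)
  then have "homogenize x $ Some i = homogenize y $ Some i" for i by simp
  then show ?thesis by (simp add: homogenize_def vec_eq_iff)
qed

lemma bary_affine:
  assumes "k \<le> CARD('n)"
  shows "bary (u *\<^sub>R x + (1 - u) *\<^sub>R y :: 'n::{finite,linorder} point) k = u * bary x k + (1 - u) * bary y k"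
proof (rule bary_unique[OF _ assms])
  have "homogenize (u *\<^sub>R x + (1 - u) *\<^sub>R y) = u *\<^sub>R homogenize x + (1 - u) *\<^sub>R homogenize y"
    by (auto simp: homogenize_def vec_eq_iff split: option.split)
  also have "\<dots> = V_mat *v (u *\<^sub>R vec_of (bary x) + (1 - u) *\<^sub>R vec_of (bary y))"
    by (simp add: homogenize_bary matrix_vector_right_distrib matrix_vector_mult_scaleR)
  also have "u *\<^sub>R vec_of (bary x) + (1 - u) *\<^sub>R vec_of (bary y) =
      (vec_of (\<lambda>k. u * bary x k + (1 - u) * bary y k) :: 'n proj_vector)"
    by (simp add: vec_eq_iff)
  finally show "homogenize (u *\<^sub>R x + (1 - u) *\<^sub>R y) = V_mat *v vec_of (\<lambda>k. u * bary x k + (1 - u) * bary y k)" .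
qed

lemma nth_bary: "(x :: 'n::{finite,linorder} point) $ i = (\<Sum>k = 1..CARD('n) - ix (Some i). bary x k)"
proof -
  have "x $ i = homogenize x $ Some i" by (simp add: homogenize_def)
  then show ?thesis by (simp add: homogenize_bary V_mat_vec_of)
qed

lemma coord_cases:
  "coord (x :: 'n::{finite,linorder} point) m = 0 \<or> coord x m = 1 \<or> (\<exists>i. coord x m = x $ i)"
proof (cases "1 \<le> m \<and> m \<le> CARD('n)")
  case True
  then have "m - 1 < CARD('n)" by auto
  then obtain i :: 'n where "ix (Some i) = m - 1" by (rule ix_Some_surj)
  then show ?thesis using coord_ix[of x i] True by auto
qed (auto simp: coord_def)

lemma continuous_on_bary [continuous_intros]: "continuous_on S (\<lambda>x :: 'n::{finite,linorder} point. bary x k)"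
proof -
  have "continuous_on S (\<lambda>x :: 'n point. coord x m)" for m
  proof (cases "1 \<le> m \<and> m \<le> CARD('n)")
    case True
    then have "m - 1 < CARD('n)" by auto
    then obtain i :: 'n where "ix (Some i) = m - 1" by (rule ix_Some_surj)
    then have "coord x m = x $ i" for x using coord_ix[of x i] True by auto
    then show ?thesis by (auto intro: continuous_intros)
  qed (auto simp: coord_def)
  then show ?thesis unfolding bary_def by (cases "k = 0") (auto intro!: continuous_intros)
qed

section \<open>The simplex and its halves in barycentric coordinates\<close>

lemma Delta_iff: "(x :: 'n::{finite,linorder} point) \<in> Delta \<longleftrightarrow> (\<forall>k\<le>CARD('n). 0 \<le> bary x k)"
proof -
  have "V_mat $ None $ j > 0" for j :: "'n option" by (simp add: V_mat_def)
  then have "x \<in> Delta \<longleftrightarrow> (\<exists>\<beta>. (\<forall>j. \<beta> $ j \<ge> 0) \<and> homogenize x = V_mat *v \<beta>)"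
    unfolding Delta_def by (rule simplex_of_columns_iff)
  also have "\<dots> \<longleftrightarrow> (\<forall>j. (vec_of (bary x) :: 'n proj_vector) $ j \<ge> 0)"
    using homogenize_bary[of x] V_mat_inv by metis
  also have "\<dots> \<longleftrightarrow> (\<forall>k\<le>CARD('n). 0 \<le> bary x k)"
    by (metis ix_le ix_surj vec_of_nth)
  finally show ?thesis .
qed

lemma VK_mat_None_pos: "(V_mat ** A_mat a) $ None $ (j :: 'n::{finite,linorder} option) > 0"
proof -
  let ?n = "CARD('n)" let ?e = "\<lambda>k. if k = ix j then 1 else (0::real)"
  have n: "1 \<le> ?n" by (simp add: Suc_leI)
  have "(V_mat ** A_mat a) $ None $ j = ((V_mat ** A_mat a) *v (vec_of ?e :: 'n proj_vector)) $ None"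
    by (simp add: matrix_vector_mult_def if_distrib[of "\<lambda>x. _ * x"] cong: if_cong)
  also have "\<dots> = (\<Sum>k\<le>?n. inv_lin ?n 1 a ?e k)"
    by (simp add: matrix_vector_mul_assoc[symmetric] K_mat_1[symmetric] K_mat_vec_of V_mat_vec_of)
  also have "\<dots> > 0"
  proof (rule sum_pos2)
    \<comment> \<open>A row where column j of \<open>A_mat a\<close> has a 1: row 0 or 1 according
      to \<open>a\<close> for the first column, row 0 for the last one, and row j + 1 in
      between.\<close>
    show "(if ix j = 0 then if a then 1 else 0 else if ix j = ?n then 0 else ix j + 1) \<in> {..?n}"
      using ix_le[of j] n by auto
    show "0 < inv_lin ?n 1 a ?e (if ix j = 0 then if a then 1 else 0 else if ix j = ?n then 0 else ix j + 1)"
      using n by (auto simp: inv_lin_def)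
  qed (auto simp: inv_lin_def)
  finally show ?thesis .
qed

text \<open>The coordinates of x with respect to the columns of \<open>V_mat ** A_mat a\<close> are
  given by \<open>step_lin\<close> with c = 1. Position 0 being non-negative orders b_0 and b_1 as
  \<open>a\<close> prescribes; position n says that the smaller of them is non-negative, and the
  positions in between give the remaining coordinates.\<close>

lemma Delta_half_iff:
  "(x :: 'n::{finite,linorder} point) \<in> Delta_half a \<longleftrightarrow>
     x \<in> Delta \<and> (if a then bary x 0 \<le> bary x 1 else bary x 1 \<le> bary x 0)"
proof -
  let ?n = "CARD('n)"
  have n: "1 \<le> ?n" by (simp add: Suc_leI)
  have "x \<in> Delta_half a \<longleftrightarrow> (\<exists>\<beta>. (\<forall>j. \<beta> $ j \<ge> 0) \<and> homogenize x = (V_mat ** A_mat a) *v \<beta>)"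
    unfolding Delta_half_def using simplex_of_columns_iff[OF VK_mat_None_pos] .
  also have "\<dots> \<longleftrightarrow> (\<exists>b. (\<forall>k\<le>?n. b k \<ge> 0) \<and> homogenize x = (V_mat ** A_mat a) *v vec_of b)"
  proof
    assume "\<exists>\<beta>. (\<forall>j. \<beta> $ j \<ge> 0) \<and> homogenize x = (V_mat ** A_mat a) *v \<beta>"
    then obtain \<beta> :: "'n proj_vector" where \<beta>: "\<forall>j. \<beta> $ j \<ge> 0" "homogenize x = (V_mat ** A_mat a) *v \<beta>" by auto
    obtain b where b: "\<beta> = vec_of b" by (rule vec_of_surj)
    have "b k \<ge> 0" if "k \<le> ?n" for k
      using that \<beta>(1) ix_surj[of k, where 'n='n] b by (metis vec_of_nth)
    with \<beta> b show "\<exists>b. (\<forall>k\<le>?n. b k \<ge> 0) \<and> homogenize x = (V_mat ** A_mat a) *v vec_of b" by auto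
  next
    assume "\<exists>b. (\<forall>k\<le>?n. b k \<ge> 0) \<and> homogenize x = (V_mat ** A_mat a) *v vec_of b"
    then obtain b where "\<forall>k\<le>?n. b k \<ge> 0" "homogenize x = (V_mat ** A_mat a) *v vec_of b" by auto
    then show "\<exists>\<beta>. (\<forall>j. \<beta> $ j \<ge> 0) \<and> homogenize x = (V_mat ** A_mat a) *v \<beta>"
      using ix_le by (intro exI[of _ "vec_of b"]) auto
  qed
  also have "\<dots> \<longleftrightarrow> (\<exists>b. (\<forall>k\<le>?n. b k \<ge> 0) \<and> (\<forall>k\<le>?n. bary x k = inv_lin ?n 1 a b k))"
  proof -
    have "homogenize x = (V_mat ** A_mat a) *v vec_of b \<longleftrightarrow> (\<forall>k\<le>?n. bary x k = inv_lin ?n 1 a b k)" for b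
    proof -
      have "(V_mat ** A_mat a) *v vec_of b = V_mat *v (vec_of (inv_lin ?n 1 a b) :: 'n proj_vector)"
        by (simp add: matrix_vector_mul_assoc[symmetric] K_mat_1[symmetric] K_mat_vec_of)
      then show ?thesis
        using homogenize_bary[of x] V_mat_inv vec_of_eq_iff[of "bary x" "inv_lin ?n 1 a b", where 'n='n] by metis
    qed
    then show ?thesis by simp
  qed
  also have "\<dots> \<longleftrightarrow> (\<forall>k\<le>?n. step_lin ?n 1 a (bary x) k \<ge> 0)"
  proof safe
    fix b k assume b: "\<forall>k\<le>?n. 0 \<le> b k" "\<forall>k\<le>?n. bary x k = inv_lin ?n 1 a b k" and k: "k \<le> ?n"
    then have "step_lin ?n 1 a (bary x) k = step_lin ?n 1 a (inv_lin ?n 1 a b) k"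
      using n by (simp add: step_lin_def)
    then show "0 \<le> step_lin ?n 1 a (bary x) k" using b k n by (simp add: step_inv_lin)
  next
    assume *: "\<forall>k\<le>?n. 0 \<le> step_lin ?n 1 a (bary x) k"
    show "\<exists>b. (\<forall>k\<le>?n. b k \<ge> 0) \<and> (\<forall>k\<le>?n. bary x k = inv_lin ?n 1 a b k)"
      using * n by (intro exI[of _ "step_lin ?n 1 a (bary x)"]) (simp add: inv_step_lin)
  qed
  also have "\<dots> \<longleftrightarrow> x \<in> Delta \<and> (if a then bary x 0 \<le> bary x 1 else bary x 1 \<le> bary x 0)"
  proof
    assume *: "\<forall>k\<le>?n. step_lin ?n 1 a (bary x) k \<ge> 0"
    have s0: "if a then bary x 0 \<le> bary x 1 else bary x 1 \<le> bary x 0"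
      using *[rule_format, of 0] by (simp add: step_lin_def split: if_splits)
    have sn: "0 \<le> (if a then bary x 0 else bary x 1)"
      using *[rule_format, of ?n] n by (simp add: step_lin_def)
    have "0 \<le> bary x k" if "k \<le> ?n" for k
    proof (cases "2 \<le> k")
      case True
      then have "k - 1 \<noteq> 0" "k - 1 < ?n" "Suc (k - 1) = k" using that by auto
      then show ?thesis using *[rule_format, of "k - 1"] by (simp add: step_lin_def)
    next
      case False
      then have "k = 0 \<or> k = 1" by auto
      then show ?thesis using s0 sn by (auto split: if_splits)
    qed
    with s0 show "x \<in> Delta \<and> (if a then bary x 0 \<le> bary x 1 else bary x 1 \<le> bary x 0)"
      by (simp add: Delta_iff)
  next
    assume "x \<in> Delta \<and> (if a then bary x 0 \<le> bary x 1 else bary x 1 \<le> bary x 0)"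
    then show "\<forall>k\<le>?n. step_lin ?n 1 a (bary x) k \<ge> 0"
      using n by (auto simp: Delta_iff step_lin_def)
  qed
  finally show ?thesis .
qed

text \<open>The last row of \<open>V_mat\<close> consists of ones, so the last projective coordinate
  of the image is its coordinate sum, and passing to the affine point is normalization.\<close>

lemma proj_action_step:
  fixes x :: "'n::{finite,linorder} point"
  assumes c: "c \<noteq> 0" and s: "(\<Sum>j\<le>CARD('n). step_lin CARD('n) c a (bary x) j) > 0" and k: "k \<le> CARD('n)"
  shows "bary (proj_action (V_mat ** matrix_inv (K_mat c a) ** matrix_inv V_mat) x) k =
     step_lin CARD('n) c a (bary x) k / (\<Sum>j\<le>CARD('n). step_lin CARD('n) c a (bary x) j)"
proof (rule bary_unique[OF _ k])
  let ?n = "CARD('n)"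
  define b s where "b = step_lin ?n c a (bary x)" and "s = (\<Sum>j\<le>?n. b j)"
  have "(V_mat ** matrix_inv (K_mat c a) ** matrix_inv V_mat) *v homogenize x = V_mat *v (vec_of b :: 'n proj_vector)"
    using c by (simp add: homogenize_bary matrix_vector_mul_assoc[symmetric] V_mat_inv K_mat_inv b_def)
  moreover have "homogenize (proj_point (V_mat *v vec_of b)) = V_mat *v (vec_of (\<lambda>k. b k / s) :: 'n proj_vector)"
  proof -
    have "s \<noteq> 0" using assms by (simp add: b_def s_def)
    then show ?thesis
      by (auto simp: vec_eq_iff V_mat_vec_of homogenize_def proj_point_def s_def sum_divide_distrib[symmetric]
          split: option.split)
  qed
  ultimately show "homogenize (proj_action (V_mat ** matrix_inv (K_mat c a) ** matrix_inv V_mat) x) =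
     V_mat *v (vec_of (\<lambda>k. step_lin ?n c a (bary x) k / (\<Sum>j\<le>?n. step_lin ?n c a (bary x) j)) :: 'n proj_vector)"
    unfolding proj_action_def by (simp add: b_def s_def)
qed

section \<open>The subtractive algorithm on barycentric coordinates\<close>

text \<open>A step replaces b_0 + b_1 by a difference of the two plus c times the subtracted one, a
  loss of 2 - c times the latter.\<close>

lemma sum_step_lin:
  assumes "1 \<le> n"
  shows "(\<Sum>k\<le>n. step_lin n c a b k) = (\<Sum>k\<le>n. b k) - (2 - c) * (if a then b 0 else b 1)"
proof -
  obtain m where n: "n = Suc m" using assms by (cases n) auto
  have "(\<Sum>k\<le>n. step_lin n c a b k) =
      step_lin n c a b 0 + ((\<Sum>i<m. step_lin n c a b (Suc i)) + step_lin n c a b n)"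
    unfolding n by (simp only: sum.atMost_Suc_shift) (simp add: lessThan_Suc_atMost[symmetric])
  also have "(\<Sum>i<m. step_lin n c a b (Suc i)) = (\<Sum>i<m. b (Suc (Suc i)))"
    by (intro sum.cong) (auto simp: step_lin_def n)
  finally have "(\<Sum>k\<le>n. step_lin n c a b k) =
      step_lin n c a b 0 + ((\<Sum>i<m. b (Suc (Suc i))) + step_lin n c a b n)" .
  moreover have "(\<Sum>k\<le>n. b k) = b 0 + (b 1 + (\<Sum>i<m. b (Suc (Suc i))))"
    unfolding n by (simp add: sum.atMost_Suc_shift lessThan_Suc_atMost[symmetric] sum.lessThan_Suc_shift
        del: sum.atMost_Suc sum.lessThan_Suc)
  ultimately show ?thesis using assms by (simp add: step_lin_def algebra_simps)
qed

lemma sum_inv_lin: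
  assumes "1 \<le> n" "c \<noteq> 0"
  shows "(\<Sum>k\<le>n. inv_lin n c a b k) = (\<Sum>k\<le>n. b k) + (2 / c - 1) * b n"
proof -
  have "(\<Sum>k\<le>n. b k) = (\<Sum>k\<le>n. step_lin n c a (inv_lin n c a b) k)"
    using assms by (simp add: step_inv_lin)
  also have "\<dots> = (\<Sum>k\<le>n. inv_lin n c a b k) - (2 - c) * (if a then inv_lin n c a b 0 else inv_lin n c a b 1)"
    by (rule sum_step_lin[OF assms(1)])
  also have "(if a then inv_lin n c a b 0 else inv_lin n c a b 1) = b n / c"
    by (simp add: inv_lin_def)
  also have "(2 - c) * (b n / c) = (2 / c - 1) * b n"
    using assms(2) by (simp add: field_simps)
  finally show ?thesis by simp
qed

lemma step_lin_scale: "step_lin n c a (\<lambda>k. b k * d) k = step_lin n c a b k * d"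
  by (auto simp: step_lin_def algebra_simps)

lemma inv_lin_scale: "inv_lin n c a (\<lambda>k. b k * d) k = inv_lin n c a b k * d"
  by (auto simp: inv_lin_def algebra_simps)

lemma step_lin_comb:
  "step_lin n c a (\<lambda>k. u * b k + v * b' k) k = u * step_lin n c a b k + v * step_lin n c a b' k"
  by (auto simp: step_lin_def algebra_simps)

lemma inv_lin_comb:
  "inv_lin n c a (\<lambda>k. u * b k + v * b' k) k = u * inv_lin n c a b k + v * inv_lin n c a b' k"
  by (auto simp: inv_lin_def algebra_simps add_divide_distrib)

lemma step_lin_cong: "1 \<le> n \<Longrightarrow> k \<le> n \<Longrightarrow> (\<And>j. j \<le> n \<Longrightarrow> b j = b' j) \<Longrightarrow> step_lin n c a b k = step_lin n c a b' k"
  by (auto simp: step_lin_def)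

lemma inv_lin_cong: "1 \<le> n \<Longrightarrow> k \<le> n \<Longrightarrow> (\<And>j. j \<le> n \<Longrightarrow> b j = b' j) \<Longrightarrow> inv_lin n c a b k = inv_lin n c a b' k"
  by (auto simp: inv_lin_def)

lemma card_ge_1: "1 \<le> CARD('n::finite)"
  by (simp add: Suc_leI)

text \<open>A tie gets the digit 0, as in the case distinctions of \<open>M_map\<close> and
  \<open>T_map\<close>. So each point of \<open>Delta\<close> has a canonical code, determined by
  its orbit.\<close>

definition digit :: "'n::{finite,linorder} point \<Rightarrow> bool" where
  "digit x \<longleftrightarrow> bary x 0 < bary x 1"

section \<open>Points and vertices of the simplex\<close>

lemma Delta_half_digit: "x \<in> Delta \<Longrightarrow> x \<in> Delta_half (digit x)"
  by (simp add: Delta_half_iff digit_def)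

lemma Delta_half_subset: "x \<in> Delta_half a \<Longrightarrow> x \<in> Delta"
  by (simp add: Delta_half_iff)

lemma bary_ge_0: "(x :: 'n::{finite,linorder} point) \<in> Delta \<Longrightarrow> k \<le> CARD('n) \<Longrightarrow> 0 \<le> bary x k"
  by (simp add: Delta_iff)

lemma bary_add_le_1:
  assumes "(x :: 'n::{finite,linorder} point) \<in> Delta" "i \<noteq> j" "i \<le> CARD('n)" "j \<le> CARD('n)"
  shows "bary x i + bary x j \<le> 1"
proof -
  have "(\<Sum>k\<in>{i, j}. bary x k) \<le> (\<Sum>k\<le>CARD('n). bary x k)"
    using assms by (intro sum_mono2) (auto simp: bary_ge_0)
  then show ?thesis using assms by simp
qed

lemma bary_le_1:
  assumes "(x :: 'n::{finite,linorder} point) \<in> Delta" "i \<le> CARD('n)"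
  shows "bary x i \<le> 1"
  using member_le_sum[of i "{..CARD('n)}" "bary x"] assms by (simp add: bary_ge_0)

lemma bary_comb:
  assumes "k \<le> CARD('n)"
  shows "bary ((1 - u) *\<^sub>R x + u *\<^sub>R y :: 'n::{finite,linorder} point) k = (1 - u) * bary x k + u * bary y k"
  using bary_affine[OF assms, of "1 - u" x y] by simp

lemma bary_column: "bary (proj_point (column j V_mat) :: 'n::{finite,linorder} point) k = (if k = ix j then 1 else 0)"
  if "k \<le> CARD('n)"
proof (rule bary_unique[OF _ that])
  have "(V_mat :: 'n proj_matrix) $ None $ j = 1" by (simp add: V_mat_def)
  then have "homogenize (proj_point (column j V_mat)) = column j (V_mat :: 'n proj_matrix)"
    by (auto simp: vec_eq_iff homogenize_def proj_point_def column_def split: option.split)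
  also have "\<dots> = V_mat *v (vec_of (\<lambda>k. if k = ix j then 1 else 0) :: 'n proj_vector)"
    by (simp add: vec_eq_iff matrix_vector_mult_def column_def if_distrib[of "\<lambda>x. _ * x"] cong: if_cong)
  finally show "homogenize (proj_point (column j V_mat) :: 'n point) =
      V_mat *v vec_of (\<lambda>k. if k = ix j then 1 else 0)" .
qed

lemma bary_v1: "k \<le> CARD('n) \<Longrightarrow> bary (v1 :: 'n::{finite,linorder} point) k = (if k = 0 then 1 else 0)"
proof -
  have "{..Min UNIV} = {Min UNIV :: 'n}" by (auto intro: antisym)
  then have "ix (Some (Min UNIV :: 'n)) = 0" by (simp add: ix_def)
  then show "k \<le> CARD('n) \<Longrightarrow> ?thesis" by (simp add: v1_def bary_column)
qed

lemma v1_Delta: "v1 \<in> Delta"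
  by (simp add: Delta_iff bary_v1)

lemma v1_eqI:
  assumes "(x :: 'n::{finite,linorder} point) \<in> Delta" "bary x 0 = 1"
  shows "x = v1"
proof (rule bary_eqI)
  fix k assume k: "k \<le> CARD('n)"
  show "bary x k = bary (v1 :: 'n point) k"
    using bary_add_le_1[OF assms(1), of 0 k] bary_ge_0[OF assms(1) k] assms k bary_v1[OF k] by (cases "k = 0") auto
qed

lemma v1_extreme: "v1 extreme_point_of (Delta :: 'n::{finite,linorder} point set)"
  unfolding extreme_point_of_def
proof (intro conjI ballI notI)
  fix x y :: "'n point" assume xy: "x \<in> Delta" "y \<in> Delta" "v1 \<in> open_segment x y"
  then obtain u where u: "0 < u" "u < 1" "v1 = (1 - u) *\<^sub>R x + u *\<^sub>R y" and ne: "x \<noteq> y"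
    by (auto simp: in_segment)
  have "1 = (1 - u) * bary x 0 + u * bary y 0"
    using bary_affine[of 0 "1 - u" x y] u by (simp add: bary_v1)
  moreover have "(1 - u) * bary x 0 \<le> (1 - u) * 1" "u * bary y 0 \<le> u * 1"
    using u bary_le_1[OF xy(1), of 0] bary_le_1[OF xy(2), of 0] by (auto intro!: mult_left_mono)
  ultimately have "(1 - u) * bary x 0 = (1 - u) * 1" "u * bary y 0 = u * 1" by argo+
  then have "x = v1" "y = v1" using u xy by (auto intro: v1_eqI)
  with ne show False by simp
qed (rule v1_Delta)

lemma extreme_Delta_unit:
  assumes "(x :: 'n::{finite,linorder} point) extreme_point_of Delta"
  obtains k where "k \<le> CARD('n)" "bary x k = 1"
proof -
  have "x \<in> range (\<lambda>j. proj_point (column j V_mat))"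
    using assms extreme_point_of_convex_hull unfolding Delta_def simplex_of_columns_def by blast
  then obtain j where "x = proj_point (column j V_mat)" by auto
  then show ?thesis using that[of "ix j"] by (simp add: bary_column ix_le)
qed

text \<open>A map that becomes affine after multiplication by a positive affine function
  \<open>d\<close> sends segments to segments; only the parameter is reweighted, from
  \<open>u\<close> to \<open>u * d y / d z\<close>. Applied to \<open>R\<close> on a half and to the
  inverse branches.\<close>

lemma projective_segment:
  fixes F :: "'n::{finite,linorder} point \<Rightarrow> 'n point"
  assumes z: "z \<in> open_segment x y" and ne: "F x \<noteq> F y"
    and d: "d x > 0" "d y > 0" "\<And>u. d ((1 - u) *\<^sub>R x + u *\<^sub>R y) = (1 - u) * d x + u * d y"
    and F: "\<And>u k. 0 < u \<Longrightarrow> u < 1 \<Longrightarrow> k \<le> CARD('n) \<Longrightarrow>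
      d ((1 - u) *\<^sub>R x + u *\<^sub>R y) * bary (F ((1 - u) *\<^sub>R x + u *\<^sub>R y)) k =
      (1 - u) * (d x * bary (F x) k) + u * (d y * bary (F y) k)"
  shows "F z \<in> open_segment (F x) (F y)"
proof -
  obtain u where u: "0 < u" "u < 1" "z = (1 - u) *\<^sub>R x + u *\<^sub>R y" using z by (auto simp: in_segment)
  define v where "v = u * d y / d z"
  have dz: "d z = (1 - u) * d x + u * d y" using d(3)[of u] u by simp
  have "(1 - u) * d x > 0" "u * d y > 0" using u d by auto
  then have dz0: "d z > 0" and v: "0 < v" "v < 1" by (auto simp: v_def dz field_simps)
  have v': "1 - v = (1 - u) * d x / d z" using dz0 by (simp add: v_def dz field_simps)
  have "F z = (1 - v) *\<^sub>R F x + (1 - (1 - v)) *\<^sub>R F y"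
  proof (rule bary_eqI)
    fix k assume k: "k \<le> CARD('n)"
    have "d z * bary (F z) k = (1 - u) * (d x * bary (F x) k) + u * (d y * bary (F y) k)"
      using F[OF u(1,2) k] u by simp
    then have "bary (F z) k = ((1 - u) * (d x * bary (F x) k) + u * (d y * bary (F y) k)) / d z"
      using dz0 by (simp add: field_simps)
    also have "\<dots> = (1 - v) * bary (F x) k + v * bary (F y) k"
      unfolding v' unfolding v_def using dz0 by (simp add: add_divide_distrib)
    finally show "bary (F z) k = bary ((1 - v) *\<^sub>R F x + (1 - (1 - v)) *\<^sub>R F y) k"
      by (simp only: bary_affine[OF k]) simp
  qed
  then show ?thesis using v ne by (auto simp: in_segment)
qed

text \<open>The interface through which both maps enter the common theory. The denominator is the
  coordinate sum of the \<open>step_lin\<close> vector, by \<open>sum_step_lin\<close>, and equals 1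
  for c = 2.\<close>

locale bary_map =
  fixes R :: "'n::{finite,linorder} point \<Rightarrow> 'n point" and c :: real
  assumes c: "c = 1 \<or> c = 2"
    and R_digit: "x \<in> Delta \<Longrightarrow> k \<le> CARD('n) \<Longrightarrow>
      bary (R x) k = step_lin CARD('n) c (digit x) (bary x) k /
        (1 - (2 - c) * (if digit x then bary x 0 else bary x 1))"
begin

definition den :: "bool \<Rightarrow> 'n point \<Rightarrow> real" where
  "den a x = 1 - (2 - c) * (if a then bary x 0 else bary x 1)"

lemma c0: "c > 0" using c by auto

lemma den_pos:
  assumes "x \<in> Delta_half a"
  shows "den a x > 0"
  using assms bary_add_le_1[of x 0 1] card_ge_1[where 'n='n] c
  by (auto simp: den_def Delta_half_iff split: if_splits)

lemma R_half:
  assumes x: "x \<in> Delta_half a" and k: "k \<le> CARD('n)"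
  shows "bary (R x) k = step_lin CARD('n) c a (bary x) k / den a x"
proof (cases "digit x = a")
  case True
  then show ?thesis using R_digit[of x k] x k by (simp add: den_def Delta_half_iff)
next
  case False
  then have "bary x 0 = bary x 1" using x by (auto simp: Delta_half_iff digit_def split: if_splits)
  then show ?thesis using R_digit[of x k] x k by (simp add: den_def Delta_half_iff step_lin_def)
qed

lemma R_Delta:
  assumes "x \<in> Delta"
  shows "R x \<in> Delta"
proof -
  have x: "x \<in> Delta_half (digit x)" using assms by (rule Delta_half_digit)
  have "step_lin CARD('n) c (digit x) (bary x) k \<ge> 0" if "k \<le> CARD('n)" for k
    using that assms c card_ge_1[where 'n='n] by (auto simp: step_lin_def Delta_iff digit_def)
  then show ?thesis using R_half[OF x] den_pos[OF x] by (simp add: Delta_iff)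
qed

lemma funpow_Delta: "x \<in> Delta \<Longrightarrow> (R ^^ t) x \<in> Delta"
  by (induction t) (auto simp: R_Delta)

text \<open>The inverse of \<open>R\<close> on the half \<open>a\<close>. By
  \<open>sum_inv_lin\<close> the denominator is the coordinate sum of the numerators.\<close>

definition branch :: "bool \<Rightarrow> 'n point \<Rightarrow> 'n point" where
  "branch a y = point_of (\<lambda>k. inv_lin CARD('n) c a (bary y) k / (1 + (2 / c - 1) * bary y CARD('n)))"

lemma branch_den_pos: "(y :: 'n point) \<in> Delta \<Longrightarrow> 1 + (2 / c - 1) * bary y CARD('n) > 0"
  using c bary_ge_0[of y "CARD('n)"] by auto

lemma bary_branch:
  assumes y: "y \<in> Delta" and k: "k \<le> CARD('n)"
  shows "bary (branch a y) k = inv_lin CARD('n) c a (bary y) k / (1 + (2 / c - 1) * bary y CARD('n))"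
  unfolding branch_def
proof (rule bary_point_of[OF _ k])
  show "(\<Sum>k\<le>CARD('n). inv_lin CARD('n) c a (bary y) k / (1 + (2 / c - 1) * bary y CARD('n))) = 1"
    using branch_den_pos[OF y] c0 by (simp add: sum_divide_distrib[symmetric] sum_inv_lin card_ge_1)
qed

lemma branch_half:
  assumes y: "y \<in> Delta"
  shows "branch a y \<in> Delta_half a"
proof -
  let ?n = "CARD('n)"
  have "inv_lin ?n c a (bary y) k \<ge> 0" if "k \<le> ?n" for k
    using y that c0 by (auto simp: inv_lin_def Delta_iff)
  moreover have "if a then inv_lin ?n c a (bary y) 0 \<le> inv_lin ?n c a (bary y) 1
      else inv_lin ?n c a (bary y) 1 \<le> inv_lin ?n c a (bary y) 0"
    using y by (auto simp: inv_lin_def Delta_iff)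
  ultimately show ?thesis
    using branch_den_pos[OF y] card_ge_1[where 'n='n] y
    by (auto simp: Delta_half_iff Delta_iff bary_branch divide_right_mono simp del: One_nat_def split: if_splits)
qed

text \<open>Undoing the linear step recovers a point from its image up to the factor
  \<open>den a x\<close>, and the coordinate sum 1 determines this factor.\<close>

lemma R_inj:
  assumes x: "x \<in> Delta_half a" and y: "y \<in> Delta_half a" and eq: "R x = R y"
  shows "x = y"
proof -
  let ?n = "CARD('n)"
  have *: "bary z k = inv_lin ?n c a (bary (R z)) k * den a z" if z: "z \<in> Delta_half a" and k: "k \<le> ?n" for z k
  proof -
    have "bary z k = inv_lin ?n c a (step_lin ?n c a (bary z)) k"
      using c0 k by (simp add: inv_step_lin card_ge_1)
    also have "\<dots> = inv_lin ?n c a (\<lambda>k. bary (R z) k * den a z) k"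
      using R_half[OF z] den_pos[OF z] k by (intro inv_lin_cong) (auto simp: card_ge_1)
    finally show ?thesis by (simp add: inv_lin_scale)
  qed
  have "1 = (\<Sum>k\<le>?n. inv_lin ?n c a (bary (R z)) k) * den a z" if "z \<in> Delta_half a" for z
    using sum_bary[of z] *[OF that] by (simp add: sum_distrib_right del: sum_bary)
  from this[OF x] this[OF y] eq have "den a x = den a y"
    by (metis mult_cancel_left mult_zero_left zero_neq_one)
  then show ?thesis using *[OF x] *[OF y] eq by (intro bary_eqI) simp
qed

lemma R_branch:
  assumes y: "y \<in> Delta"
  shows "R (branch a y) = y"
proof (rule bary_eqI)
  let ?n = "CARD('n)"
  define s where "s = 1 / (1 + (2 / c - 1) * bary y ?n)"
  have s: "s > 0" using branch_den_pos[OF y] by (simp add: s_def)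
  have st: "step_lin ?n c a (bary (branch a y)) k = bary y k * s" if "k \<le> ?n" for k
  proof -
    have "step_lin ?n c a (bary (branch a y)) k = step_lin ?n c a (\<lambda>k. inv_lin ?n c a (bary y) k * s) k"
      using that by (intro step_lin_cong) (auto simp: card_ge_1 bary_branch y s_def)
    then show ?thesis using that c0 by (simp add: step_lin_scale step_inv_lin card_ge_1)
  qed
  have "den a (branch a y) = (\<Sum>k\<le>?n. step_lin ?n c a (bary (branch a y)) k)"
    by (simp add: sum_step_lin card_ge_1 den_def)
  also have "\<dots> = s" using st sum_distrib_right[of "bary y" "{..?n}" s] by simp
  finally have d: "den a (branch a y) = s" .
  fix k assume "k \<le> ?n"
  then show "bary (R (branch a y)) k = bary y k"
    using R_half[OF branch_half[OF y]] st s by (simp add: d)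
qed

lemma branch_R: "x \<in> Delta_half a \<Longrightarrow> branch a (R x) = x"
  by (meson Delta_half_subset R_Delta R_branch R_inj branch_half)

lemma R_segment:
  assumes "x \<in> Delta_half a" "y \<in> Delta_half a" "z \<in> open_segment x y"
  shows "R z \<in> open_segment (R x) (R y)"
proof (rule projective_segment[where F = R and x = x and y = y and d = "den a"])
  show "R x \<noteq> R y" using assms R_inj by (metis open_segment_idem empty_iff)
  show "0 < den a x" "0 < den a y" using assms den_pos by auto
  show dd: "den a ((1 - u) *\<^sub>R x + u *\<^sub>R y) = (1 - u) * den a x + u * den a y" for u
    using card_ge_1[where 'n='n] unfolding den_def
    by (simp only: bary_comb[of 0] bary_comb[of 1] split: if_split) (simp add: algebra_simps)
  fix u :: real and k assume u: "0 < u" "u < 1" and k: "k \<le> CARD('n)"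
  define w where "w = (1 - u) *\<^sub>R x + u *\<^sub>R y"
  have bw: "bary w j = (1 - u) * bary x j + u * bary y j" if "j \<le> CARD('n)" for j
    using bary_affine[OF that, of "1 - u" x y] by (simp add: w_def)
  have w: "w \<in> Delta_half a"
    using assms(1,2) u card_ge_1[where 'n='n]
    by (auto simp: Delta_half_iff Delta_iff bw simp del: One_nat_def split: if_splits intro!: add_mono mult_left_mono)
  have "den a w * bary (R w) k = step_lin CARD('n) c a (bary w) k"
    using R_half[OF w k] den_pos[OF w] by simp
  also have "\<dots> = step_lin CARD('n) c a (\<lambda>j. (1 - u) * bary x j + u * bary y j) k"
    using bw k by (intro step_lin_cong) (auto simp: card_ge_1)
  also have "\<dots> = (1 - u) * (den a x * bary (R x) k) + u * (den a y * bary (R y) k)"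
    using R_half[OF assms(1) k] den_pos[OF assms(1)] R_half[OF assms(2) k] den_pos[OF assms(2)]
    by (simp add: step_lin_comb)
  finally show "den a ((1 - u) *\<^sub>R x + u *\<^sub>R y) * bary (R ((1 - u) *\<^sub>R x + u *\<^sub>R y)) k =
      (1 - u) * (den a x * bary (R x) k) + u * (den a y * bary (R y) k)"
    by (simp add: w_def)
qed (fact assms)

lemma branch_segment:
  assumes "x \<in> Delta" "y \<in> Delta" "z \<in> open_segment x y"
  shows "branch a z \<in> open_segment (branch a x) (branch a y)"
proof (rule projective_segment[where F = "branch a" and x = x and y = y and d = "\<lambda>y :: 'n point. 1 + (2 / c - 1) * bary y CARD('n)"])
  show "branch a x \<noteq> branch a y" using assms R_branch by (metis open_segment_idem empty_iff)
  show "0 < 1 + (2 / c - 1) * bary x CARD('n)" "0 < 1 + (2 / c - 1) * bary y CARD('n)"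
    using assms branch_den_pos by auto
  show dd: "1 + (2 / c - 1) * bary ((1 - u) *\<^sub>R x + u *\<^sub>R y) CARD('n) =
      (1 - u) * (1 + (2 / c - 1) * bary x CARD('n)) + u * (1 + (2 / c - 1) * bary y CARD('n))" for u
    by (simp only: bary_comb[OF order_refl]) (simp add: algebra_simps add_divide_distrib diff_divide_distrib)
  fix u :: real and k assume u: "0 < u" "u < 1" and k: "k \<le> CARD('n)"
  define w where "w = (1 - u) *\<^sub>R x + u *\<^sub>R y"
  have bw: "bary w j = (1 - u) * bary x j + u * bary y j" if "j \<le> CARD('n)" for j
    using bary_affine[OF that, of "1 - u" x y] by (simp add: w_def)
  have w: "w \<in> Delta" using assms(1,2) u by (auto simp: Delta_iff bw)
  have *: "(1 + (2 / c - 1) * bary y CARD('n)) * bary (branch a y) k = inv_lin CARD('n) c a (bary y) k"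
    if "y \<in> Delta" for y
    using bary_branch[OF that k] branch_den_pos[OF that] by simp
  have "(1 + (2 / c - 1) * bary w CARD('n)) * bary (branch a w) k = inv_lin CARD('n) c a (bary w) k"
    by (rule *[OF w])
  also have "\<dots> = inv_lin CARD('n) c a (\<lambda>j. (1 - u) * bary x j + u * bary y j) k"
    using bw k by (intro inv_lin_cong) (auto simp: card_ge_1)
  also have "\<dots> = (1 - u) * ((1 + (2 / c - 1) * bary x CARD('n)) * bary (branch a x) k) +
      u * ((1 + (2 / c - 1) * bary y CARD('n)) * bary (branch a y) k)"
    unfolding *[OF assms(1)] *[OF assms(2)] by (rule inv_lin_comb)
  finally show "(1 + (2 / c - 1) * bary ((1 - u) *\<^sub>R x + u *\<^sub>R y) CARD('n)) *
      bary (branch a ((1 - u) *\<^sub>R x + u *\<^sub>R y)) k =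
      (1 - u) * ((1 + (2 / c - 1) * bary x CARD('n)) * bary (branch a x) k) +
      u * ((1 + (2 / c - 1) * bary y CARD('n)) * bary (branch a y) k)"
    by (simp add: w_def)
qed (fact assms)

section \<open>Cylinders and their vertices\<close>

lemma cylinder_Nil: "cylinder R [] = Delta"
  by (auto simp: cylinder_def)

lemma cylinder_Cons: "cylinder R (a # w) = {x \<in> Delta_half a. R x \<in> cylinder R w}"
proof -
  have "(\<forall>i < length (a # w). (R ^^ i) x \<in> Delta_half ((a # w) ! i)) \<longleftrightarrow>
      x \<in> Delta_half a \<and> (\<forall>i < length w. (R ^^ i) (R x) \<in> Delta_half (w ! i))" for x
    by (auto simp: less_Suc_eq_0_disj funpow_swap1)
  then show ?thesis using R_Delta by (auto simp: cylinder_def Delta_half_subset)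
qed

lemma cylinder_subset: "cylinder R w \<subseteq> Delta"
  by (auto simp: cylinder_def)

text \<open>\<open>R\<close> on a half and \<open>branch a\<close> are mutually inverse and both
  carry open segments to open segments, so neither creates or destroys extreme points.\<close>

lemma extreme_pullback:
  assumes C: "C \<subseteq> Delta" and p: "p \<in> Delta_half a"
  shows "p extreme_point_of {x \<in> Delta_half a. R x \<in> C} \<longleftrightarrow> R p extreme_point_of C"
proof
  assume ex: "p extreme_point_of {x \<in> Delta_half a. R x \<in> C}"
  show "R p extreme_point_of C"
    unfolding extreme_point_of_def
  proof (intro conjI ballI notI)
    show "R p \<in> C" using ex by (auto simp: extreme_point_of_def)
    fix x y assume xy: "x \<in> C" "y \<in> C" "R p \<in> open_segment x y"
    then have D: "x \<in> Delta" "y \<in> Delta" using C by auto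
    have "p \<in> open_segment (branch a x) (branch a y)"
      using branch_segment[OF D xy(3), of a] by (simp add: branch_R p)
    moreover have "branch a x \<in> {x \<in> Delta_half a. R x \<in> C}" "branch a y \<in> {x \<in> Delta_half a. R x \<in> C}"
      using D xy by (auto simp: branch_half R_branch)
    ultimately show False using ex by (auto simp: extreme_point_of_def)
  qed
next
  assume ex: "R p extreme_point_of C"
  show "p extreme_point_of {x \<in> Delta_half a. R x \<in> C}"
    unfolding extreme_point_of_def
  proof (intro conjI ballI notI)
    show "p \<in> {x \<in> Delta_half a. R x \<in> C}" using ex p by (simp add: extreme_point_of_def)
    fix x y assume xy: "x \<in> {x \<in> Delta_half a. R x \<in> C}" "y \<in> {x \<in> Delta_half a. R x \<in> C}"
      "p \<in> open_segment x y"
    then have "R p \<in> open_segment (R x) (R y)" using R_segment[of x a y p] by simp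
    then show False using ex xy by (simp add: extreme_point_of_def)
  qed
qed

lemma extreme_cylinder:
  "p extreme_point_of cylinder R w \<longleftrightarrow> p \<in> cylinder R w \<and> (R ^^ length w) p extreme_point_of Delta"
proof (induction w arbitrary: p)
  case Nil
  then show ?case by (auto simp: cylinder_Nil extreme_point_of_def)
next
  case (Cons a w)
  show ?case
  proof (cases "p \<in> cylinder R (a # w)")
    case True
    then have p: "p \<in> Delta_half a" "R p \<in> cylinder R w" by (auto simp: cylinder_Cons)
    have "p extreme_point_of cylinder R (a # w) \<longleftrightarrow> R p extreme_point_of cylinder R w"
      unfolding cylinder_Cons by (rule extreme_pullback[OF cylinder_subset p(1)])
    also have "\<dots> \<longleftrightarrow> (R ^^ length w) (R p) extreme_point_of Delta"
      unfolding Cons.IH using p(2) by simp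
    also have "(R ^^ length w) (R p) = (R ^^ length (a # w)) p" by (simp add: funpow_swap1)
    finally show ?thesis using True by blast
  next
    case False
    then show ?thesis unfolding extreme_point_of_def by blast
  qed
qed

section \<open>Orbits that end at \<open>v1\<close>\<close>

lemma in_cylinder_digits: "x \<in> Delta \<Longrightarrow> x \<in> cylinder R (map (\<lambda>i. digit ((R ^^ i) x)) [0..<t])"
  by (auto simp: cylinder_def intro: Delta_half_digit funpow_Delta)

text \<open>The shift carries the single coordinate 1 down by one place. For k = 0 truncated
  subtraction turns this into the fixed point property of \<open>v1\<close>.\<close>

lemma R_unit:
  assumes x: "x \<in> Delta" "bary x k = 1" "k \<le> CARD('n)"
  shows "bary (R x) (k - 1) = 1"
proof -
  have z: "bary x j = 0" if "j \<le> CARD('n)" "j \<noteq> k" for j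
    using bary_add_le_1[OF x(1), of j k] bary_ge_0[OF x(1), of j] that x by auto
  have h: "x \<in> Delta_half (k = 1)"
    using x z[of 0] z[of 1] bary_ge_0[OF x(1), of 0] card_ge_1[where 'n='n] by (auto simp: Delta_half_iff)
  show ?thesis
    using R_half[OF h, of "k - 1"] bary_ge_0[OF x(1), of 0] z[of 0] z[of 1] x card_ge_1[where 'n='n]
    by (cases "k = 0"; cases "k = 1") (auto simp: den_def step_lin_def)
qed

lemma unit_reaches_v1:
  assumes "x \<in> Delta" "bary x k = 1" "k \<le> CARD('n)"
  shows "\<exists>t. (R ^^ t) x = v1"
  using assms
proof (induction k arbitrary: x)
  case 0
  then show ?case using v1_eqI by (intro exI[of _ 0]) simp
next
  case (Suc k)
  then obtain t where "(R ^^ t) (R x) = v1" using R_unit[of x "Suc k"] R_Delta by fastforce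
  then show ?case by (intro exI[of _ "Suc t"]) (simp add: funpow_swap1)
qed

lemma R_v1: "R v1 = v1"
  using R_unit[of v1 0] by (intro v1_eqI R_Delta v1_Delta) (simp add: bary_v1 v1_Delta)

lemma funpow_v1: "(R ^^ t) v1 = v1"
  by (induction t) (auto simp: R_v1)

lemma EPO_eq_v1_iff:
  assumes "p \<in> Delta"
  shows "EPO R p = {v1} \<longleftrightarrow> (\<exists>t. (R ^^ t) p = v1)"
proof
  assume "EPO R p = {v1}"
  then have "v1 \<in> EPO R p" by simp
  then show "\<exists>t. (R ^^ t) p = v1" unfolding EPO_def mem_Collect_eq by metis
next
  assume "\<exists>t. (R ^^ t) p = v1"
  then obtain t where t: "(R ^^ t) p = v1" by auto
  have later: "(R ^^ s) p = v1" if "s \<ge> t" for s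
    using that t funpow_v1[of "s - t"] funpow_add[of "s - t" t R] by simp
  have "q = v1" if "i < j" "q = (R ^^ i) p" "q = (R ^^ j) p" for q i j
  proof -
    \<comment> \<open>A value that recurs once recurs arbitrarily late, in particular after time t,
      when the orbit is constantly \<open>v1\<close>.\<close>
    have per: "(R ^^ (i + m * (j - i))) p = q" for m
    proof (induction m)
      case (Suc m)
      have "i + Suc m * (j - i) = (j - i) + (i + m * (j - i))" by simp
      then have "(R ^^ (i + Suc m * (j - i))) p = (R ^^ (j - i)) q"
        using Suc funpow_add[of "j - i" "i + m * (j - i)" R] by (metis comp_apply)
      also have "\<dots> = (R ^^ j) p" using that funpow_add[of "j - i" i R] by simp
      finally show ?case using that by simp
    qed (use that in simp)
    have "t * 1 \<le> t * (j - i)" using that by (intro mult_le_mono) auto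
    then have "i + t * (j - i) \<ge> t" by (simp only: mult_1_right trans_le_add2)
    then show ?thesis using per[of t] later by simp
  qed
  moreover have "v1 \<in> EPO R p"
    unfolding EPO_def mem_Collect_eq using later[of t] later[of "Suc t"] v1_Delta by (metis le_SucI lessI order_refl)
  moreover have "EPO R p \<subseteq> {v1}" using calculation(1) unfolding EPO_def by blast
  ultimately show "EPO R p = {v1}" by blast
qed

text \<open>Vertices of cylinders are the points that reach a vertex of \<open>Delta\<close>, and
  all of these descend to \<open>v1\<close>. Conversely, \<open>v1\<close> is a vertex of
  \<open>Delta\<close>, so p is a vertex of the cylinder given by its own first t digits.\<close>

lemma vertex_iff:
  assumes "p \<in> Delta"
  shows "(\<exists>t. p \<in> complex_vertices (cylinder_complex R t)) \<longleftrightarrow> (\<exists>t. (R ^^ t) p = v1)"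
proof
  assume "\<exists>t. p \<in> complex_vertices (cylinder_complex R t)"
  then obtain w where "p extreme_point_of cylinder R w"
    by (auto simp: complex_vertices_def cylinder_complex_def face_of_singleton)
  then have "(R ^^ length w) p extreme_point_of Delta" by (simp add: extreme_cylinder)
  then obtain k where "k \<le> CARD('n)" "bary ((R ^^ length w) p) k = 1" by (rule extreme_Delta_unit)
  then obtain t where "(R ^^ t) ((R ^^ length w) p) = v1"
    using unit_reaches_v1 assms funpow_Delta by blast
  then show "\<exists>t. (R ^^ t) p = v1" by (metis comp_apply funpow_add)
next
  assume "\<exists>t. (R ^^ t) p = v1"
  then obtain t where t: "(R ^^ t) p = v1" by auto
  let ?w = "map (\<lambda>i. digit ((R ^^ i) p)) [0..<t]"
  have "p extreme_point_of cylinder R ?w"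
    using t assms by (simp add: extreme_cylinder in_cylinder_digits v1_extreme)
  then show "\<exists>t. p \<in> complex_vertices (cylinder_complex R t)"
    by (auto simp: complex_vertices_def cylinder_complex_def face_of_singleton intro!: exI[of _ t] exI[of _ ?w])
qed

lemma GO_v1_iff: "q \<in> GO R v1 \<longleftrightarrow> q \<in> Delta \<and> (\<exists>t. (R ^^ t) q = v1)"
  unfolding GO_def mem_Collect_eq funpow_v1 by metis

end

section \<open>The two maps as instances\<close>

lemma M_bary_map: "bary_map (M_map :: 'n::{finite,linorder} point \<Rightarrow> 'n point) 1"
proof
  fix x :: "'n point" and k assume x: "x \<in> Delta" and k: "k \<le> CARD('n)"
  let ?n = "CARD('n)"
  have n: "1 \<le> ?n" by (rule card_ge_1)
  have s: "(\<Sum>j\<le>?n. step_lin ?n 1 (digit x) (bary x) j) = 1 - (2 - 1) * (if digit x then bary x 0 else bary x 1)"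
    by (simp add: sum_step_lin n)
  have "1 - (2 - 1) * (if digit x then bary x 0 else bary x 1) > 0"
    using bary_add_le_1[OF x, of 0 1] bary_ge_0[OF x, of 0] n by (auto simp: digit_def)
  moreover have "M_map x = proj_action (V_mat ** matrix_inv (K_mat 1 (digit x)) ** matrix_inv V_mat) x"
    using x by (auto simp: M_map_def M_mat_def K_mat_1 Delta_half_iff digit_def)
  ultimately show "bary (M_map x) k = step_lin ?n 1 (digit x) (bary x) k /
      (1 - (2 - 1) * (if digit x then bary x 0 else bary x 1))"
    using proj_action_step[of 1 "digit x" x k] k unfolding s by simp
qed simp

lemma T_bary_map: "bary_map (T_map :: 'n::{finite,linorder} point \<Rightarrow> 'n point) 2"
proof
  fix x :: "'n point" and k assume x: "x \<in> Delta" and k: "k \<le> CARD('n)"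
  let ?n = "CARD('n)"
  have s: "(\<Sum>j\<le>?n. step_lin ?n 2 (digit x) (bary x) j) = 1"
    by (simp add: sum_step_lin card_ge_1)
  moreover have "T_map x = proj_action (V_mat ** matrix_inv (K_mat 2 (digit x)) ** matrix_inv V_mat) x"
    using x by (auto simp: T_map_def T_mat_def K_mat_2 Delta_half_iff digit_def)
  ultimately show "bary (T_map x) k = step_lin ?n 2 (digit x) (bary x) k /
      (1 - (2 - 2) * (if digit x then bary x 0 else bary x 1))"
    using proj_action_step[of 2 "digit x" x k] k unfolding s by simp
qed simp

section \<open>Convergence of the cylinders\<close>

text \<open>A coupling: x and y have weight at least \<open>\<eta>\<close> in their mixtures, so
  \<open>\<eta> * (x - y)\<close> splits off, and what remains of each mixture has mass 1 -
  \<open>\<eta>\<close> and lies between the corresponding multiples of \<open>lo\<close> and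
  \<open>hi\<close>.\<close>

lemma overlap_bound:
  fixes x y z w :: real
  assumes I: "x \<in> {lo..hi}" "y \<in> {lo..hi}" "z \<in> {lo..hi}" "w \<in> {lo..hi}"
    and \<eta>: "0 \<le> \<eta>" "\<eta> \<le> \<alpha>" "\<alpha> \<le> 1" "\<eta> \<le> \<beta>" "\<beta> \<le> 1"
  shows "\<bar>(\<alpha> * x + (1 - \<alpha>) * z) - (\<beta> * y + (1 - \<beta>) * w)\<bar> \<le> \<eta> * \<bar>x - y\<bar> + (1 - \<eta>) * (hi - lo)"
proof -
  have b: "(1 - \<eta>) * lo \<le> (\<gamma> - \<eta>) * p + (1 - \<gamma>) * q \<and> (\<gamma> - \<eta>) * p + (1 - \<gamma>) * q \<le> (1 - \<eta>) * hi"
    if "p \<in> {lo..hi}" "q \<in> {lo..hi}" "\<eta> \<le> \<gamma>" "\<gamma> \<le> 1" for p q \<gamma>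
  proof -
    have "(\<gamma> - \<eta>) * lo \<le> (\<gamma> - \<eta>) * p" "(1 - \<gamma>) * lo \<le> (1 - \<gamma>) * q"
      "(\<gamma> - \<eta>) * p \<le> (\<gamma> - \<eta>) * hi" "(1 - \<gamma>) * q \<le> (1 - \<gamma>) * hi"
      using that by (auto intro!: mult_left_mono)
    then show ?thesis by (simp add: algebra_simps)
  qed
  have "\<bar>(\<alpha> * x + (1 - \<alpha>) * z) - (\<beta> * y + (1 - \<beta>) * w)\<bar> =
      \<bar>\<eta> * (x - y) + (((\<alpha> - \<eta>) * x + (1 - \<alpha>) * z) - ((\<beta> - \<eta>) * y + (1 - \<beta>) * w))\<bar>"
    by (simp add: algebra_simps)
  also have "\<dots> \<le> \<bar>\<eta> * (x - y)\<bar> + \<bar>((\<alpha> - \<eta>) * x + (1 - \<alpha>) * z) - ((\<beta> - \<eta>) * y + (1 - \<beta>) * w)\<bar>"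
    by (rule abs_triangle_ineq)
  also have "\<bar>\<eta> * (x - y)\<bar> = \<eta> * \<bar>x - y\<bar>" using \<eta> by (simp add: abs_mult)
  also have "\<bar>((\<alpha> - \<eta>) * x + (1 - \<alpha>) * z) - ((\<beta> - \<eta>) * y + (1 - \<beta>) * w)\<bar> \<le> (1 - \<eta>) * (hi - lo)"
    using b[of x z \<alpha>] b[of y w \<beta>] I \<eta> by (simp add: right_diff_distrib abs_le_iff)
  finally show ?thesis by simp
qed

text \<open>
  The vertices of the cylinders form a queue \<open>U t, \<dots>, U (t + n - 1)\<close> together with a distinguished
  vertex \<open>H t\<close>. A step enqueues a point between \<open>H t\<close> and the dequeued \<open>U t\<close>, and keeps one
  of these two as the new \<open>H\<close>.
\<close>

locale vertex_queue =
  fixes n :: nat and H U \<theta> :: "nat \<Rightarrow> real"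
  assumes n: "1 \<le> n"
    and U: "U (t + n) = \<theta> t * H t + (1 - \<theta> t) * U t"
    and H: "H (Suc t) = H t \<or> H (Suc t) = U t"
    and \<theta>: "0 \<le> \<theta> t" "\<theta> t \<le> 1 / 2"
begin

definition enclosed :: "nat \<Rightarrow> real \<Rightarrow> real \<Rightarrow> bool" where
  "enclosed t lo hi \<longleftrightarrow> H t \<in> {lo..hi} \<and> (\<forall>i<n. U (t + i) \<in> {lo..hi})"

lemma enclosed_later:
  assumes t0: "enclosed t0 lo hi"
  shows "t0 \<le> t \<Longrightarrow> H t \<in> {lo..hi}" "t0 \<le> t \<Longrightarrow> U t \<in> {lo..hi}"
proof -
  have "enclosed (t0 + s) lo hi" for s
  proof (induction s)
    case (Suc s)
    let ?t = "t0 + s"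
    have HU: "H ?t \<in> {lo..hi}" "U ?t \<in> {lo..hi}" using Suc n by (auto simp: enclosed_def dest: spec[of _ 0])
    have "\<theta> ?t * lo \<le> \<theta> ?t * H ?t" "\<theta> ?t * H ?t \<le> \<theta> ?t * hi"
      "(1 - \<theta> ?t) * lo \<le> (1 - \<theta> ?t) * U ?t" "(1 - \<theta> ?t) * U ?t \<le> (1 - \<theta> ?t) * hi"
      using HU \<theta>[of ?t] by (auto intro!: mult_left_mono)
    then have new: "U (?t + n) \<in> {lo..hi}" unfolding U by (auto simp: algebra_simps)
    have "U (Suc ?t + i) \<in> {lo..hi}" if "i < n" for i
    proof (cases "Suc i = n")
      case True
      then have "Suc ?t + i = ?t + n" by simp
      then show ?thesis using new by metis
    next
      case False
      then have "U (?t + Suc i) \<in> {lo..hi}" using Suc that unfolding enclosed_def by (metis Suc_lessI)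
      then show ?thesis by simp
    qed
    moreover have "H (Suc ?t) \<in> {lo..hi}" using H[of ?t] HU by auto
    ultimately show ?case by (simp add: enclosed_def)
  qed (use t0 in simp)
  then have "t0 \<le> t \<Longrightarrow> enclosed t lo hi" by (metis le_add_diff_inverse)
  then show "t0 \<le> t \<Longrightarrow> H t \<in> {lo..hi}" "t0 \<le> t \<Longrightarrow> U t \<in> {lo..hi}"
    using n by (auto simp: enclosed_def dest: spec[of _ 0])
qed

lemma H_trace: "t \<le> t' \<Longrightarrow> H t' = H t \<or> (\<exists>s. t \<le> s \<and> s < t' \<and> H t' = U s)"
proof (induction "t' - t" arbitrary: t')
  case (Suc d)
  then obtain r where r: "t' = Suc r" "t \<le> r" "d = r - t" by (cases t') auto
  show ?case using H[of r] Suc(1)[OF r(3) r(2)] r by (metis less_Suc_eq le_less_trans)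
qed simp

text \<open>
  Two points enqueued \<open>r + 1\<close> steps apart share an ancestor in the previous round, or have ancestors
  enqueued at most \<open>r\<close> steps apart. So all vertices share an ancestor after sufficiently many rounds.
\<close>

lemma contraction_aux:
  assumes t0: "enclosed t0 lo hi"
    and \<eta>: "0 \<le> \<eta>" "\<And>t. t0 \<le> t \<Longrightarrow> t < t0 + N \<Longrightarrow> \<eta> \<le> \<theta> t"
  shows "t0 + r * n \<le> i \<Longrightarrow> i \<le> i' \<Longrightarrow> i' \<le> i + r \<Longrightarrow> i' < t0 + N + n \<Longrightarrow>
    \<bar>U i - U i'\<bar> \<le> (1 - \<eta> ^ r) * (hi - lo)"
proof (induction r arbitrary: i i')
  case (Suc r)
  have D: "0 \<le> hi - lo" using enclosed_later(1)[OF t0, of t0] by simp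
  define t t' where "t = i - n" and "t' = i' - n"
  have i: "i = t + n" "i' = t' + n" and t: "t0 + r * n \<le> t" "t \<le> t'" "t' \<le> t + Suc r" "t' < t0 + N"
    using Suc.prems by (auto simp: t_def t'_def)
  then have tt: "t0 \<le> t" "t0 \<le> t'" "t < t0 + N" by auto
  note I = enclosed_later[OF t0]
  have \<eta>2: "\<eta> \<le> \<theta> t" "\<eta> \<le> \<theta> t'" "\<eta> \<le> 1 - \<theta> t" "\<eta> \<le> 1" using \<eta>(2)[of t] \<eta>(2)[of t'] \<theta>(2)[of t] t tt by auto
  have pw: "\<eta> ^ r \<le> 1" using \<eta> \<eta>2 by (simp add: power_le_one)
  have main: "\<bar>U i - U i'\<bar> \<le> \<eta> * ((1 - \<eta> ^ r) * (hi - lo)) + (1 - \<eta>) * (hi - lo)"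
  proof (cases "H t' = H t")
    case True
    have "\<bar>U i - U i'\<bar> \<le> \<eta> * \<bar>H t - H t'\<bar> + (1 - \<eta>) * (hi - lo)"
      unfolding i U using I tt \<eta> \<eta>2 \<theta>[of t] \<theta>[of t'] by (intro overlap_bound) auto
    moreover have "0 \<le> \<eta> * ((1 - \<eta> ^ r) * (hi - lo))" using \<eta> pw D by simp
    ultimately show ?thesis by (simp add: True)
  next
    case False
    then obtain s where s: "t \<le> s" "s < t'" "H t' = U s" using H_trace[OF t(2)] by auto
    \<comment> \<open>The ancestors to couple are \<open>U t\<close> and \<open>H t' = U s\<close>,
      whose indices differ by at most r. The weight 1 - \<open>\<theta> t\<close> of
      \<open>U t\<close> is at least 1/2, hence at least \<open>\<eta>\<close>.\<close>
    have "\<bar>U i - U i'\<bar> = \<bar>((1 - \<theta> t) * U t + (1 - (1 - \<theta> t)) * H t) - (\<theta> t' * H t' + (1 - \<theta> t') * U t')\<bar>"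
      unfolding i U by (simp add: algebra_simps)
    also have "\<dots> \<le> \<eta> * \<bar>U t - H t'\<bar> + (1 - \<eta>) * (hi - lo)"
      using I tt \<eta> \<eta>2 \<theta>[of t] \<theta>[of t'] by (intro overlap_bound) auto
    also have "\<bar>U t - H t'\<bar> \<le> (1 - \<eta> ^ r) * (hi - lo)"
      unfolding s(3) using s t by (intro Suc.IH) auto
    finally show ?thesis using \<eta> by (simp add: mult_left_mono)
  qed
  also have "\<dots> = (1 - \<eta> ^ Suc r) * (hi - lo)" by (simp add: algebra_simps)
  finally show ?case .
qed simp

text \<open>At the end of the block the queue occupies n consecutive indices, and a recently
  replaced \<open>H\<close> comes from the n indices before them. These indices differ by less than
  2 * n, so \<open>contraction_aux\<close> is applied with r = 2 * n, which asks for 2 * n * n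
  earlier steps.\<close>

definition window :: nat where "window = 2 * n * n + n"

lemma contraction:
  assumes t0: "enclosed t0 lo hi"
    and \<eta>: "0 \<le> \<eta>" "\<And>t. t0 \<le> t \<Longrightarrow> t < t0 + window \<Longrightarrow> \<eta> \<le> \<theta> t"
  shows "\<exists>lo' hi'. enclosed (t0 + window) lo' hi' \<and> hi' - lo' \<le> (1 - \<eta> ^ (2 * n)) * (hi - lo)"
proof -
  let ?T = "t0 + window" and ?e = "(1 - \<eta> ^ (2 * n)) * (hi - lo)"
  note I = enclosed_later[OF t0]
  have D: "0 \<le> hi - lo" using I(1)[of t0] by simp
  have \<eta>1: "\<eta> \<le> 1" using \<eta>(2)[of t0] \<theta>(2)[of t0] n by (auto simp: window_def)
  have UU: "\<bar>U i - U i'\<bar> \<le> ?e" if "t0 + 2 * n * n \<le> i" "t0 + 2 * n * n \<le> i'" "i < ?T + n" "i' < ?T + n" for i i'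
  proof -
    have *: "\<bar>U i - U i'\<bar> \<le> ?e" if "t0 + 2 * n * n \<le> i" "i' < ?T + n" "i \<le> i'" for i i'
      using that contraction_aux[OF t0 \<eta>, where r = "2 * n" and i = i and i' = i'] by (simp add: window_def)
    show ?thesis using *[of i i'] *[of i' i] that by (cases "i \<le> i'") (auto simp: abs_minus_commute)
  qed
  have HU: "\<bar>H ?T - U (?T + j)\<bar> \<le> ?e" if j: "j < n" for j
  proof -
    define s where "s = t0 + 2 * n * n"
    have T: "?T = s + n" by (simp add: window_def s_def)
    from H_trace[of "s + j" ?T] j T have "H ?T = H (s + j) \<or> (\<exists>r\<ge>s. r < ?T \<and> H ?T = U r)" by force
    then show ?thesis
    proof
      \<comment> \<open>\<open>H\<close> is unchanged since time s + j, when it was mixed into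
        \<open>U (?T + j)\<close> with weight at least \<open>\<eta>\<close>: it is itself the
        common ancestor.\<close>
      assume h: "H ?T = H (s + j)"
      have s: "t0 \<le> s + j" "s + j < ?T" using T j by (auto simp: s_def)
      have u: "U (?T + j) = \<theta> (s + j) * H (s + j) + (1 - \<theta> (s + j)) * U (s + j)"
        using U[of "s + j"] T by (simp add: ac_simps)
      have "\<bar>H ?T - U (?T + j)\<bar> = \<bar>(1 * H (s + j) + (1 - 1) * H (s + j)) - (\<theta> (s + j) * H (s + j) + (1 - \<theta> (s + j)) * U (s + j))\<bar>"
        unfolding h u by simp
      also have "\<dots> \<le> \<eta> * \<bar>H (s + j) - H (s + j)\<bar> + (1 - \<eta>) * (hi - lo)"
        using I s \<eta> \<eta>1 \<theta>[of "s + j"] by (intro overlap_bound) auto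
      also have "\<dots> \<le> ?e"
      proof -
        have "\<eta> ^ (2 * n) \<le> \<eta> ^ 1" using \<eta> \<eta>1 n by (intro power_decreasing) auto
        then show ?thesis using D by (simp add: mult_right_mono)
      qed
      finally show ?thesis .
    next
      assume "\<exists>r\<ge>s. r < ?T \<and> H ?T = U r"
      then show ?thesis using UU j T by (force simp: s_def)
    qed
  qed
  define S where "S = insert (H ?T) ((\<lambda>i. U (?T + i)) ` {..<n})"
  have S: "finite S" "S \<noteq> {}" by (auto simp: S_def)
  have "\<bar>x - y\<bar> \<le> ?e" if "x \<in> S" "y \<in> S" for x y
  proof -
    have "0 \<le> ?e" using D \<eta> \<eta>1 by (simp add: power_le_one)
    then show ?thesis
      using that UU HU by (auto simp: S_def window_def abs_minus_commute[of _ "H _"])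
  qed
  then have "Max S - Min S \<le> ?e" using S by (meson Max_in Min_in abs_le_D1)
  moreover have "enclosed ?T (Min S) (Max S)" using S by (auto simp: enclosed_def S_def)
  ultimately show ?thesis by blast
qed

text \<open>Each block of good weights multiplies the diameter by a fixed factor below 1, it does
  not grow between blocks, and blocks recur forever.\<close>

lemma contracts_to_0:
  assumes "0 < \<eta>" and often: "\<And>t1. \<exists>t0\<ge>t1. \<forall>t. t0 \<le> t \<longrightarrow> t < t0 + window \<longrightarrow> \<eta> \<le> \<theta> t"
    and "0 < \<epsilon>"
  shows "\<exists>t lo hi. enclosed t lo hi \<and> hi - lo \<le> \<epsilon>"
proof -
  define S where "S = insert (H 0) (U ` {..<n})"
  have init: "enclosed 0 (Min S) (Max S)" by (auto simp: enclosed_def S_def)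
  let ?D = "Max S - Min S" and ?\<kappa> = "1 - \<eta> ^ (2 * n)"
  have \<eta>1: "\<eta> \<le> 1"
  proof -
    obtain t0 where "\<forall>t. t0 \<le> t \<longrightarrow> t < t0 + window \<longrightarrow> \<eta> \<le> \<theta> t" using often by auto
    then have "\<eta> \<le> \<theta> t0" using n by (auto simp: window_def)
    then show ?thesis using \<theta>(2)[of t0] by simp
  qed
  have \<kappa>: "0 \<le> ?\<kappa>" "?\<kappa> < 1" using \<open>0 < \<eta>\<close> \<eta>1 by (auto simp: power_le_one)
  have iter: "\<exists>t lo hi. enclosed t lo hi \<and> hi - lo \<le> ?\<kappa> ^ m * ?D" for m
  proof (induction m)
    case 0
    then show ?case using init by auto
  next
    case (Suc m)
    then obtain t lo hi where t: "enclosed t lo hi" "hi - lo \<le> ?\<kappa> ^ m * ?D" by auto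
    obtain t0 where t0: "t0 \<ge> t" "\<And>s. t0 \<le> s \<Longrightarrow> s < t0 + window \<Longrightarrow> \<eta> \<le> \<theta> s" using often by metis
    have "enclosed t0 lo hi" using enclosed_later[OF t(1)] t0 by (auto simp: enclosed_def)
    then obtain lo' hi' where l: "enclosed (t0 + window) lo' hi'" "hi' - lo' \<le> ?\<kappa> * (hi - lo)"
      using contraction[of t0 lo hi \<eta>] t0 \<open>0 < \<eta>\<close> by auto
    have "hi' - lo' \<le> ?\<kappa> * (?\<kappa> ^ m * ?D)" using l(2) mult_left_mono[OF t(2) \<kappa>(1)] by simp
    then show ?case using l by (auto simp: mult.assoc)
  qed
  have "(\<lambda>m. ?\<kappa> ^ m * ?D) \<longlonglongrightarrow> 0"
    using \<kappa> by (intro tendsto_mult_left_zero LIMSEQ_realpow_zero) auto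
  then have "\<forall>\<^sub>F m in sequentially. ?\<kappa> ^ m * ?D < \<epsilon>" using \<open>0 < \<epsilon>\<close> order_tendstoD(2) by blast
  then obtain m where "?\<kappa> ^ m * ?D < \<epsilon>" by (auto simp: eventually_sequentially)
  then show ?thesis using iter[of m] by force
qed

end

text \<open>The transpose of \<open>inv_lin\<close>. Started at a functional f and iterated t times
  along a code, its k-th entry is the value of f at the k-th column of the product of the first t
  matrices \<open>K_mat\<close>, that is, at an unnormalized vertex of the cylinder.\<close>

definition adj :: "nat \<Rightarrow> real \<Rightarrow> bool \<Rightarrow> (nat \<Rightarrow> real) \<Rightarrow> nat \<Rightarrow> real" where
  "adj n c a f k = (if k = 0 then if a then f 1 else f 0
     else if k < n then f (Suc k) else (f 0 + f 1) / c)"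

primrec adj_run :: "nat \<Rightarrow> real \<Rightarrow> (nat \<Rightarrow> bool) \<Rightarrow> (nat \<Rightarrow> real) \<Rightarrow> nat \<Rightarrow> nat \<Rightarrow> real" where
  "adj_run n c a f 0 = f"
| "adj_run n c a f (Suc t) = adj n c (a t) (adj_run n c a f t)"

lemma sum_inv_lin_adj:
  assumes "1 \<le> n"
  shows "(\<Sum>k\<le>n. inv_lin n c a b k * f k) = (\<Sum>k\<le>n. b k * adj n c a f k)"
proof -
  obtain m where n: "n = Suc m" using assms by (cases n) auto
  have "(\<Sum>k\<le>n. inv_lin n c a b k * f k) = inv_lin n c a b 0 * f 0 + (inv_lin n c a b 1 * f 1 +
      (\<Sum>i<m. inv_lin n c a b (Suc (Suc i)) * f (Suc (Suc i))))"
    unfolding n by (simp add: sum.atMost_Suc_shift lessThan_Suc_atMost[symmetric] sum.lessThan_Suc_shift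
        del: sum.atMost_Suc sum.lessThan_Suc)
  moreover have "(\<Sum>k\<le>n. b k * adj n c a f k) =
      b 0 * adj n c a f 0 + ((\<Sum>i<m. b (Suc i) * adj n c a f (Suc i)) + b n * adj n c a f n)"
    unfolding n by (simp only: sum.atMost_Suc_shift) (simp add: lessThan_Suc_atMost[symmetric])
  moreover have "(\<Sum>i<m. b (Suc i) * adj n c a f (Suc i)) =
      (\<Sum>i<m. inv_lin n c a b (Suc (Suc i)) * f (Suc (Suc i)))"
    by (intro sum.cong) (auto simp: adj_def inv_lin_def n)
  ultimately show ?thesis using assms by (simp add: adj_def inv_lin_def algebra_simps add_divide_distrib)
qed

lemma adj_run_shift: "i + j < n \<Longrightarrow> adj_run n c a f (t + i) (Suc j) = adj_run n c a f t (Suc (i + j))"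
  by (induction i arbitrary: j) (auto simp: adj_def)

text \<open>The entry created at place n by step t + 1 moves down one place per step and arrives at
  place 1 at time t + n.\<close>

lemma adj_run_push: "1 \<le> n \<Longrightarrow> adj_run n c a f (t + n) 1 = (adj_run n c a f t 0 + adj_run n c a f t 1) / c"
  using adj_run_shift[of "n - 1" 0 n c a f "Suc t"] by (simp add: adj_def)

lemma adj_run_comb: "adj_run n c a (\<lambda>k. u * f k - v * g k) t k = u * adj_run n c a f t k - v * adj_run n c a g t k"
proof (induction t arbitrary: k)
  case (Suc t)
  show ?case unfolding adj_run.simps adj_def Suc.IH by (simp add: algebra_simps diff_divide_distrib add_divide_distrib)
qed simp

text \<open>
  \<open>weight n c a t k\<close> is the denominator of the \<open>k\<close>-th vertex of the cylinder, and
  \<open>vert n c a j t k\<close> its \<open>j\<close>-th barycentric coordinate.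
\<close>

definition weight :: "nat \<Rightarrow> real \<Rightarrow> (nat \<Rightarrow> bool) \<Rightarrow> nat \<Rightarrow> nat \<Rightarrow> real" where
  "weight n c a = adj_run n c a (\<lambda>_. 1)"

definition vert :: "nat \<Rightarrow> real \<Rightarrow> (nat \<Rightarrow> bool) \<Rightarrow> nat \<Rightarrow> nat \<Rightarrow> nat \<Rightarrow> real" where
  "vert n c a j t k = adj_run n c a (\<lambda>i. if i = j then 1 else 0) t k / weight n c a t k"

lemma weight_2: "weight n 2 a t k = 1"
  unfolding weight_def by (induction t arbitrary: k) (auto simp: adj_def)

lemma weight_ge_1: "weight n 1 a t k \<ge> 1"
  unfolding weight_def
proof (induction t arbitrary: k)
  case (Suc t)
  then have "adj_run n 1 a (\<lambda>_. 1) t 0 + adj_run n 1 a (\<lambda>_. 1) t 1 \<ge> 1 + 1" by (intro add_mono)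
  with Suc show ?case by (auto simp: adj_def)
qed simp

text \<open>The next last weight is the sum of the first two, so the second inequality is what keeps
  the list sorted at its end. It persists because the new first two weights dominate the old
  ones.\<close>

lemma weight_sorted:
  assumes "1 \<le> n"
  shows "(\<forall>k<n. weight n 1 a t k \<le> weight n 1 a t (Suc k)) \<and> weight n 1 a t n \<le> weight n 1 a t 0 + weight n 1 a t 1"
proof (induction t)
  case (Suc t)
  let ?w = "weight n 1 a t"
  have s: "?w k \<le> ?w (Suc k)" if "k < n" for k using Suc that by auto
  have l: "?w n \<le> ?w 0 + ?w 1" using Suc by auto
  have w: "weight n 1 a (Suc t) k = (if k = 0 then if a t then ?w 1 else ?w 0
      else if k < n then ?w (Suc k) else ?w 0 + ?w 1)" for k
    by (simp add: weight_def adj_def)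
  have p: "?w k \<ge> 1" for k by (rule weight_ge_1)
  have "weight n 1 a (Suc t) k \<le> weight n 1 a (Suc t) (Suc k)" if "k < n" for k
    using that s[of k] s[of "Suc k"] s[of 0] s[of 1] l p[of 0] p[of 1] assms unfolding w
    by (cases "Suc k = n") auto
  moreover have "weight n 1 a (Suc t) n \<le> weight n 1 a (Suc t) 0 + weight n 1 a (Suc t) 1"
    using s[of 0] s[of 1] assms p[of 0] p[of 1] unfolding w by auto
  ultimately show ?case by blast
qed (auto simp: weight_def)

lemma weight_mono:
  assumes "1 \<le> n" "i \<le> j" "j \<le> n"
  shows "weight n 1 a t i \<le> weight n 1 a t j"
  using assms(2,3)
proof (induction j rule: dec_induct)
  case (step m)
  then show ?case using weight_sorted[OF assms(1), of a t] by (metis Suc_leD Suc_le_lessD order_trans)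
qed simp

lemma weight_pos: "c = 1 \<or> c = 2 \<Longrightarrow> weight n c a t k > 0"
  using weight_ge_1[of n a t k] weight_2[of n a t k] by auto

text \<open>Adding two unnormalized columns mixes their points in proportion to the denominators, as
  for mediants; this is the share of vertex 0.\<close>

definition ratio :: "nat \<Rightarrow> real \<Rightarrow> (nat \<Rightarrow> bool) \<Rightarrow> nat \<Rightarrow> real" where
  "ratio n c a t = weight n c a t 0 / (weight n c a t 0 + weight n c a t 1)"

text \<open>The queue is read at its head: by \<open>adj_run_shift\<close>, place k at time t is
  place 1 at time t + k - 1, so one sequence describes all places from 1 to n. The bound 1/2 comes
  from the weights being sorted.\<close>

lemma vertex_queue_vert:
  assumes n: "1 \<le> n" and c: "c = 1 \<or> c = 2"
  shows "vertex_queue n (\<lambda>t. vert n c a j t 0) (\<lambda>t. vert n c a j t 1) (ratio n c a)"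
proof
  fix t
  let ?w = "weight n c a t" and ?f = "adj_run n c a (\<lambda>i. if i = j then 1 else 0)"
  have p: "?w k > 0" for k using weight_pos[OF c] .
  have "vert n c a j (t + n) 1 = ((?f t 0 + ?f t 1) / c) / ((?w 0 + ?w 1) / c)"
    unfolding vert_def weight_def by (simp only: adj_run_push[OF n])
  also have "\<dots> = (?f t 0 + ?f t 1) / (?w 0 + ?w 1)" using c by auto
  also have "\<dots> = ?w 0 / (?w 0 + ?w 1) * (?f t 0 / ?w 0) + ?w 1 / (?w 0 + ?w 1) * (?f t 1 / ?w 1)"
    using p[of 0] p[of 1] by (simp add: add_divide_distrib)
  also have "?w 1 / (?w 0 + ?w 1) = 1 - ratio n c a t"
    using p[of 0] p[of 1] by (simp add: ratio_def field_simps)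
  finally show "vert n c a j (t + n) 1 = ratio n c a t * vert n c a j t 0 + (1 - ratio n c a t) * vert n c a j t 1"
    by (simp add: ratio_def vert_def)
  show "vert n c a j (Suc t) 0 = vert n c a j t 0 \<or> vert n c a j (Suc t) 0 = vert n c a j t 1"
    by (auto simp: vert_def weight_def adj_def)
  show "0 \<le> ratio n c a t" using p[of 0] p[of 1] by (simp add: ratio_def)
  have "?w 0 \<le> ?w 1" using c weight_mono[OF n, of 0 1] n by (auto simp: weight_2)
  then show "ratio n c a t \<le> 1 / 2" using p[of 0] p[of 1] by (simp add: ratio_def field_simps)
qed (rule n)

text \<open>Just after a digit \<open>1\<close> all weights agree up to a factor \<open>2\<close>.\<close>

lemma ratio_after_True:
  assumes n: "1 \<le> n" and a: "a s" and t: "Suc s \<le> t" "t < Suc s + N"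
  shows "1 / (1 + 2 ^ (N + 1)) \<le> ratio n 1 a t"
proof -
  let ?w = "weight n 1 a"
  have w: "?w (Suc t) k = (if k = 0 then if a t then ?w t 1 else ?w t 0
      else if k < n then ?w t (Suc k) else ?w t 0 + ?w t 1)" for t k
    by (simp add: weight_def adj_def)
  have p: "?w t k \<ge> 1" for t k by (rule weight_ge_1)
  define d where "d = ?w (Suc s) 0"
  \<comment> \<open>The digit 1 discards the smaller weight \<open>?w s 0\<close>: the new first
    weight is \<open>?w s 1\<close>, and the new last one is at most twice that.\<close>
  have "?w (Suc s) n \<le> 2 * d"
    using a n weight_mono[OF n, of 0 1 a s] by (simp add: w d_def)
  \<comment> \<open>Each step at most doubles the largest weight and never lowers the
    smallest.\<close>
  have *: "d \<le> ?w (Suc s + i) 0 \<and> ?w (Suc s + i) n \<le> 2 ^ (i + 1) * d" for i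
  proof (induction i)
    case 0
    then show ?case using \<open>?w (Suc s) n \<le> 2 * d\<close> by (simp add: d_def)
  next
    case (Suc i)
    let ?t = "Suc s + i"
    have "?w ?t 0 \<le> ?w ?t 1" "?w ?t 1 \<le> ?w ?t n" "?w ?t 0 \<le> ?w ?t n" using weight_mono[OF n] n by auto
    then have "?w (Suc ?t) n \<le> 2 * ?w ?t n" "?w ?t 0 \<le> ?w (Suc ?t) 0" using n by (auto simp: w)
    then show ?case using Suc by simp
  qed
  obtain i where i: "t = Suc s + i" "i < N" using t by (metis le_Suc_ex nat_add_left_cancel_less)
  have "?w t 1 \<le> 2 ^ (i + 1) * d" using *[of i] weight_mono[OF n, of 1 n a t] n i by simp
  also have "\<dots> \<le> 2 ^ (N + 1) * ?w t 0"
    using *[of i] i p[of "Suc s" 0] by (intro mult_mono power_increasing) (auto simp: d_def)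
  finally have le: "?w t 0 + ?w t 1 \<le> (1 + 2 ^ (N + 1)) * ?w t 0" by (simp add: algebra_simps)
  define K :: real where "K = 1 + 2 ^ (N + 1)"
  have "K > 0" by (simp add: K_def add_pos_pos)
  then show ?thesis using le p[of t 0] p[of t 1]
    unfolding K_def[symmetric] by (simp add: ratio_def field_simps)
qed

lemma vert_shrink:
  assumes n: "1 \<le> n" and c: "c = 1 \<or> c = 2" and \<epsilon>: "0 < \<epsilon>"
  shows "\<exists>t lo hi. hi - lo \<le> \<epsilon> \<and> (\<forall>k\<le>n. vert n c a j t k \<in> {lo..hi})"
proof -
  interpret vertex_queue n "\<lambda>t. vert n c a j t 0" "\<lambda>t. vert n c a j t 1" "ratio n c a"
    by (rule vertex_queue_vert[OF n c])
  have encl: "\<forall>k\<le>n. vert n c a j t k \<in> {lo..hi}" if "enclosed t lo hi" for t lo hi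
  proof (intro allI impI)
    fix k assume k: "k \<le> n"
    show "vert n c a j t k \<in> {lo..hi}"
    proof (cases k)
      case (Suc i)
      then have "vert n c a j (t + i) 1 = vert n c a j t k"
        using adj_run_shift[of i 0 n] k by (simp add: vert_def weight_def)
      moreover have "vert n c a j (t + i) 1 \<in> {lo..hi}"
        using that Suc k unfolding enclosed_def by auto
      ultimately show ?thesis by metis
    next
      case 0
      then show ?thesis using that unfolding enclosed_def by auto
    qed
  qed
  consider "c = 2" | "c = 1" "\<forall>t. \<exists>s\<ge>t. a s" | T where "c = 1" "\<forall>s\<ge>T. \<not> a s" using c by blast
  then show ?thesis
  proof cases
    case 1
    have "\<exists>t lo hi. enclosed t lo hi \<and> hi - lo \<le> \<epsilon>"
      using \<epsilon> 1 by (intro contracts_to_0[of "1 / 2"]) (auto simp: ratio_def weight_2)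
    then show ?thesis using encl by metis
  next
    case 2
    have "\<exists>t lo hi. enclosed t lo hi \<and> hi - lo \<le> \<epsilon>"
    proof (rule contracts_to_0[of "1 / (1 + 2 ^ (window + 1))"])
      fix t1
      obtain s where "s \<ge> t1" "a s" using 2 by auto
      then show "\<exists>t0\<ge>t1. \<forall>t. t0 \<le> t \<longrightarrow> t < t0 + window \<longrightarrow> 1 / (1 + 2 ^ (window + 1)) \<le> ratio n c a t"
        using ratio_after_True[OF n, of a s _ window] 2(1) by (intro exI[of _ "Suc s"]) auto
    qed (use \<epsilon> in \<open>auto simp: add_pos_pos\<close>)
    then show ?thesis using encl by metis
  next
    case 3
    let ?f = "adj_run n 1 a (\<lambda>i. if i = j then 1 else 0)" and ?w = "weight n 1 a"
    \<comment> \<open>The difference in coordinate j between vertex k and the vertex kept forever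
      from time T on, with denominators cleared. As \<open>E t 0\<close> vanishes from then on, the
      entries of \<open>E t\<close> only change places and stay bounded, while the weights at the
      places 1 to n tend to infinity.\<close>
    define E where "E t k = ?w T 0 * ?f t k - ?f T 0 * ?w t k" for t k
    have E_run: "E t = adj_run n 1 a (\<lambda>i. ?w T 0 * (if i = j then 1 else 0) - ?f T 0 * 1) t" for t
      by (rule ext) (simp only: E_def weight_def adj_run_comb)
    have E_Suc: "E (Suc t) k = (if k = 0 then E t 0 else if k < n then E t (Suc k) else E t 0 + E t 1)"
      if "t \<ge> T" for t k using that 3 unfolding E_run by (simp add: adj_def)
    define C where "C = Max ((\<lambda>k. \<bar>E T k\<bar>) ` {..n})"
    have E0: "E (T + s) 0 = 0 \<and> (\<forall>k\<le>n. \<bar>E (T + s) k\<bar> \<le> C)" for s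
    proof (induction s)
      case 0
      then show ?case by (auto simp: E_def C_def mult.commute)
    next
      case (Suc s)
      then show ?case using n by (auto simp: E_Suc)
    qed
    have w0: "?w (T + s) 0 = ?w T 0" for s
      using 3 by (induction s) (auto simp: weight_def adj_def)
    have p: "?w t k \<ge> 1" for t k by (rule weight_ge_1)
    \<comment> \<open>In every round of n steps the constant weight of the kept vertex is added once
      to the weight at place 1.\<close>
    have grow: "?w (T + m * n) 1 \<ge> real m" for m
    proof (induction m)
      case (Suc m)
      have "?w (T + Suc m * n) 1 = ?w (T + m * n) 0 + ?w (T + m * n) 1"
        using adj_run_push[OF n, of 1 a "\<lambda>_. 1" "T + m * n"] by (simp add: weight_def ac_simps)
      then show ?case using Suc p[of "T + m * n" 0] by simp
    qed (use p[of T 1] in simp)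
    have C: "C \<ge> 0" using E0[of 0] by force
    obtain m :: nat where m: "real m > 2 * C / \<epsilon>" using reals_Archimedean2 by blast
    then have m0: "real m > 0" using C \<epsilon> by (smt (verit) divide_nonneg_pos mult_nonneg_nonneg)
    let ?t = "T + m * n" and ?P = "?f T 0 / ?w T 0"
    have "\<bar>vert n 1 a j ?t k - ?P\<bar> \<le> \<epsilon> / 2" if k: "k \<le> n" for k
    proof (cases "k = 0")
      case True
      have "E ?t 0 = 0" using E0 by auto
      then have "vert n 1 a j ?t 0 = ?P"
        using p[of T 0] p[of ?t 0] by (simp add: E_def vert_def field_simps)
      then show ?thesis using \<epsilon> True by simp
    next
      case False
      have "vert n 1 a j ?t k - ?P = E ?t k / (?w T 0 * ?w ?t k)"
        using p[of T 0] p[of ?t k] by (simp add: E_def vert_def field_simps)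
      then have "\<bar>vert n 1 a j ?t k - ?P\<bar> = \<bar>E ?t k\<bar> / (?w T 0 * ?w ?t k)"
        using p[of T 0] p[of ?t k] by (simp add: abs_mult)
      also have "\<dots> \<le> C / (1 * real m)"
      proof (rule frac_le)
        show "\<bar>E ?t k\<bar> \<le> C" using E0 k by auto
        have "real m \<le> ?w ?t k" using grow[of m] weight_mono[OF n, of 1 k a ?t] False k by simp
        then show "1 * real m \<le> ?w T 0 * ?w ?t k" using p[of T 0] p[of ?t k] by (intro mult_mono) auto
      qed (use C m0 in auto)
      also have "\<dots> \<le> \<epsilon> / 2" using m m0 \<epsilon> by (simp add: field_simps)
      finally show ?thesis .
    qed
    then have "\<forall>k\<le>n. vert n c a j ?t k \<in> {?P - \<epsilon> / 2..?P + \<epsilon> / 2}"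
      unfolding abs_diff_le_iff atLeastAtMost_iff 3(1) by blast
    then show ?thesis by (intro exI[of _ ?t] exI[of _ "?P - \<epsilon> / 2"] exI[of _ "?P + \<epsilon> / 2"]) simp
  qed
qed

section \<open>Points of a cylinder as mixtures of its vertices\<close>

context bary_map
begin

lemma bary_inv:
  assumes "x \<in> Delta_half a" "k \<le> CARD('n)"
  shows "bary x k = inv_lin CARD('n) c a (bary (R x)) k / (1 + (2 / c - 1) * bary (R x) CARD('n))"
  using bary_branch[OF R_Delta[OF Delta_half_subset[OF assms(1)]] assms(2), of a] branch_R[OF assms(1)] by simp

text \<open>A cylinder indexed by an infinite sequence and a length instead of a word, so that
  shifting the code is a change of index.\<close>

definition follows :: "(nat \<Rightarrow> bool) \<Rightarrow> nat \<Rightarrow> 'n point \<Rightarrow> bool" where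
  "follows a t x \<longleftrightarrow> x \<in> Delta \<and> (\<forall>i<t. (R ^^ i) x \<in> Delta_half (a i))"

text \<open>\<open>\<gamma>\<close> collects the normalizations of t inverse branches and does not
  depend on f; hence it may be computed from f = 1.\<close>

lemma bary_adj_run:
  assumes "follows a t x"
  shows "\<exists>\<gamma>>0. \<forall>f. (\<Sum>k\<le>CARD('n). bary x k * f k) =
    \<gamma> * (\<Sum>k\<le>CARD('n). bary ((R ^^ t) x) k * adj_run CARD('n) c a f t k)"
  using assms
proof (induction t)
  case 0
  then show ?case by (intro exI[of _ 1]) simp
next
  case (Suc t)
  let ?n = "CARD('n)"
  obtain \<gamma> where \<gamma>: "\<gamma> > 0" "\<And>f. (\<Sum>k\<le>?n. bary x k * f k) =
      \<gamma> * (\<Sum>k\<le>?n. bary ((R ^^ t) x) k * adj_run ?n c a f t k)"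
    using Suc by (auto simp: follows_def)
  have h: "(R ^^ t) x \<in> Delta_half (a t)" using Suc by (simp add: follows_def)
  define s where "s = 1 + (2 / c - 1) * bary (R ((R ^^ t) x)) ?n"
  have s: "s > 0" using branch_den_pos R_Delta Delta_half_subset[OF h] by (simp add: s_def)
  have "(\<Sum>k\<le>?n. bary ((R ^^ t) x) k * g k) =
      (\<Sum>k\<le>?n. bary ((R ^^ Suc t) x) k * adj ?n c (a t) g k) / s" for g
    using bary_inv[OF h] by (simp add: s_def sum_inv_lin_adj[symmetric] card_ge_1 sum_divide_distrib)
  then show ?case using \<gamma> s by (intro exI[of _ "\<gamma> / s"]) simp
qed

text \<open>x is a mixture of the vertices with weights \<open>w\<close>, which sum to 1 by the case
  f = 1 of \<open>bary_adj_run\<close>.\<close>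

lemma bary_vert_bounds:
  assumes x: "follows a t x" and j: "j \<le> CARD('n)"
    and V: "\<forall>k\<le>CARD('n). vert CARD('n) c a j t k \<in> {lo..hi}"
  shows "bary x j \<in> {lo..hi}"
proof -
  let ?n = "CARD('n)"
  obtain \<gamma> where \<gamma>: "\<gamma> > 0" "\<And>f. (\<Sum>k\<le>?n. bary x k * f k) =
      \<gamma> * (\<Sum>k\<le>?n. bary ((R ^^ t) x) k * adj_run ?n c a f t k)"
    using bary_adj_run[OF x] by auto
  define w where "w k = \<gamma> * bary ((R ^^ t) x) k * weight ?n c a t k" for k
  have "(R ^^ t) x \<in> Delta" using x funpow_Delta by (simp add: follows_def)
  then have w0: "w k \<ge> 0" if "k \<le> ?n" for k
    using that \<gamma> weight_pos[OF c, of ?n a t k] by (simp add: w_def bary_ge_0)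
  have w1: "(\<Sum>k\<le>?n. w k) = 1"
    using \<gamma>(2)[of "\<lambda>_. 1"] by (simp add: w_def weight_def sum_distrib_left mult.assoc)
  have "bary x j = (\<Sum>k\<le>?n. bary x k * (if k = j then 1 else 0))"
    using j by (simp add: if_distrib[of "\<lambda>x. _ * x"] cong: if_cong)
  also have "\<dots> = (\<Sum>k\<le>?n. w k * vert ?n c a j t k)"
    using weight_pos[OF c, of ?n a t] unfolding \<gamma>(2)
    by (simp add: w_def vert_def sum_distrib_left mult.assoc order_less_imp_not_eq2)
  finally have e: "bary x j = (\<Sum>k\<le>?n. w k * vert ?n c a j t k)" .
  have "(\<Sum>k\<le>?n. w k * lo) \<le> bary x j" "bary x j \<le> (\<Sum>k\<le>?n. w k * hi)"
    unfolding e using w0 V by (auto intro!: sum_mono mult_left_mono)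
  then show ?thesis by (simp add: sum_distrib_right[symmetric] w1)
qed

lemma follows_close:
  assumes "0 < \<epsilon>" "j \<le> CARD('n)"
  shows "\<exists>t. \<forall>x y. follows a t x \<longrightarrow> follows a t y \<longrightarrow> \<bar>bary x j - bary y j\<bar> \<le> \<epsilon>"
proof -
  obtain t lo hi where t: "hi - lo \<le> \<epsilon>" "\<forall>k\<le>CARD('n). vert CARD('n) c a j t k \<in> {lo..hi}"
    using vert_shrink[OF card_ge_1[where 'n='n] c assms(1)] by metis
  show ?thesis
  proof (intro exI[of _ t] allI impI)
    fix x y assume "follows a t x" "follows a t y"
    then have "bary x j \<in> {lo..hi}" "bary y j \<in> {lo..hi}" using bary_vert_bounds[OF _ assms(2) t(2)] by auto
    then show "\<bar>bary x j - bary y j\<bar> \<le> \<epsilon>" using t(1) by auto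
  qed
qed

definition codes :: "(nat \<Rightarrow> bool) \<Rightarrow> 'n point \<Rightarrow> bool" where
  "codes a x \<longleftrightarrow> (\<forall>t. follows a t x)"

lemma codes_unique:
  assumes "codes a x" "codes a y"
  shows "x = y"
proof (rule bary_eqI)
  fix k assume k: "k \<le> CARD('n)"
  have "\<bar>bary x k - bary y k\<bar> \<le> 0 + \<epsilon>" if "0 < \<epsilon>" for \<epsilon>
    using follows_close[OF that k, of a] assms by (auto simp: codes_def)
  then have "\<bar>bary x k - bary y k\<bar> \<le> 0" by (rule field_le_epsilon)
  then show "bary x k = bary y k" by simp
qed

end

section \<open>Codes and the conjugacy\<close>

lemma Delta_compact: "compact (Delta :: 'n::{finite,linorder} point set)"
  unfolding Delta_def simplex_of_columns_def by (intro finite_imp_compact_convex_hull) simp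

text \<open>
  The facet \<open>b\<^sub>k = 0\<close> of a half of the simplex is mapped to the intersection of the facets in
  \<open>facet_step n a {k}\<close>. This does not depend on \<open>c\<close>, so the combinatorics of the cylinders is the
  same for both maps.
\<close>

definition facet_step :: "nat \<Rightarrow> bool \<Rightarrow> nat set \<Rightarrow> nat set" where
  "facet_step n a S = (\<Union>k\<in>S. if 2 \<le> k then {k - 1} else if (k = 0) = a then {n} else {0, n})"

primrec facet_run :: "nat \<Rightarrow> (nat \<Rightarrow> bool) \<Rightarrow> nat set \<Rightarrow> nat \<Rightarrow> nat set" where
  "facet_run n a S 0 = S"
| "facet_run n a S (Suc t) = facet_step n (a t) (facet_run n a S t)"

lemma facet_run_subset: "S \<subseteq> {..n} \<Longrightarrow> facet_run n a S t \<subseteq> {..n}"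
  by (induction t) (force simp: facet_step_def split: if_splits)+

section \<open>Coded points and the faces that contain them\<close>

context bary_map
begin

lemma continuous_on_branch: "continuous_on Delta (branch a)"
proof -
  have "continuous_on Delta (\<lambda>y :: 'n point. inv_lin CARD('n) c a (bary y) k)" for k
    unfolding inv_lin_def using c0
    by (cases "2 \<le> k"; cases "(k = 1) = a") (auto intro!: continuous_intros)
  then show ?thesis
    unfolding branch_def point_of_def
    using branch_den_pos c0
    by (intro continuous_on_vec_lambda continuous_on_sum continuous_on_divide continuous_intros)
      (auto simp: order_less_imp_not_eq2)
qed

lemma follows_Suc: "follows a (Suc t) x \<longleftrightarrow> x \<in> Delta_half (a 0) \<and> follows (\<lambda>i. a (Suc i)) t (R x)"
  using R_Delta by (auto simp: follows_def Delta_half_subset less_Suc_eq_0_disj funpow_swap1)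

lemma follows_Suc_image: "{x. follows a (Suc t) x} = branch (a 0) ` {x. follows (\<lambda>i. a (Suc i)) t x}"
proof (intro subset_antisym subsetI)
  fix x assume "x \<in> {x. follows a (Suc t) x}"
  then show "x \<in> branch (a 0) ` {x. follows (\<lambda>i. a (Suc i)) t x}"
    using branch_R[of x "a 0"] by (auto simp: follows_Suc image_iff intro!: exI[of _ "R x"])
next
  fix x assume "x \<in> branch (a 0) ` {x. follows (\<lambda>i. a (Suc i)) t x}"
  then obtain y where "x = branch (a 0) y" "follows (\<lambda>i. a (Suc i)) t y" by auto
  moreover from this have "y \<in> Delta" by (simp add: follows_def)
  ultimately show "x \<in> {x. follows a (Suc t) x}" by (simp add: follows_Suc branch_half R_branch)
qed

lemma follows_reach: "y \<in> Delta \<Longrightarrow> \<exists>x. follows a t x \<and> (R ^^ t) x = y"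
proof (induction t arbitrary: a)
  case 0
  then show ?case by (simp add: follows_def)
next
  case (Suc t)
  then obtain x where x: "follows (\<lambda>i. a (Suc i)) t x" "(R ^^ t) x = y" by blast
  then have "x \<in> Delta" by (simp add: follows_def)
  with x show ?case
    by (intro exI[of _ "branch (a 0) x"]) (simp add: follows_Suc branch_half R_branch funpow_swap1)
qed

lemma compact_follows: "compact {x. follows a t x}"
proof (induction t arbitrary: a)
  case 0
  then show ?case by (simp add: follows_def Delta_compact)
next
  case (Suc t)
  show ?case unfolding follows_Suc_image
    by (intro compact_continuous_image Suc continuous_on_subset[OF continuous_on_branch])
      (auto simp: follows_def)
qed

lemma codes_exists: "\<exists>x. codes a x"
proof -
  have "\<Inter>(range (\<lambda>t. {x. follows a t x})) \<noteq> {}"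
  proof (rule compact_nest)
    show "{x. follows a t x} \<noteq> {}" for t using follows_reach[OF v1_Delta] by blast
    show "{x. follows a t x} \<subseteq> {x. follows a s x}" if "s \<le> t" for s t
      using that by (auto simp: follows_def)
  qed (rule compact_follows)
  then show ?thesis by (auto simp: codes_def)
qed

lemma codes_iff: "codes a x \<longleftrightarrow> x \<in> Delta \<and> (\<forall>i. (R ^^ i) x \<in> Delta_half (a i))"
  by (auto simp: codes_def follows_def)

lemma codes_digits: "x \<in> Delta \<Longrightarrow> codes (\<lambda>i. digit ((R ^^ i) x)) x"
  by (simp add: codes_iff Delta_half_digit funpow_Delta)

lemma codes_shift: "codes a x \<Longrightarrow> codes (\<lambda>i. a (s + i)) ((R ^^ s) x)"
  by (auto simp: codes_iff funpow_Delta) (metis add.commute comp_apply funpow_add)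

lemma coded_point_eq:
  assumes "codes a x"
  shows "coded_point R a = x"
proof -
  have "y \<in> (\<Inter>t. cylinder R (map a [0..<t])) \<longleftrightarrow> codes a y" for y
    by (auto simp: cylinder_def codes_def follows_def)
  then show ?thesis
    unfolding coded_point_def using assms codes_unique by (intro the_equality) blast+
qed

lemma coded_point_eq_iff: "coded_point R a = x \<longleftrightarrow> codes a x"
  using codes_exists coded_point_eq by metis

text \<open>Up to a positive factor, coordinate 0 of \<open>R x\<close> is the distance between b_0
  and b_1, which vanishes exactly on the common face of the two halves.\<close>

lemma half_ambiguous:
  assumes x: "x \<in> Delta_half a"
  shows "x \<in> Delta_half b \<longleftrightarrow> b = a \<or> bary (R x) 0 = 0"
  using x R_half[OF x, of 0] den_pos[OF x] by (auto simp: Delta_half_iff step_lin_def split: if_splits)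

lemma facet_step_iff:
  assumes x: "x \<in> Delta_half a" and S: "S \<subseteq> {..CARD('n)}"
  shows "(\<forall>k\<in>S. bary x k = 0) \<longleftrightarrow> (\<forall>k\<in>facet_step CARD('n) a S. bary (R x) k = 0)"
proof -
  let ?n = "CARD('n)"
  have y: "R x \<in> Delta" using x R_Delta Delta_half_subset by blast
  define F where "F k = (if 2 \<le> k then {k - 1} else if (k = 0) = a then {?n} else {0, ?n})" for k
  have F: "bary x k = 0 \<longleftrightarrow> (\<forall>j\<in>F k. bary (R x) j = 0)" if "k \<le> ?n" for k
  proof -
    have z: "bary x k = 0 \<longleftrightarrow> inv_lin ?n c a (bary (R x)) k = 0"
      using bary_inv[OF x that] branch_den_pos[OF y] by simp
    consider "2 \<le> k" | "k < 2" "(k = 0) = a" | "k < 2" "(k = 0) \<noteq> a" by linarith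
    then show ?thesis
    proof cases
      case 1
      then show ?thesis by (simp add: z inv_lin_def F_def)
    next
      case 2
      then have "(k = 1) \<noteq> a" by auto
      then have "inv_lin ?n c a (bary (R x)) k = bary (R x) ?n / c" using 2 by (simp add: inv_lin_def)
      then show ?thesis using 2 c0 by (simp add: z F_def)
    next
      \<comment> \<open>A sum of two non-negative terms vanishes only if both do: here one facet
        becomes the intersection of two, and c drops out.\<close>
      case 3
      then have "(k = 1) = a" by auto
      then have "inv_lin ?n c a (bary (R x)) k = bary (R x) 0 + bary (R x) ?n / c" using 3 by (simp add: inv_lin_def)
      then show ?thesis
        using 3 c0 bary_ge_0[OF y, of 0] bary_ge_0[OF y, of ?n] by (simp add: z F_def add_nonneg_eq_0_iff)
    qed
  qed
  have "(\<forall>k\<in>S. bary x k = 0) \<longleftrightarrow> (\<forall>k\<in>S. \<forall>j\<in>F k. bary (R x) j = 0)"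
    using S F by (intro ball_cong) auto
  then show ?thesis unfolding facet_step_def F_def by blast
qed

lemma facet_run_iff:
  assumes "follows a t x" and S: "S \<subseteq> {..CARD('n)}"
  shows "(\<forall>k\<in>S. bary x k = 0) \<longleftrightarrow> (\<forall>k\<in>facet_run CARD('n) a S t. bary ((R ^^ t) x) k = 0)"
  using assms(1)
proof (induction t)
  case (Suc t)
  then have "(R ^^ t) x \<in> Delta_half (a t)" "follows a t x" by (auto simp: follows_def)
  then show ?case
    using Suc.IH facet_step_iff[of "(R ^^ t) x" "a t" "facet_run CARD('n) a S t"] facet_run_subset[OF S] by simp
qed simp

text \<open>If all indices occur at time t, the face would be mapped into the empty intersection of
  all facets. Otherwise, for every t some vertex of \<open>Delta\<close> is missed by the facet
  conditions; its preimage in the cylinder lies on the face, and for suitable t it is close to x in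
  coordinate k.\<close>

lemma face_codes_iff:
  assumes x: "codes a x" and S: "S \<subseteq> {..CARD('n)}"
  shows "(\<forall>k\<in>S. bary x k = 0) \<longleftrightarrow> (\<forall>t. facet_run CARD('n) a S t \<noteq> {..CARD('n)})"
proof
  assume *: "\<forall>k\<in>S. bary x k = 0"
  show "\<forall>t. facet_run CARD('n) a S t \<noteq> {..CARD('n)}"
  proof (intro allI notI)
    fix t assume "facet_run CARD('n) a S t = {..CARD('n)}"
    then have "\<forall>k\<le>CARD('n). bary ((R ^^ t) x) k = 0"
      using facet_run_iff[OF _ S, of a t x] x * by (simp add: codes_def)
    then show False using sum_bary[of "(R ^^ t) x"] by (simp del: sum_bary)
  qed
next
  assume *: "\<forall>t. facet_run CARD('n) a S t \<noteq> {..CARD('n)}"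
  show "\<forall>k\<in>S. bary x k = 0"
  proof
    fix k assume k: "k \<in> S"
    then have kn: "k \<le> CARD('n)" using S by auto
    have "\<bar>bary x k\<bar> \<le> 0 + \<epsilon>" if \<epsilon>: "0 < \<epsilon>" for \<epsilon>
    proof -
      obtain t where t: "\<And>x y. follows a t x \<Longrightarrow> follows a t y \<Longrightarrow> \<bar>bary x k - bary y k\<bar> \<le> \<epsilon>"
        using follows_close[OF \<epsilon> kn] by blast
      obtain m where m: "m \<le> CARD('n)" "m \<notin> facet_run CARD('n) a S t"
        using * facet_run_subset[OF S] by blast
      define y :: "'n point" where "y = point_of (\<lambda>j. if j = m then 1 else 0)"
      have y: "bary y j = (if j = m then 1 else 0)" if "j \<le> CARD('n)" for j
        unfolding y_def using that m by (intro bary_point_of) auto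
      then have "y \<in> Delta" by (simp add: Delta_iff)
      then obtain z where z: "follows a t z" "(R ^^ t) z = y" using follows_reach by blast
      have "\<forall>j\<in>facet_run CARD('n) a S t. bary ((R ^^ t) z) j = 0"
        using m facet_run_subset[OF S, of a t] by (auto simp: z y subset_iff)
      then have "bary z k = 0" using facet_run_iff[OF z(1) S] k by blast
      then show ?thesis using t[of x z] x z by (simp add: codes_def)
    qed
    then have "\<bar>bary x k\<bar> \<le> 0" by (rule field_le_epsilon)
    then show "bary x k = 0" by simp
  qed
qed

text \<open>The right-hand side mentions neither \<open>R\<close> nor c. So a point for
  \<open>M\<close> and a point for \<open>T\<close> that share one code share all their
  codes.\<close>

lemma codes_ambiguous:
  assumes x: "codes a x"
  shows "codes b x \<longleftrightarrow> (\<forall>i. b i = a i \<or> (\<forall>t. facet_run CARD('n) (\<lambda>j. a (Suc i + j)) {0} t \<noteq> {..CARD('n)}))"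
proof -
  have "codes b x \<longleftrightarrow> (\<forall>i. b i = a i \<or> bary ((R ^^ Suc i) x) 0 = 0)"
  proof -
    have "(R ^^ i) x \<in> Delta_half (b i) \<longleftrightarrow> b i = a i \<or> bary ((R ^^ Suc i) x) 0 = 0" for i
      using half_ambiguous[of "(R ^^ i) x" "a i" "b i"] x by (simp add: codes_iff)
    then show ?thesis using x by (simp add: codes_iff)
  qed
  also have "\<dots> \<longleftrightarrow> (\<forall>i. b i = a i \<or> (\<forall>t. facet_run CARD('n) (\<lambda>j. a (Suc i + j)) {0} t \<noteq> {..CARD('n)}))"
  proof -
    have "bary ((R ^^ Suc i) x) 0 = 0 \<longleftrightarrow>
        (\<forall>t. facet_run CARD('n) (\<lambda>j. a (Suc i + j)) {0} t \<noteq> {..CARD('n)})" for i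
      using face_codes_iff[OF codes_shift[OF x, of "Suc i"], of "{0}"] by simp
    then show ?thesis by (simp only:)
  qed
  finally show ?thesis .
qed

lemma funpow_eq_v1_iff: "codes a x \<Longrightarrow> (R ^^ s) x = v1 \<longleftrightarrow> codes (\<lambda>i. a (s + i)) v1"
  using codes_shift codes_unique by metis

lemma codes_v1: "codes (\<lambda>_. False) v1"
  by (simp add: codes_iff v1_Delta funpow_v1 Delta_half_iff bary_v1 card_ge_1 del: One_nat_def)

end

section \<open>Transfer between the two maps\<close>

interpretation M: bary_map "M_map :: 'n::{finite,linorder} point \<Rightarrow> 'n point" 1
  by (rule M_bary_map)

interpretation T: bary_map "T_map :: 'n::{finite,linorder} point \<Rightarrow> 'n point" 2
  by (rule T_bary_map)

lemma codes_M_iff_T: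
  fixes x y :: "'n::{finite,linorder} point"
  assumes "M.codes a x" "T.codes a y"
  shows "M.codes b x \<longleftrightarrow> T.codes b y"
  using M.codes_ambiguous[OF assms(1)] T.codes_ambiguous[OF assms(2)] by simp

lemma Phi_eq:
  fixes p q :: "'n::{finite,linorder} point"
  assumes "M.codes a p" "T.codes a q"
  shows "Phi p = q"
  unfolding Phi_def
proof (rule the_equality)
  show "\<exists>a. coded_point M_map a = p \<and> q = coded_point T_map a"
    using assms M.coded_point_eq T.coded_point_eq by metis
  fix q' :: "'n point" assume "\<exists>a. coded_point M_map a = p \<and> q' = coded_point T_map a"
  then obtain b where "M.codes b p" "T.codes b q'"
    using M.coded_point_eq_iff T.coded_point_eq_iff by metis
  then show "q' = q" using codes_M_iff_T[OF assms] T.codes_unique by blast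
qed

text \<open>Reaching \<open>v1\<close> after s steps means that the code shifted by s is a code of
  \<open>v1\<close>, and \<open>v1\<close> has the same codes for both maps.\<close>

lemma bij_betw_Phi_GO:
  "bij_betw Phi (GO M_map (v1 :: 'n::{finite,linorder} point)) (GO T_map v1)"
proof -
  have v1: "M.codes a (v1 :: 'n point) \<longleftrightarrow> T.codes a (v1 :: 'n point)" for a
    by (rule codes_M_iff_T[OF M.codes_v1 T.codes_v1])
  have GO: "p \<in> GO M_map v1 \<longleftrightarrow> q \<in> GO T_map v1" if "M.codes a p" "T.codes a q" for a and p q :: "'n point"
    using M.funpow_eq_v1_iff[OF that(1)] T.funpow_eq_v1_iff[OF that(2)] that
    by (simp add: M.GO_v1_iff T.GO_v1_iff v1) (simp add: M.codes_iff T.codes_iff)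
  have M_ex: "\<exists>a. \<exists>q :: 'n point. M.codes a p \<and> T.codes a q" if "p \<in> Delta" for p :: "'n point"
    using M.codes_digits[OF that] T.codes_exists by blast
  have T_ex: "\<exists>a. \<exists>p :: 'n point. M.codes a p \<and> T.codes a q" if "q \<in> Delta" for q :: "'n point"
    using T.codes_digits[OF that] M.codes_exists by blast
  show ?thesis
    unfolding bij_betw_def
  proof (intro conjI inj_onI subset_antisym subsetI)
    fix p p' :: "'n point" assume p: "p \<in> GO M_map v1" "p' \<in> GO M_map v1" "Phi p = Phi p'"
    then obtain a a' and q q' :: "'n point" where q: "M.codes a p" "T.codes a q" "M.codes a' p'" "T.codes a' q'"
      using M_ex by (metis M.GO_v1_iff)
    then have "q = q'" using Phi_eq p(3) by metis
    then show "p = p'" using q codes_M_iff_T[OF q(1,2)] M.codes_unique by blast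
  next
    fix q assume "q \<in> Phi ` GO M_map (v1 :: 'n point)"
    then obtain p :: "'n point" where p: "p \<in> GO M_map v1" "q = Phi p" by auto
    then obtain a and q' :: "'n point" where "M.codes a p" "T.codes a q'" using M_ex by (metis M.GO_v1_iff)
    then show "q \<in> GO T_map v1" using GO p Phi_eq by metis
  next
    fix q :: "'n point" assume q: "q \<in> GO T_map v1"
    then obtain a and p :: "'n point" where "M.codes a p" "T.codes a q" using T_ex by (metis T.GO_v1_iff)
    then show "q \<in> Phi ` GO M_map v1" using GO q Phi_eq by (metis imageI)
  qed
qed

section \<open>Rational and dyadic points\<close>

lemma sum_closed:
  fixes S :: "real set"
  assumes "0 \<in> S" "\<And>x y. x \<in> S \<Longrightarrow> y \<in> S \<Longrightarrow> x - y \<in> S" "\<And>k. k \<in> A \<Longrightarrow> f k \<in> S"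
  shows "sum f A \<in> S"
proof (cases "finite A")
  case True
  then show ?thesis using assms(3)
  proof (induction A)
    case (insert k A)
    then have "sum f A \<in> S" "f k \<in> S" by auto
    then have "f k - (0 - sum f A) \<in> S" by (intro assms(1,2))
    then show ?case using insert by simp
  qed (simp add: assms(1))
qed (simp add: assms(1))

text \<open>Affine and barycentric coordinates are integral combinations of each other and 1. The
  set S will be the rationals, the dyadic rationals, or a real field.\<close>

lemma coords_closed_iff:
  fixes x :: "'n::{finite,linorder} point"
  assumes S: "0 \<in> S" "1 \<in> S" "\<And>x y. x \<in> S \<Longrightarrow> y \<in> S \<Longrightarrow> x - y \<in> S"
  shows "(\<forall>i. x $ i \<in> S) \<longleftrightarrow> (\<forall>k\<le>CARD('n). bary x k \<in> S)"
proof
  assume "\<forall>i. x $ i \<in> S"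
  then have "coord x m \<in> S" for m using coord_cases[of x m] S by auto
  then show "\<forall>k\<le>CARD('n). bary x k \<in> S" using S by (simp add: bary_def)
next
  assume "\<forall>k\<le>CARD('n). bary x k \<in> S"
  then show "\<forall>i. x $ i \<in> S" unfolding nth_bary using S by (auto intro!: sum_closed)
qed

lemma rational_point_iff: "rational_point (x :: 'n::{finite,linorder} point) \<longleftrightarrow> (\<forall>k\<le>CARD('n). bary x k \<in> \<rat>)"
  unfolding rational_point_def by (rule coords_closed_iff) auto

section \<open>Common denominators, and orbits of rational and dyadic points\<close>

lemma dyadic_iff: "x \<in> dyadic_rationals \<longleftrightarrow> (\<exists>m :: nat. x * 2 ^ m \<in> \<int>)"
proof
  assume "x \<in> dyadic_rationals"
  then obtain k :: int and m :: nat where "x = of_int k / 2 ^ m" by (auto simp: dyadic_rationals_def)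
  then have "x * 2 ^ m = of_int k" by simp
  then show "\<exists>m :: nat. x * 2 ^ m \<in> \<int>" by (metis Ints_of_int)
next
  assume "\<exists>m :: nat. x * 2 ^ m \<in> \<int>"
  then obtain m :: nat and k :: int where "x * 2 ^ m = of_int k" by (auto elim: Ints_cases)
  then have "x = of_int k / 2 ^ m" by (simp add: field_simps)
  then show "x \<in> dyadic_rationals" by (auto simp: dyadic_rationals_def)
qed

lemma dyadic_diff:
  assumes "x \<in> dyadic_rationals" "y \<in> dyadic_rationals"
  shows "x - y \<in> dyadic_rationals"
proof -
  obtain m m' :: nat where "x * 2 ^ m \<in> \<int>" "y * 2 ^ m' \<in> \<int>" using assms by (auto simp: dyadic_iff)
  then have "x * 2 ^ m * 2 ^ m' - y * 2 ^ m' * 2 ^ m \<in> \<int>" by auto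
  then have "(x - y) * 2 ^ (m + m') \<in> \<int>" by (simp add: power_add algebra_simps)
  then show ?thesis by (auto simp: dyadic_iff)
qed

lemma dyadic_half:
  assumes "x \<in> dyadic_rationals"
  shows "x / 2 \<in> dyadic_rationals"
proof -
  obtain m :: nat where "x * 2 ^ m \<in> \<int>" using assms by (auto simp: dyadic_iff)
  then have "x / 2 * 2 ^ Suc m \<in> \<int>" by simp
  then show ?thesis unfolding dyadic_iff by blast
qed

lemma dyadic_0_1: "0 \<in> dyadic_rationals" "1 \<in> dyadic_rationals"
  unfolding dyadic_iff by auto

lemma dyadic_point_iff:
  "dyadic_point (x :: 'n::{finite,linorder} point) \<longleftrightarrow> (\<forall>k\<le>CARD('n). bary x k \<in> dyadic_rationals)"
  unfolding dyadic_point_def by (rule coords_closed_iff) (auto simp: dyadic_0_1 dyadic_diff)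

text \<open>D is the set of positive integers for rational points and of powers of 2 for dyadic
  points.\<close>

lemma common_multiple:
  fixes f :: "nat \<Rightarrow> real" and D :: "nat set"
  assumes D: "1 \<in> D" "\<And>M N. M \<in> D \<Longrightarrow> N \<in> D \<Longrightarrow> M * N \<in> D"
  shows "(\<And>k. k < m \<Longrightarrow> \<exists>N\<in>D. f k * real N \<in> \<int>) \<Longrightarrow> \<exists>N\<in>D. \<forall>k<m. f k * real N \<in> \<int>"
proof (induction m)
  case (Suc m)
  then obtain N where N: "N \<in> D" "\<And>k. k < m \<Longrightarrow> f k * real N \<in> \<int>" by force
  obtain M where M: "M \<in> D" "f m * real M \<in> \<int>" using Suc by blast
  have "f k * real (M * N) \<in> \<int>" if "k < Suc m" for k
  proof (cases "k = m")
    case True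
    have "f m * real M * real N \<in> \<int>" using M by auto
    then show ?thesis by (simp add: True mult.assoc)
  next
    case False
    then have "f k * real N * real M \<in> \<int>" using N(2)[of k] that by auto
    then show ?thesis by (simp add: ac_simps)
  qed
  then show ?case using D M N by blast
qed (use D in auto)

lemma rational_common_denominator:
  assumes "rational_point (x :: 'n::{finite,linorder} point)"
  obtains N :: nat where "N > 0" "\<forall>k\<le>CARD('n). bary x k * real N \<in> \<int>"
proof -
  have "\<exists>N\<in>{N. N > 0}. bary x k * real N \<in> \<int>" if "k < CARD('n) + 1" for k
  proof -
    have "bary x k \<in> \<rat>" using assms that by (simp add: rational_point_iff)
    then obtain p q :: int where pq: "q > 0" "bary x k = of_int p / of_int q"
      by (metis Rats_cases' of_rat_rat)
    then have "bary x k * real (nat q) = of_int p" by simp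
    then show ?thesis using pq by (intro bexI[of _ "nat q"]) auto
  qed
  then obtain N where "N \<in> {N. N > 0}" "\<forall>k<CARD('n) + 1. bary x k * real N \<in> \<int>"
    using common_multiple[of "{N. N > 0}" "CARD('n) + 1" "bary x"] by auto
  then show ?thesis using that[of N] by auto
qed

lemma dyadic_common_denominator:
  assumes "dyadic_point (x :: 'n::{finite,linorder} point)"
  obtains m :: nat where "\<forall>k\<le>CARD('n). bary x k * 2 ^ m \<in> \<int>"
proof -
  let ?D = "range (\<lambda>m. 2 ^ m :: nat)"
  have "\<exists>N\<in>?D. bary x k * real N \<in> \<int>" if k: "k < CARD('n) + 1" for k
  proof -
    have "bary x k \<in> dyadic_rationals" using assms k by (simp add: dyadic_point_iff)
    then obtain m :: nat where "bary x k * 2 ^ m \<in> \<int>" by (auto simp: dyadic_iff)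
    then show ?thesis by (intro bexI[of _ "2 ^ m"]) auto
  qed
  moreover have "1 \<in> ?D" by (rule range_eqI[of _ _ 0]) simp
  moreover have "M * N \<in> ?D" if "M \<in> ?D" "N \<in> ?D" for M N
    using that by (auto simp: power_add[symmetric])
  ultimately obtain N where "N \<in> ?D" "\<forall>k<CARD('n) + 1. bary x k * real N \<in> \<int>"
    using common_multiple[of ?D "CARD('n) + 1" "bary x"] by blast
  moreover from this obtain m where "N = 2 ^ m" by blast
  ultimately show ?thesis using that[of m] by simp
qed

text \<open>A lexicographic induction on the denominator N and a bound L for the support. If
  \<open>m > 0\<close>, N drops to N - m and L is reset to n; if \<open>m = 0\<close>, the enqueued
  coordinate is 0 and the shift lowers L.\<close>

lemma M_rational_reaches_aux:
  fixes x :: "'n::{finite,linorder} point" and a :: "nat \<Rightarrow> nat"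
  shows "x \<in> Delta \<Longrightarrow> N > 0 \<Longrightarrow> (\<And>k. k \<le> CARD('n) \<Longrightarrow> bary x k = real (a k) / real N) \<Longrightarrow>
    (\<And>k. L < k \<Longrightarrow> k \<le> CARD('n) \<Longrightarrow> a k = 0) \<Longrightarrow> \<exists>t. (M_map ^^ t) x = v1"
proof (induction N arbitrary: x a L rule: less_induct)
  case (less N)
  show ?case using less.prems
  proof (induction L arbitrary: x a)
    case 0
    have "(\<Sum>k\<le>CARD('n). bary x k) = (\<Sum>k\<in>{0}. bary x k)"
      using 0 by (intro sum.mono_neutral_right) auto
    then have "bary x 0 = 1" by simp
    then have "x = v1" using 0 by (intro v1_eqI)
    then show ?case by (intro exI[of _ 0]) simp
  next
    case (Suc L)
    let ?n = "CARD('n)"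
    have n: "1 \<le> ?n" by (rule card_ge_1)
    define m a' where "m = min (a 0) (a 1)"
      and "a' k = (if k = 0 then max (a 0) (a 1) - m else if k < ?n then a (Suc k) else m)" for k
    have "real (a 0) / real N + real (a 1) / real N \<le> 1"
      using bary_add_le_1[OF Suc.prems(1), of 0 1] Suc.prems(3)[of 0] Suc.prems(3)[of 1] n by simp
    then have "real (a 0 + a 1) \<le> real N" using Suc.prems(2) by (simp add: field_simps)
    then have "a 0 + a 1 \<le> N" by (simp only: of_nat_le_iff)
    then have mN: "m < N" using Suc.prems(2) by (auto simp: m_def)
    have dig: "digit x \<longleftrightarrow> a 0 < a 1"
      using Suc.prems(2) Suc.prems(3)[of 0] Suc.prems(3)[of 1] n by (simp add: digit_def divide_less_cancel)
    have half: "x \<in> Delta_half (digit x)" using Suc.prems(1) by (rule Delta_half_digit)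
    have b: "bary (M_map x) k = real (a' k) / real (N - m)" if k: "k \<le> ?n" for k
    proof -
      have "step_lin ?n 1 (digit x) (bary x) k = real (a' k) / real N"
        using k n Suc.prems(3)[of 0] Suc.prems(3)[of 1] Suc.prems(3)[of "Suc k"]
        by (auto simp: step_lin_def a'_def m_def dig of_nat_diff diff_divide_distrib min_def max_def)
      moreover have "M.den (digit x) x = real (N - m) / real N"
        using n Suc.prems(2) Suc.prems(3)[of 0] Suc.prems(3)[of 1] mN
        by (auto simp: M.den_def dig m_def of_nat_diff diff_divide_distrib min_def)
      ultimately show ?thesis using M.R_half[OF half k] Suc.prems(2) by simp
    qed
    have "\<exists>t. (M_map ^^ t) (M_map x) = v1"
    proof (cases "m = 0")
      case True
      have "a' k = 0" if k: "L < k" "k \<le> ?n" for k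
        using k True Suc.prems(4)[of "Suc k"] by (auto simp: a'_def)
      then show ?thesis
        using Suc.IH[of "M_map x" a'] M.R_Delta[OF Suc.prems(1)] Suc.prems(2) b True by simp
    next
      case False
      then show ?thesis
        using less.IH[of "N - m" "M_map x" a' ?n] M.R_Delta[OF Suc.prems(1)] mN b by simp
    qed
    then show ?case by (metis comp_apply funpow_Suc_right)
  qed
qed

lemma M_rational_reaches:
  fixes x :: "'n::{finite,linorder} point"
  assumes "rational_point x" "x \<in> Delta"
  shows "\<exists>t. (M_map ^^ t) x = v1"
proof -
  obtain N :: nat where N: "N > 0" "\<forall>k\<le>CARD('n). bary x k * real N \<in> \<int>"
    using assms(1) by (rule rational_common_denominator)
  define a where "a k = nat \<lfloor>bary x k * real N\<rfloor>" for k
  have "bary x k = real (a k) / real N" if k: "k \<le> CARD('n)" for k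
  proof -
    obtain z where z: "bary x k * real N = of_int z" using N(2)[rule_format, OF k] by (auto elim: Ints_cases)
    moreover have "bary x k * real N \<ge> 0" using bary_ge_0[OF assms(2) k] by simp
    ultimately have "real (a k) = bary x k * real N" by (simp add: a_def)
    then show ?thesis using N(1) by (simp add: field_simps)
  qed
  then show ?thesis using M_rational_reaches_aux[OF assms(2) N(1), of a "CARD('n)"] by auto
qed

text \<open>Every enqueued coordinate has been doubled. After n steps this covers the places 1 to n,
  and the coordinate sum 1 takes care of place 0. For m = 0 the coordinates are integers between 0
  and 1, so the point is a vertex.\<close>

lemma T_dyadic_reaches_aux:
  fixes x :: "'n::{finite,linorder} point"
  shows "x \<in> Delta \<Longrightarrow> (\<And>k. k \<le> CARD('n) \<Longrightarrow> bary x k * 2 ^ m \<in> \<int>) \<Longrightarrow> \<exists>t. (T_map ^^ t) x = v1"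
proof (induction m arbitrary: x)
  case 0
  have "\<not> (\<forall>k\<le>CARD('n). bary x k = 0)"
  proof
    assume "\<forall>k\<le>CARD('n). bary x k = 0"
    then have "(\<Sum>k\<le>CARD('n). bary x k) = 0" by simp
    then show False by simp
  qed
  then obtain k where k: "k \<le> CARD('n)" "bary x k \<noteq> 0" by auto
  obtain z :: int where z: "bary x k = of_int z" using 0(2)[OF k(1)] by (auto elim: Ints_cases)
  then have "bary x k = 1"
    using bary_ge_0[OF 0(1) k(1)] bary_le_1[OF 0(1) k(1)] k(2) by (simp add: z)
  then show ?case using T.unit_reaches_v1[OF 0(1) _ k(1)] by simp
next
  case (Suc m)
  let ?n = "CARD('n)"
  \<comment> \<open>After j steps the last j places hold enqueued coordinates.\<close>
  have *: "(\<forall>k\<le>?n. bary ((T_map ^^ j) x) k * 2 ^ Suc m \<in> \<int>) \<and>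
      (\<forall>k\<le>?n. ?n < j + k \<longrightarrow> bary ((T_map ^^ j) x) k * 2 ^ m \<in> \<int>)" if "j \<le> ?n" for j
    using that
  proof (induction j)
    case 0
    then show ?case using Suc.prems by simp
  next
    case (Suc j)
    define y where "y = (T_map ^^ j) x"
    have yD: "y \<in> Delta" using \<open>x \<in> Delta\<close> T.funpow_Delta by (simp add: y_def)
    have y: "bary y k * 2 ^ Suc m \<in> \<int>" "?n < j + k \<Longrightarrow> bary y k * 2 ^ m \<in> \<int>" if "k \<le> ?n" for k
      using Suc that unfolding y_def by auto
    have b: "bary (T_map y) k = step_lin ?n 2 (digit y) (bary y) k" if "k \<le> ?n" for k
      using T.R_digit[OF yD that] by simp
    have n: "1 \<le> ?n" by (rule card_ge_1)
    have last: "bary (T_map y) ?n * 2 ^ m \<in> \<int>"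
    proof -
      have "bary (T_map y) ?n * 2 ^ m = (if digit y then bary y 0 * 2 ^ Suc m else bary y 1 * 2 ^ Suc m)"
        using n by (simp add: b step_lin_def)
      then show ?thesis using y(1)[of 0] y(1)[of 1] n by simp
    qed
    have "bary (T_map y) k * 2 ^ m \<in> \<int>" if "k \<le> ?n" "?n < Suc j + k" for k
    proof (cases "k = ?n")
      case False
      then have "bary (T_map y) k = bary y (Suc k)" using that Suc.prems n by (simp add: b step_lin_def)
      then show ?thesis using y(2)[of "Suc k"] that False by simp
    qed (simp add: last)
    moreover have "bary (T_map y) k * 2 ^ Suc m \<in> \<int>" if k: "k \<le> ?n" for k
    proof -
      consider "k = 0" | "0 < k" "k < ?n" | "k = ?n" using k n by linarith
      then show ?thesis
      proof cases
        case 1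
        have "bary (T_map y) k * 2 ^ Suc m =
            (if digit y then bary y 1 * 2 ^ Suc m - bary y 0 * 2 ^ Suc m else bary y 0 * 2 ^ Suc m - bary y 1 * 2 ^ Suc m)"
          using 1 by (simp add: b step_lin_def left_diff_distrib del: power_Suc)
        then show ?thesis using y(1)[of 0] y(1)[of 1] n by (simp del: power_Suc)
      next
        case 2
        then show ?thesis using y(1)[of "Suc k"] by (simp add: b step_lin_def del: power_Suc)
      next
        case 3
        have double: "z * p + z * p = z * (2 * p)" for z p :: real by simp
        show ?thesis using Ints_add[OF last last] unfolding 3 power_Suc double .
      qed
    qed
    ultimately show ?case by (simp add: y_def)
  qed
  define y where "y = (T_map ^^ ?n) x"
  have y1: "bary y k * 2 ^ m \<in> \<int>" if "k \<le> ?n" "1 \<le> k" for k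
    using *[of ?n] that by (simp add: y_def)
  have "bary y k * 2 ^ m \<in> \<int>" if k: "k \<le> ?n" for k
  proof (cases "1 \<le> k")
    case False
    have "1 = bary y 0 + (\<Sum>k = 1..?n. bary y k)"
      using sum_bary[of y] by (simp add: atMost_atLeast0 sum.atLeast_Suc_atMost del: sum_bary)
    then have "bary y 0 = 1 - (\<Sum>k = 1..?n. bary y k)" by simp
    then have "bary y 0 * 2 ^ m = 2 ^ m - (\<Sum>k = 1..?n. bary y k * 2 ^ m)"
      by (simp only: left_diff_distrib sum_distrib_right mult_1_left)
    moreover have "(\<Sum>k = 1..?n. bary y k * 2 ^ m) \<in> \<int>" using y1 by (intro sum_closed) auto
    moreover have "(2 ^ m :: real) \<in> \<int>" by simp
    moreover have "k = 0" using False by simp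
    ultimately show ?thesis using Ints_diff by simp
  qed (use y1 k in simp)
  then obtain t where "(T_map ^^ t) y = v1" using Suc.IH[of y] T.funpow_Delta[OF Suc.prems(1)] by (auto simp: y_def)
  then show ?case unfolding y_def by (metis comp_apply funpow_add)
qed

lemma T_dyadic_reaches:
  fixes x :: "'n::{finite,linorder} point"
  assumes "dyadic_point x" "x \<in> Delta"
  shows "\<exists>t. (T_map ^^ t) x = v1"
proof -
  obtain m :: nat where m: "\<forall>k\<le>CARD('n). bary x k * 2 ^ m \<in> \<int>"
    using assms(1) by (rule dyadic_common_denominator)
  show ?thesis using T_dyadic_reaches_aux[OF assms(2), of m] m by blast
qed

text \<open>With c = 2 there is no normalization and the step has integral coefficients, so a common
  denominator survives. A rational orbit thus stays in a finite set.\<close>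

lemma T_integral:
  fixes x :: "'n::{finite,linorder} point"
  assumes x: "x \<in> Delta" "\<And>k. k \<le> CARD('n) \<Longrightarrow> bary x k * N \<in> \<int>" and k: "k \<le> CARD('n)"
  shows "bary (T_map x) k * N \<in> \<int>"
proof -
  have "bary (T_map x) k * N = step_lin CARD('n) 2 (digit x) (\<lambda>k. bary x k * N) k"
    using T.R_digit[OF x(1) k] by (simp add: step_lin_scale)
  moreover have "\<dots> \<in> \<int>"
    using x(2) k by (auto simp: step_lin_def card_ge_1[where 'n='n, simplified] intro!: Ints_diff Ints_mult)
  ultimately show ?thesis by simp
qed

lemma finite_bounded_denominator:
  assumes N: "N > 0"
  shows "finite {x :: 'n::{finite,linorder} point. x \<in> Delta \<and> (\<forall>k\<le>CARD('n). bary x k * real N \<in> \<int>)}" (is "finite ?X")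
proof (rule finite_imageD)
  let ?f = "\<lambda>x :: 'n point. restrict (\<lambda>k. bary x k * real N) {..CARD('n)}"
  have "?f ` ?X \<subseteq> {..CARD('n)} \<rightarrow>\<^sub>E of_int ` {0..int N}"
  proof
    fix g assume "g \<in> ?f ` ?X"
    then obtain x where g: "g = ?f x" and x: "x \<in> Delta" "\<forall>k\<le>CARD('n). bary x k * real N \<in> \<int>" by auto
    show "g \<in> {..CARD('n)} \<rightarrow>\<^sub>E of_int ` {0..int N}"
      unfolding g
    proof (intro restrict_PiE_iff[THEN iffD2] ballI)
      fix k assume "k \<in> {..CARD('n)}"
      then have k: "k \<le> CARD('n)" by simp
      then obtain z :: int where z: "bary x k * real N = of_int z" using x by (auto elim: Ints_cases)
      moreover have "0 \<le> bary x k * real N" using bary_ge_0[OF x(1) k] by simp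
      moreover have "bary x k * real N \<le> 1 * real N" using bary_le_1[OF x(1) k] by (intro mult_right_mono) auto
      ultimately have "0 \<le> z" "z \<le> int N" by linarith+
      then show "bary x k * real N \<in> of_int ` {0..int N}" by (simp add: z)
    qed
  qed
  then show "finite (?f ` ?X)" by (rule finite_subset) (simp add: finite_PiE)
  show "inj_on ?f ?X"
  proof (rule inj_onI)
    fix x y assume "?f x = ?f y"
    then have "bary x k * real N = bary y k * real N" if "k \<le> CARD('n)" for k
      using that by (metis (mono_tags) atMost_iff restrict_apply')
    then show "x = y" using N by (intro bary_eqI) simp
  qed
qed

lemma T_rational_preperiodic:
  fixes x :: "'n::{finite,linorder} point"
  assumes "rational_point x" "x \<in> Delta"
  shows "preperiodic T_map x"
proof -
  obtain N :: nat where N: "N > 0" "\<forall>k\<le>CARD('n). bary x k * real N \<in> \<int>"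
    using assms(1) by (rule rational_common_denominator)
  let ?X = "{x :: 'n point. x \<in> Delta \<and> (\<forall>k\<le>CARD('n). bary x k * real N \<in> \<int>)}"
  have "(T_map ^^ t) x \<in> ?X" for t
  proof (induction t)
    case (Suc t)
    then have y: "(T_map ^^ t) x \<in> Delta" "\<forall>k\<le>CARD('n). bary ((T_map ^^ t) x) k * real N \<in> \<int>" by auto
    have "T_map ((T_map ^^ t) x) \<in> Delta" using y(1) by (rule T.R_Delta)
    moreover have "\<forall>k\<le>CARD('n). bary (T_map ((T_map ^^ t) x)) k * real N \<in> \<int>"
      using T_integral[OF y(1)] y(2) by blast
    ultimately show ?case by simp
  qed (use N assms in simp)
  then have "finite (range (\<lambda>t. (T_map ^^ t) x))"
    using finite_bounded_denominator[OF N(1), where 'n='n] by (meson finite_subset image_subsetI)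
  then have "\<not> inj (\<lambda>t. (T_map ^^ t) x)" using finite_imageD by blast
  then obtain s t where "s \<noteq> t" "(T_map ^^ s) x = (T_map ^^ t) x" by (auto simp: inj_def)
  then obtain s t where "s < t" "(T_map ^^ s) x = (T_map ^^ t) x" by (metis linorder_neqE_nat)
  then have "(T_map ^^ s) x \<in> EPO T_map x"
    using T.funpow_Delta[OF assms(2)] unfolding EPO_def by blast
  then show ?thesis by (auto simp: preperiodic_def)
qed

text \<open>The convention \<open>inverse 0 = 0\<close> lets closure under inverses range over all
  of K.\<close>

definition subfield_of_reals :: "real set \<Rightarrow> bool" where
  "subfield_of_reals K \<longleftrightarrow> 1 \<in> K \<and> (\<forall>x\<in>K. \<forall>y\<in>K. x - y \<in> K \<and> x * y \<in> K) \<and> (\<forall>x\<in>K. inverse x \<in> K)"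

lemma subfield_of_reals_simps:
  assumes "subfield_of_reals K"
  shows "0 \<in> K" "1 \<in> K" "x \<in> K \<Longrightarrow> y \<in> K \<Longrightarrow> x - y \<in> K" "x \<in> K \<Longrightarrow> y \<in> K \<Longrightarrow> x + y \<in> K"
    "x \<in> K \<Longrightarrow> y \<in> K \<Longrightarrow> x * y \<in> K" "x \<in> K \<Longrightarrow> y \<in> K \<Longrightarrow> x / y \<in> K" "x \<in> K \<Longrightarrow> - x \<in> K" "2 \<in> K"
proof -
  note K = assms[unfolded subfield_of_reals_def]
  show 1: "1 \<in> K" using K by blast
  show d: "x \<in> K \<Longrightarrow> y \<in> K \<Longrightarrow> x - y \<in> K" for x y using K by blast
  show 0: "0 \<in> K" using d[OF 1 1] by simp
  show m: "x \<in> K \<Longrightarrow> - x \<in> K" for x using d[OF 0, of x] by simp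
  show a: "x \<in> K \<Longrightarrow> y \<in> K \<Longrightarrow> x + y \<in> K" for x y using d[of x "- y"] m by simp
  show "x \<in> K \<Longrightarrow> y \<in> K \<Longrightarrow> x * y \<in> K" using K by blast
  show "x \<in> K \<Longrightarrow> y \<in> K \<Longrightarrow> x / y \<in> K" using K unfolding divide_inverse by blast
  show "2 \<in> K" using a[OF 1 1] by simp
qed

lemma subfield_Rats: "subfield_of_reals \<rat>"
  by (auto simp: subfield_of_reals_def)

section \<open>Fields of definition along orbits\<close>

context bary_map
begin

lemma c_in_subfield: "subfield_of_reals K \<Longrightarrow> c \<in> K"
  using c subfield_of_reals_simps[of K] by auto

lemma subfield_backward:
  assumes K: "subfield_of_reals K" and x: "x \<in> Delta_half a"
    and R: "\<And>k. k \<le> CARD('n) \<Longrightarrow> bary (R x) k \<in> K" and k: "k \<le> CARD('n)"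
  shows "bary x k \<in> K"
proof -
  note [simp, intro] = subfield_of_reals_simps[OF K] c_in_subfield[OF K]
  have "inv_lin CARD('n) c a (bary (R x)) k \<in> K" using R k by (auto simp: inv_lin_def)
  moreover have "1 + (2 / c - 1) * bary (R x) CARD('n) \<in> K" using R by auto
  ultimately show ?thesis using bary_inv[OF x k] by auto
qed

lemma subfield_forward:
  assumes K: "subfield_of_reals K" and x: "x \<in> Delta_half a"
    and b: "\<And>k. k \<le> CARD('n) \<Longrightarrow> bary x k \<in> K" and k: "k \<le> CARD('n)"
  shows "bary (R x) k \<in> K"
proof -
  note [simp, intro] = subfield_of_reals_simps[OF K] c_in_subfield[OF K]
  have b01: "bary x 0 \<in> K" "bary x 1 \<in> K" using b card_ge_1[where 'n='n] by auto
  have "step_lin CARD('n) c a (bary x) k \<in> K" using b k b01 by (auto simp: step_lin_def)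
  moreover have "den a x \<in> K" using b01 by (auto simp: den_def)
  ultimately show ?thesis using R_half[OF x k] by auto
qed

text \<open>\<open>R\<close> and its inverse branches are rational functions with rational
  coefficients, so membership in K passes along the orbit in both directions.\<close>

lemma subfield_funpow:
  assumes K: "subfield_of_reals K" and x: "x \<in> Delta"
  shows "(\<forall>k\<le>CARD('n). bary ((R ^^ t) x) k \<in> K) \<longleftrightarrow> (\<forall>k\<le>CARD('n). bary x k \<in> K)"
proof (induction t)
  case (Suc t)
  have h: "(R ^^ t) x \<in> Delta_half (digit ((R ^^ t) x))" using x by (intro Delta_half_digit funpow_Delta)
  show ?case
    unfolding Suc[symmetric] using subfield_backward[OF K h] subfield_forward[OF K h] by auto
qed simp

lemma reaches_rational:
  assumes "x \<in> Delta" "(R ^^ t) x = v1"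
  shows "rational_point x"
proof -
  have "\<forall>k\<le>CARD('n). bary (v1 :: 'n point) k \<in> \<rat>" by (simp add: bary_v1)
  then show ?thesis
    using subfield_funpow[OF subfield_Rats assms(1), of t] assms(2) by (simp add: rational_point_iff)
qed

end

lemma T_reaches_dyadic:
  fixes x :: "'n::{finite,linorder} point"
  shows "x \<in> Delta \<Longrightarrow> (T_map ^^ t) x = v1 \<Longrightarrow> dyadic_point x"
proof (induction t arbitrary: x)
  case 0
  then show ?case by (auto simp: dyadic_point_iff bary_v1 dyadic_0_1)
next
  case (Suc t)
  then have "(T_map ^^ t) (T_map x) = v1" by (simp add: funpow_swap1)
  then have d: "bary (T_map x) k \<in> dyadic_rationals" if "k \<le> CARD('n)" for k
    using Suc.IH[OF T.R_Delta[OF Suc.prems(1)]] that by (simp add: dyadic_point_iff)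
  have add: "p + q \<in> dyadic_rationals" if "p \<in> dyadic_rationals" "q \<in> dyadic_rationals" for p q
    using dyadic_diff[OF that(1) dyadic_diff[OF dyadic_0_1(1) that(2)]] by simp
  have "bary x k \<in> dyadic_rationals" if "k \<le> CARD('n)" for k
    using T.bary_inv[OF Delta_half_digit[OF Suc.prems(1)] that] d that
    by (auto simp: inv_lin_def intro!: add dyadic_half)
  then show ?case by (simp add: dyadic_point_iff)
qed

section \<open>Preperiodic points\<close>

text \<open>
  \<open>linear_graph K G\<close> says that \<open>G\<close> is the graph of a \<open>K\<close>-linear map on a \<open>K\<close>-subspace of \<open>\<real>\<close>.
\<close>

definition linear_graph :: "real set \<Rightarrow> (real \<times> real) set \<Rightarrow> bool" where
  "linear_graph K G \<longleftrightarrow> (0, 0) \<in> G \<and> (\<forall>x y x' y'. (x, y) \<in> G \<longrightarrow> (x', y') \<in> G \<longrightarrow> (x - x', y - y') \<in> G) \<and>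
     (\<forall>k\<in>K. \<forall>x y. (x, y) \<in> G \<longrightarrow> (k * x, k * y) \<in> G) \<and> (\<forall>y. (0, y) \<in> G \<longrightarrow> y = 0)"

lemma linear_graphD:
  assumes "linear_graph K G"
  shows "(0, 0) \<in> G" "(x, y) \<in> G \<Longrightarrow> (x', y') \<in> G \<Longrightarrow> (x - x', y - y') \<in> G"
    "(x, y) \<in> G \<Longrightarrow> (x', y') \<in> G \<Longrightarrow> (x + x', y + y') \<in> G"
    "k \<in> K \<Longrightarrow> (x, y) \<in> G \<Longrightarrow> (k * x, k * y) \<in> G" "(x, y) \<in> G \<Longrightarrow> (x, y') \<in> G \<Longrightarrow> y = y'"
proof -
  note G = assms[unfolded linear_graph_def]
  show z: "(0, 0) \<in> G" using G by blast
  show d: "(x, y) \<in> G \<Longrightarrow> (x', y') \<in> G \<Longrightarrow> (x - x', y - y') \<in> G" for x y x' y' using G by blast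
  show "(x, y) \<in> G \<Longrightarrow> (x', y') \<in> G \<Longrightarrow> (x + x', y + y') \<in> G"
    using d[of x y "0 - x'" "0 - y'"] d[OF z] by simp
  show "k \<in> K \<Longrightarrow> (x, y) \<in> G \<Longrightarrow> (k * x, k * y) \<in> G" using G by blast
  show "(x, y) \<in> G \<Longrightarrow> (x, y') \<in> G \<Longrightarrow> y = y'" using d[of x y x y'] G by force
qed

lemma linear_graph_sum:
  assumes "linear_graph K G" "\<And>k. k \<in> A \<Longrightarrow> (f k, g k) \<in> G"
  shows "(sum f A, sum g A) \<in> G"
proof (cases "finite A")
  case True
  then show ?thesis using assms(2)
    by (induction A) (auto intro: linear_graphD(1,3)[OF assms(1)])
qed (simp add: linear_graphD(1)[OF assms(1)])

text \<open>A number outside the domain of the map is linearly independent of it over K, so its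
  value can be chosen freely.\<close>

lemma linear_graph_extend:
  assumes K: "subfield_of_reals K" and G: "linear_graph K G" and z: "\<And>v. (z, v) \<notin> G"
  shows "\<exists>G'. linear_graph K G' \<and> G \<subseteq> G' \<and> (z, w) \<in> G'"
proof -
  note [simp, intro] = subfield_of_reals_simps[OF K]
  note GD = linear_graphD[OF G]
  define G' where "G' = {(x + k * z, y + k * w) | x y k. (x, y) \<in> G \<and> k \<in> K}"
  have "linear_graph K G'"
    unfolding linear_graph_def
  proof (intro conjI allI impI ballI)
    show "(0, 0) \<in> G'" unfolding G'_def using GD(1) by (intro CollectI exI[of _ 0]) auto
  next
    fix x y x' y' assume "(x, y) \<in> G'" "(x', y') \<in> G'"
    then obtain p q k p' q' k' where "x = p + k * z" "y = q + k * w" "(p, q) \<in> G" "k \<in> K"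
      "x' = p' + k' * z" "y' = q' + k' * w" "(p', q') \<in> G" "k' \<in> K" unfolding G'_def by blast
    then show "(x - x', y - y') \<in> G'"
      unfolding G'_def using GD(2)[of p q p' q']
      by (intro CollectI exI[of _ "p - p'"] exI[of _ "q - q'"] exI[of _ "k - k'"]) (auto simp: algebra_simps)
  next
    fix l x y assume l: "l \<in> K" "(x, y) \<in> G'"
    then obtain p q k where "x = p + k * z" "y = q + k * w" "(p, q) \<in> G" "k \<in> K" unfolding G'_def by blast
    then show "(l * x, l * y) \<in> G'"
      unfolding G'_def using GD(4)[of l p q] l
      by (intro CollectI exI[of _ "l * p"] exI[of _ "l * q"] exI[of _ "l * k"]) (auto simp: algebra_simps)
  next
    fix y assume "(0, y) \<in> G'"
    then obtain p q k where *: "0 = p + k * z" "y = q + k * w" "(p, q) \<in> G" "k \<in> K" unfolding G'_def by blast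
    have "k = 0"
    proof (rule ccontr)
      assume "k \<noteq> 0"
      then have "z = (- 1 / k) * p" using *(1) by (simp add: field_simps)
      moreover have "- 1 / k \<in> K" using *(4) by blast
      ultimately show False using GD(4)[of "- 1 / k" p q] * z by metis
    qed
    then show "y = 0" using * GD(5)[OF _ GD(1)] by simp
  qed
  moreover have "G \<subseteq> G'"
  proof
    fix s assume s: "s \<in> G"
    obtain x y where "s = (x, y)" by (cases s)
    then show "s \<in> G'" using s unfolding G'_def
      by (intro CollectI exI[of _ x] exI[of _ y] exI[of _ 0]) auto
  qed
  moreover have "(z, w) \<in> G'"
    unfolding G'_def using GD(1) by (intro CollectI exI[of _ 0] exI[of _ 1]) auto
  ultimately show ?thesis by blast
qed

text \<open>G acts as a K-linear functional that kills 1 but not \<open>x0\<close>. Defining it on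
  the given numbers one at a time avoids choosing a basis of the reals over K.\<close>

lemma linear_graph_separating:
  fixes m :: nat
  assumes K: "subfield_of_reals K" and x0: "x0 \<notin> K"
  shows "\<exists>G. linear_graph K G \<and> (1, 0) \<in> G \<and> (x0, 1) \<in> G \<and> (\<forall>k<m. \<exists>y. (f k, y) \<in> G)"
proof (induction m)
  case 0
  note [simp, intro] = subfield_of_reals_simps[OF K]
  have "linear_graph K {(k, 0) | k. k \<in> K}"
    by (auto simp: linear_graph_def)
  then obtain G where G: "linear_graph K G" "{(k, 0) | k. k \<in> K} \<subseteq> G" "(x0, 1) \<in> G"
    using linear_graph_extend[OF K, of "{(k, 0) | k. k \<in> K}" x0 1] x0 by blast
  then have "(1, 0) \<in> G" by blast
  then show ?case using G by (intro exI[of _ G]) simp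
next
  case (Suc m)
  then obtain G where G: "linear_graph K G" "(1, 0) \<in> G" "(x0, 1) \<in> G" "\<forall>k<m. \<exists>y. (f k, y) \<in> G" by blast
  show ?case
  proof (cases "\<exists>y. (f m, y) \<in> G")
    case True
    then show ?thesis using G by (intro exI[of _ G]) (auto simp: less_Suc_eq)
  next
    case False
    then obtain G' where "linear_graph K G'" "G \<subseteq> G'" "(f m, 0) \<in> G'"
      using linear_graph_extend[OF K G(1), of "f m" 0] by blast
    then show ?thesis using G by (intro exI[of _ G']) (auto simp: less_Suc_eq, blast+)
  qed
qed

text \<open>Tight constraints are not moved, and each of the finitely many strict ones leaves room
  up to \<open>f i / (\<bar>g i\<bar> + 1)\<close>, where the 1 covers
  \<open>g i = 0\<close>.\<close>

lemma small_perturbation: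
  fixes f g :: "'i \<Rightarrow> real"
  assumes "finite I" "\<And>i. i \<in> I \<Longrightarrow> f i \<ge> 0" "\<And>i. i \<in> I \<Longrightarrow> f i = 0 \<Longrightarrow> g i = 0"
  shows "\<exists>e>0. \<forall>d. 0 < d \<longrightarrow> d \<le> e \<longrightarrow> (\<forall>i\<in>I. f i + d * g i \<ge> 0)"
  using assms
proof (induction I)
  case empty
  then show ?case by (auto intro: exI[of _ 1])
next
  case (insert i I)
  then obtain e where e: "e > 0" "\<And>d j. 0 < d \<Longrightarrow> d \<le> e \<Longrightarrow> j \<in> I \<Longrightarrow> f j + d * g j \<ge> 0" by force
  show ?case
  proof (cases "f i = 0")
    case True
    then have "g i = 0" using insert by auto
    then show ?thesis using e True by (intro exI[of _ e]) auto
  next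
    case False
    then have fi: "f i > 0" using insert.prems(1)[of i] by auto
    define e' where "e' = min e (f i / (\<bar>g i\<bar> + 1))"
    have "f i + d * g i \<ge> 0" if d: "0 < d" "d \<le> e'" for d
    proof -
      have "d * (\<bar>g i\<bar> + 1) \<le> f i" using d by (simp add: e'_def pos_le_divide_eq)
      moreover have "d * \<bar>g i\<bar> \<le> d * (\<bar>g i\<bar> + 1)" "- (d * g i) \<le> d * \<bar>g i\<bar>"
        using d by (auto intro!: mult_left_mono simp: abs_if)
      ultimately show ?thesis by linarith
    qed
    moreover have "e' > 0" using e fi by (simp add: e'_def add_nonneg_pos)
    moreover have "f j + d * g j \<ge> 0" if "0 < d" "d \<le> e'" "j \<in> I" for d j
      using e(2)[of d j] that by (simp add: e'_def)
    ultimately show ?thesis by (intro exI[of _ e']) auto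
  qed
qed

text \<open>The orbit without normalization and with prescribed digits, which makes it linear in
  v.\<close>

primrec step_run :: "nat \<Rightarrow> real \<Rightarrow> (nat \<Rightarrow> bool) \<Rightarrow> nat \<Rightarrow> (nat \<Rightarrow> real) \<Rightarrow> nat \<Rightarrow> real" where
  "step_run n c a 0 v = v"
| "step_run n c a (Suc t) v = step_lin n c (a t) (step_run n c a t v)"

lemma step_run_cong:
  "1 \<le> n \<Longrightarrow> (\<And>k. k \<le> n \<Longrightarrow> v k = w k) \<Longrightarrow> k \<le> n \<Longrightarrow> step_run n c a t v k = step_run n c a t w k"
  by (induction t arbitrary: k) (auto intro!: step_lin_cong)

lemma step_run_comb: "step_run n c a t (\<lambda>k. u * v k + u' * w k) k = u * step_run n c a t v k + u' * step_run n c a t w k"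
proof (induction t arbitrary: k)
  case (Suc t)
  have "step_run n c a t (\<lambda>k. u * v k + u' * w k) = (\<lambda>k. u * step_run n c a t v k + u' * step_run n c a t w k)" using Suc by blast
  then show ?case by (simp add: step_lin_comb)
qed simp

lemma step_run_add: "step_run n c a (s + t) v = step_run n c (\<lambda>i. a (s + i)) t (step_run n c a s v)"
  by (induction t) auto

section \<open>Unnormalized orbits and eigenvectors\<close>

context bary_map
begin

lemma step_run_graph:
  assumes K: "subfield_of_reals K" and G: "linear_graph K G"
    and vu: "\<And>k. k \<le> CARD('n) \<Longrightarrow> (v k, u k) \<in> G"
  shows "k \<le> CARD('n) \<Longrightarrow> (step_run CARD('n) c a t v k, step_run CARD('n) c a t u k) \<in> G"
proof (induction t arbitrary: k)
  case (Suc t)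
  note GD = linear_graphD[OF G]
  have *: "(step_run CARD('n) c a t v j, step_run CARD('n) c a t u j) \<in> G" if "j \<le> CARD('n)" for j
    using that by (rule Suc.IH)
  have 1: "1 \<le> CARD('n)" by (rule card_ge_1)
  consider "k = 0" | "0 < k" "k < CARD('n)" | "0 < k" "k = CARD('n)" using Suc.prems by linarith
  then show ?case
  proof cases
    case 1
    then show ?thesis
      using GD(2)[OF *[of 0] *[OF \<open>1 \<le> CARD('n)\<close>]] GD(2)[OF *[OF \<open>1 \<le> CARD('n)\<close>] *[of 0]]
      by (simp add: step_lin_def)
  next
    case 2
    then show ?thesis using *[of "Suc k"] by (simp add: step_lin_def)
  next
    case 3
    then show ?thesis
      using GD(4)[OF c_in_subfield[OF K] *[of 0]] GD(4)[OF c_in_subfield[OF K] *[OF \<open>1 \<le> CARD('n)\<close>]]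
      by (simp add: step_lin_def)
  qed
qed (use vu in simp)

text \<open>D is the product of the normalizing denominators \<open>den\<close>. For c = 2 they are
  all 1, so the eigenvalue of a periodic point of \<open>T\<close> will be 1, which is
  rational.\<close>

lemma step_run_follows:
  assumes "follows a t x"
  shows "\<exists>D>0. (c = 2 \<longrightarrow> D = 1) \<and> (\<forall>k\<le>CARD('n). step_run CARD('n) c a t (bary x) k = D * bary ((R ^^ t) x) k)"
  using assms
proof (induction t)
  case 0
  then show ?case by (intro exI[of _ 1]) simp
next
  case (Suc t)
  then obtain D where D: "D > 0" "c = 2 \<longrightarrow> D = 1" "\<And>k. k \<le> CARD('n) \<Longrightarrow> step_run CARD('n) c a t (bary x) k = bary ((R ^^ t) x) k * D"
    by (auto simp: follows_def mult.commute)
  have h: "(R ^^ t) x \<in> Delta_half (a t)" using Suc by (simp add: follows_def)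
  have "step_run CARD('n) c a (Suc t) (bary x) k = (D * den (a t) ((R ^^ t) x)) * bary ((R ^^ Suc t) x) k" if "k \<le> CARD('n)" for k
  proof -
    have "step_run CARD('n) c a (Suc t) (bary x) k = step_lin CARD('n) c (a t) (\<lambda>k. bary ((R ^^ t) x) k * D) k"
      using D(3) that by (auto intro: step_lin_cong simp: card_ge_1)
    then show ?thesis using R_half[OF h that] den_pos[OF h] by (simp add: step_lin_scale)
  qed
  moreover have "c = 2 \<longrightarrow> den (a t) ((R ^^ t) x) = 1" unfolding den_def by simp
  ultimately show ?case using D(1,2) den_pos[OF h]
    by (intro exI[of _ "D * den (a t) ((R ^^ t) x)"]) auto
qed

text \<open>Position 0 of the next unnormalized step is, up to a positive factor, the difference of
  b_0 and b_1 whose sign decides on the half.\<close>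

lemma follows_of_step_run:
  assumes x: "x \<in> Delta" and step_run: "\<And>i k. k \<le> CARD('n) \<Longrightarrow> step_run CARD('n) c a i (bary x) k \<ge> 0"
  shows "follows a t x"
proof (induction t)
  case (Suc t)
  then obtain D where D: "D > 0" "\<And>k. k \<le> CARD('n) \<Longrightarrow> step_run CARD('n) c a t (bary x) k = D * bary ((R ^^ t) x) k"
    using step_run_follows by blast
  have "0 \<le> D * (if a t then bary ((R ^^ t) x) 1 - bary ((R ^^ t) x) 0 else bary ((R ^^ t) x) 0 - bary ((R ^^ t) x) 1)"
    using step_run[of 0 "Suc t"] D(2)[of 0] D(2)[of 1] card_ge_1[where 'n='n]
    by (simp add: step_lin_def right_diff_distrib split: if_splits)
  then have "(R ^^ t) x \<in> Delta_half (a t)"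
    using D(1) funpow_Delta[OF x] by (auto simp: Delta_half_iff zero_le_mult_iff split: if_splits)
  then show ?case using Suc by (auto simp: follows_def less_Suc_eq)
qed (simp add: follows_def x)

text \<open>
  A \<open>K\<close>-linear map annihilating \<open>1\<close> turns the eigenvector \<open>bary q\<close> into an eigenvector \<open>u\<close> with
  coordinate sum \<open>0\<close> that satisfies all relations over \<open>K\<close> satisfied by \<open>bary q\<close>. Moving \<open>q\<close> slightly
  in the direction \<open>u\<close> therefore does not change its code, so \<open>u = 0\<close>.
\<close>

lemma periodic_in_subfield:
  assumes q: "codes a q" and m: "m > 0" and a: "\<And>i. a (m + i) = a i"
    and eig: "\<And>k. k \<le> CARD('n) \<Longrightarrow> step_run CARD('n) c a m (bary q) k = l * bary q k" and l: "l > 0"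
    and K: "subfield_of_reals K" "l \<in> K" and j: "j \<le> CARD('n)"
  shows "bary q j \<in> K"
proof (rule ccontr)
  let ?n = "CARD('n)"
  assume "bary q j \<notin> K"
  then obtain G where G: "linear_graph K G" "(1, 0) \<in> G" "(bary q j, 1) \<in> G"
    "\<forall>k<Suc ?n. \<exists>y. (bary q k, y) \<in> G"
    using linear_graph_separating[OF K(1), of "bary q j" "Suc ?n" "bary q"] by blast
  note GD = linear_graphD[OF G(1)]
  obtain u where u: "\<And>k. k \<le> ?n \<Longrightarrow> (bary q k, u k) \<in> G" using G(4) by (metis less_Suc_eq_le)
  have uj: "u j = 1" using GD(5)[OF u[OF j] G(3)] .
  have "((\<Sum>k\<le>?n. bary q k), (\<Sum>k\<le>?n. u k)) \<in> G" using u by (intro linear_graph_sum[OF G(1)]) auto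
  then have u0: "(\<Sum>k\<le>?n. u k) = 0" using GD(5)[OF _ G(2)] by simp
  have lin_u: "(step_run CARD('n) c a i (bary q) k, step_run CARD('n) c a i u k) \<in> G" if "k \<le> ?n" for i k
    using step_run_graph[OF K(1) G(1) u that] .
  have eig_u: "step_run CARD('n) c a m u k = l * u k" if k: "k \<le> ?n" for k
  proof -
    have "(l * bary q k, step_run CARD('n) c a m u k) \<in> G" using lin_u[OF k, of m] eig[OF k] by simp
    then show ?thesis using GD(4)[OF K(2) u[OF k]] by (rule GD(5))
  qed
  have q_nonneg: "step_run CARD('n) c a i (bary q) k \<ge> 0" if "k \<le> ?n" for i k
  proof -
    have "follows a i q" using q by (simp add: codes_def)
    then obtain D where "D > 0" "\<forall>k\<le>?n. step_run ?n c a i (bary q) k = D * bary ((R ^^ i) q) k"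
      using step_run_follows by blast
    moreover have "(R ^^ i) q \<in> Delta" using q by (auto simp: codes_iff intro: funpow_Delta)
    ultimately show ?thesis using bary_ge_0[OF _ that, of "(R ^^ i) q"] that by simp
  qed
  \<comment> \<open>One period of times suffices: the perturbed vector is again an eigenvector, so
    later values are earlier ones times powers of \<open>l > 0\<close>.\<close>
  have "\<exists>e>0. \<forall>d. 0 < d \<longrightarrow> d \<le> e \<longrightarrow>
      (\<forall>p\<in>{..<m} \<times> {..?n}. step_run CARD('n) c a (fst p) (bary q) (snd p) + d * step_run CARD('n) c a (fst p) u (snd p) \<ge> 0)"
  proof (rule small_perturbation)
    fix p assume p: "p \<in> {..<m} \<times> {..?n}"
    then show "step_run CARD('n) c a (fst p) (bary q) (snd p) \<ge> 0" using q_nonneg by auto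
    assume "step_run CARD('n) c a (fst p) (bary q) (snd p) = 0"
    then have "(0, step_run CARD('n) c a (fst p) u (snd p)) \<in> G" using lin_u[of "snd p" "fst p"] p by auto
    then show "step_run CARD('n) c a (fst p) u (snd p) = 0" using GD(5)[OF _ GD(1)] by blast
  qed simp
  then obtain e where e: "e > 0" "\<forall>p\<in>{..<m} \<times> {..?n}.
      step_run ?n c a (fst p) (bary q) (snd p) + e * step_run ?n c a (fst p) u (snd p) \<ge> 0" by blast
  have e2: "step_run ?n c a i (bary q) k + e * step_run ?n c a i u k \<ge> 0" if "i < m" "k \<le> ?n" for i k
    using e(2)[rule_format, of "(i, k)"] that by simp
  define v where "v k = 1 * bary q k + e * u k" for k
  define x :: "'n point" where "x = point_of v"
  have "(\<Sum>k\<le>?n. v k) = 1" by (simp add: v_def sum.distrib sum_distrib_left[symmetric] u0)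
  then have bx: "bary x k = v k" if "k \<le> ?n" for k unfolding x_def using that by (rule bary_point_of)
  have lin_v: "step_run CARD('n) c a i v k = step_run CARD('n) c a i (bary q) k + e * step_run CARD('n) c a i u k" for i k
  proof -
    have "v = (\<lambda>k. 1 * bary q k + e * u k)" by (rule ext) (simp add: v_def)
    then show ?thesis using step_run_comb[of ?n c a i 1 "bary q" e u k] by simp
  qed
  have eig_v: "step_run CARD('n) c a m v k = l * v k" if "k \<le> ?n" for k
    using eig[OF that] eig_u[OF that] unfolding lin_v by (simp add: v_def algebra_simps)
  have v_nonneg: "step_run CARD('n) c a i v k \<ge> 0" if k: "k \<le> ?n" for i k
  proof (induction i rule: less_induct)
    case (less i)
    show ?case
    proof (cases "i < m")
      case True
      then show ?thesis unfolding lin_v using e2 k by simp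
    next
      case False
      then obtain r where r: "i = m + r" by (metis le_add_diff_inverse not_less)
      have "step_run CARD('n) c a i v k = step_run CARD('n) c a r (step_run CARD('n) c a m v) k" unfolding r step_run_add by (simp add: a)
      also have "\<dots> = step_run CARD('n) c a r (\<lambda>k. l * v k + 0 * v k) k" using eig_v k by (intro step_run_cong) (auto simp: card_ge_1)
      also have "\<dots> = l * step_run CARD('n) c a r v k" using step_run_comb[of ?n c a r l v 0 v k] by simp
      finally show ?thesis using less[of r] r m l by simp
    qed
  qed
  have "x \<in> Delta" using v_nonneg[of _ 0] by (simp add: Delta_iff bx)
  moreover have "step_run CARD('n) c a i (bary x) k \<ge> 0" if "k \<le> ?n" for i k
    using v_nonneg[OF that, of i] step_run_cong[OF card_ge_1[where 'n='n] bx that] by simp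
  ultimately have "codes a x" unfolding codes_def using follows_of_step_run by blast
  then have "x = q" using q by (rule codes_unique)
  then show False using bx[OF j] e(1) uj by (simp add: v_def)
qed

text \<open>The canonical digits depend on the orbit alone, so a periodic point has a periodic code,
  and one period of linear steps scales its coordinate vector.\<close>

lemma preperiodic_obtain:
  assumes p: "p \<in> Delta" "preperiodic R p"
  obtains t q a m l where "q = (R ^^ t) p" "codes a q" "m > 0" "\<And>i. a (m + i) = a i"
    "\<And>k. k \<le> CARD('n) \<Longrightarrow> step_run CARD('n) c a m (bary q) k = l * bary q k" "l > 0" "c = 2 \<longrightarrow> l = 1"
proof -
  obtain t s where ts: "t < s" "(R ^^ t) p = (R ^^ s) p"
    using p(2) unfolding preperiodic_def EPO_def by blast
  define q m a where "q = (R ^^ t) p" and "m = s - t" and "a i = digit ((R ^^ i) q)" for i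
  have m: "m > 0" using ts by (simp add: m_def)
  have "(R ^^ m) q = (R ^^ (m + t)) p" by (simp add: q_def funpow_add)
  then have per: "(R ^^ m) q = q" using ts by (simp add: m_def q_def)
  have q: "q \<in> Delta" using p funpow_Delta by (simp add: q_def)
  have codes: "codes a q" using codes_digits[OF q] by (simp add: a_def[abs_def])
  have "a (m + i) = a i" for i
    using funpow_add[of i m R] per by (simp add: a_def add.commute)
  moreover have "follows a m q" using codes by (simp add: codes_def)
  then obtain l where "l > 0" "c = 2 \<longrightarrow> l = 1" "\<And>k. k \<le> CARD('n) \<Longrightarrow> step_run CARD('n) c a m (bary q) k = l * bary q k"
    using step_run_follows[of a m q] unfolding per by blast
  ultimately show ?thesis using that[OF q_def codes m] by blast
qed

end

lemma T_preperiodic_rational: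
  fixes p :: "'n::{finite,linorder} point"
  assumes "p \<in> Delta" "preperiodic T_map p"
  shows "rational_point p"
proof -
  obtain t q a m l where *: "q = (T_map ^^ t) p" "T.codes a q" "m > 0" "\<And>i. a (m + i) = a i"
    "\<And>k. k \<le> CARD('n) \<Longrightarrow> step_run CARD('n) 2 a m (bary q) k = l * bary q k" "l > 0" "(2::real) = 2 \<longrightarrow> l = 1"
    using T.preperiodic_obtain[OF assms] by metis
  have "\<forall>k\<le>CARD('n). bary q k \<in> \<rat>"
    using T.periodic_in_subfield[OF *(2-6) subfield_Rats] *(7) by simp
  then show ?thesis
    unfolding *(1) T.subfield_funpow[OF subfield_Rats assms(1)] by (simp add: rational_point_iff)
qed

section \<open>The degree bound\<close>

lemma field_real_ring: "field real_ring"
  by (rule field_from_type_algebra)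

interpretation real: domain real_ring
  using field_real_ring by (rule field.axioms)

lemma real_ring_simps [simp]:
  "carrier real_ring = UNIV" "x \<oplus>\<^bsub>real_ring\<^esub> y = x + y" "x \<otimes>\<^bsub>real_ring\<^esub> y = x * y"
  "\<zero>\<^bsub>real_ring\<^esub> = 0" "\<one>\<^bsub>real_ring\<^esub> = 1"
  by (simp_all add: ring_of_type_algebra_def)

lemma real_ring_minus [simp]: "\<ominus>\<^bsub>real_ring\<^esub> x = - x"
  by (rule real.minus_equality) auto

lemma real_ring_inv: "x \<noteq> 0 \<Longrightarrow> m_inv real_ring x = inverse x"
  by (rule real.comm_inv_char) auto

lemma subfield_real_ring:
  assumes "subfield_of_reals K"
  shows "subfield K real_ring"
proof (rule field.subfieldI'[OF field_real_ring])
  show "subring K real_ring"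
    by (rule real.subringI) (auto intro: subfield_of_reals_simps[OF assms])
  show "m_inv real_ring k \<in> K" if "k \<in> K - {\<zero>\<^bsub>real_ring\<^esub>}" for k
    using that assms by (auto simp: real_ring_inv subfield_of_reals_def)
qed

lemma subfield_of_reals_real_ring:
  assumes "subfield K real_ring"
  shows "subfield_of_reals K"
proof -
  note S = subringE[OF subfieldE(1)[OF assms]]
  have "x - y \<in> K" if "x \<in> K" "y \<in> K" for x y
    using S(7)[OF that(1) S(5)[OF that(2)]] by simp
  moreover have "inverse x \<in> K" if "x \<in> K" for x
    using real.subfield_m_inv(1)[OF assms, of x] that S(2) by (cases "x = 0") (auto simp: real_ring_inv)
  ultimately show ?thesis using S(3,6) by (auto simp: subfield_of_reals_def)
qed

lemmas subfield_Rats' = subfield_real_ring[OF subfield_Rats]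

lemma rational_subspace:
  assumes "subalgebra \<rat> E real_ring"
  shows "0 \<in> E" "x \<in> E \<Longrightarrow> y \<in> E \<Longrightarrow> x - y \<in> E" "r \<in> \<rat> \<Longrightarrow> x \<in> E \<Longrightarrow> r * x \<in> E"
proof -
  interpret subgroup E "add_monoid real_ring" using assms by (rule subalgebra.axioms)
  show "0 \<in> E" using one_closed by simp
  show r: "r \<in> \<rat> \<Longrightarrow> x \<in> E \<Longrightarrow> r * x \<in> E" for r x
    using subalgebra.smult_closed[OF assms, of r x] by simp
  show "x \<in> E \<Longrightarrow> y \<in> E \<Longrightarrow> x - y \<in> E"
    using m_closed[of x "- y"] r[of "- 1" y] by simp
qed

lemma subalgebra_RatsI:
  assumes "0 \<in> E" "\<And>x y. x \<in> E \<Longrightarrow> y \<in> E \<Longrightarrow> x - y \<in> E" "\<And>r x. r \<in> \<rat> \<Longrightarrow> x \<in> E \<Longrightarrow> r * x \<in> E"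
  shows "subalgebra \<rat> E real_ring"
proof (rule subalgebra.intro)
  have neg: "- x \<in> E" if "x \<in> E" for x using assms(2)[OF assms(1) that] by simp
  show "subgroup E (add_monoid real_ring)"
  proof (rule real.add.subgroupI)
    show "\<ominus>\<^bsub>real_ring\<^esub> x \<in> E" if "x \<in> E" for x using neg that by simp
    show "x \<oplus>\<^bsub>real_ring\<^esub> y \<in> E" if "x \<in> E" "y \<in> E" for x y
      using assms(2)[OF that(1) neg[OF that(2)]] by simp
  qed (use assms(1) in auto)
  show "subalgebra_axioms \<rat> E real_ring" by unfold_locales (simp add: assms(3))
qed

text \<open>The generators may be dependent; each one in the span of its successors is
  dropped.\<close>

lemma dimension_Span_le: "\<exists>d\<le>length Us. real.dimension d \<rat> (real.Span \<rat> Us)"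
proof (induction Us)
  case (Cons u Us)
  then obtain d where d: "d \<le> length Us" "real.dimension d \<rat> (real.Span \<rat> Us)" by blast
  have base: "set Us \<subseteq> real.Span \<rat> Us" for Us by (rule real.Span_base_incl[OF subfield_Rats']) simp
  have sub: "subalgebra \<rat> (real.Span \<rat> Us) real_ring" for Us
    by (rule real.Span_is_subalgebra[OF subfield_Rats']) simp
  show ?case
  proof (cases "u \<in> real.Span \<rat> Us")
    case True
    have "real.Span \<rat> (u # Us) = real.Span \<rat> Us"
    proof (rule subset_antisym; rule real.subalgebra_Span_incl[OF subfield_Rats' sub])
      show "set (u # Us) \<subseteq> real.Span \<rat> Us" using True base[of Us] by simp
      show "set Us \<subseteq> real.Span \<rat> (u # Us)" using base[of "u # Us"] by simp
    qed
    then show ?thesis using d by (metis le_SucI length_Cons)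
  next
    case False
    then have "real.dimension (Suc d) \<rat> (real.Span \<rat> (u # Us))"
      using real.Suc_dim[OF _ False d(2)] by simp
    then show ?thesis using d(1) by (intro exI[of _ "Suc d"]) simp
  qed
qed (use real.zero_dim[of \<rat>] in simp)

text \<open>Since E contains 1, the ring of multipliers lies in E and is finite-dimensional over the
  rationals. Its elements are therefore algebraic, and the inverse of each lies in the simple
  extension that it generates.\<close>

lemma multipliers_subfield:
  assumes fin: "real.finite_dimension \<rat> E" and E: "subalgebra \<rat> E real_ring" and one: "1 \<in> E"
  shows "subfield_of_reals {r. \<forall>x\<in>E. r * x \<in> E}"
proof -
  let ?K = "{r. \<forall>x\<in>E. r * x \<in> E}"
  note ES = rational_subspace[OF E]
  have diff: "r - s \<in> ?K" if "r \<in> ?K" "s \<in> ?K" for r s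
    using that ES(2) by (auto simp: left_diff_distrib)
  have mult: "r * s \<in> ?K" if "r \<in> ?K" "s \<in> ?K" for r s
    using that by (auto simp: mult.assoc)
  have rat: "r \<in> ?K" if "r \<in> \<rat>" for r using that ES(3) by auto
  have sub: "subalgebra \<rat> ?K real_ring"
    using diff mult rat by (intro subalgebra_RatsI) (auto simp: ES(1))
  have ring: "subring ?K real_ring"
  proof (rule real.subringI)
    have neg: "- s \<in> ?K" if "s \<in> ?K" for s using diff[OF rat[OF Rats_0] that] by simp
    show "\<ominus>\<^bsub>real_ring\<^esub> s \<in> ?K" if "s \<in> ?K" for s using neg[OF that] by (simp only: real_ring_minus)
    show "r \<oplus>\<^bsub>real_ring\<^esub> s \<in> ?K" if "r \<in> ?K" "s \<in> ?K" for r s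
      using diff[OF that(1) neg[OF that(2)]] by (simp only: real_ring_simps diff_minus_eq_add)
    show "r \<otimes>\<^bsub>real_ring\<^esub> s \<in> ?K" if "r \<in> ?K" "s \<in> ?K" for r s
      using mult[OF that] by (simp only: real_ring_simps)
  qed (use rat[OF Rats_1] in auto)
  have "?K \<subseteq> E" using one by force
  then have finK: "real.finite_dimension \<rat> ?K"
    by (rule real.subalbegra_incl_imp_finite_dimension[OF subfield_Rats' fin sub])
  have "inverse r \<in> ?K" if r: "r \<in> ?K" for r
  proof -
    have "(real.algebraic over \<rat>) r"
      by (rule real.finite_dimension_imp_algebraic[OF subfield_Rats' ring finK r])
    then have "subfield (real.simple_extension \<rat> r) real_ring"
      using real.simple_extension_is_subfield[OF subfield_Rats'] by simp
    then have "subfield_of_reals (real.simple_extension \<rat> r)" by (rule subfield_of_reals_real_ring)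
    moreover have "r \<in> real.simple_extension \<rat> r"
      by (rule real.simple_extension_mem[OF subfieldE(1)[OF subfield_Rats']]) simp
    ultimately have "inverse r \<in> real.simple_extension \<rat> r" by (simp add: subfield_of_reals_def)
    moreover have "real.simple_extension \<rat> r \<subseteq> ?K"
      using rat r by (intro real.simple_extension_subring_incl[OF ring]) auto
    ultimately show ?thesis by blast
  qed
  then show ?thesis using diff mult rat[OF Rats_1] by (simp add: subfield_of_reals_def)
qed

lemma M_preperiodic_degree:
  fixes p :: "'n::{finite,linorder} point"
  assumes p: "p \<in> Delta" "preperiodic M_map p"
  shows "degree_over_Q_le (point_field p) (CARD('n) + 1)"
proof -
  let ?n = "CARD('n)"
  obtain t q a m l where q: "q = (M_map ^^ t) p" "M.codes a q" "m > 0" "\<And>i. a (m + i) = a i"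
    "\<And>k. k \<le> ?n \<Longrightarrow> step_run ?n 1 a m (bary q) k = l * bary q k" "l > 0"
    by (rule M.preperiodic_obtain[OF p]) blast
  define Us where "Us = map (bary q) [0..<Suc ?n]"
  define E where "E = real.Span \<rat> Us"
  have E: "subalgebra \<rat> E real_ring"
    unfolding E_def by (rule real.Span_is_subalgebra[OF subfield_Rats']) simp
  note ES = rational_subspace[OF E]
  have Us: "set Us = bary q ` {..?n}" 
    by (simp add: Us_def atLeast0LessThan lessThan_Suc_atMost del: upt_Suc)
  have "set Us \<subseteq> E" unfolding E_def by (rule real.Span_base_incl[OF subfield_Rats']) simp
  then have bE: "bary q k \<in> E" if "k \<le> ?n" for k using that by (auto simp: Us)
  have E_min: "E \<subseteq> Y" if "subalgebra \<rat> Y real_ring" "\<And>k. k \<le> ?n \<Longrightarrow> bary q k \<in> Y" for Y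
    unfolding E_def using that by (intro real.subalgebra_Span_incl[OF subfield_Rats']) (auto simp: Us)
  have "(\<Sum>k\<le>?n. bary q k) \<in> E" using ES bE by (intro sum_closed) auto
  then have one: "1 \<in> E" by simp
  let ?K = "{r. \<forall>x\<in>E. r * x \<in> E}"
  have "real.finite_dimension \<rat> E"
    unfolding E_def by (rule real.Span_finite_dimension[OF subfield_Rats']) simp
  then have K: "subfield_of_reals ?K" using E one by (rule multipliers_subfield)
  \<comment> \<open>For c = 1 the linear steps have integral coefficients, so the eigenvalue
    relation exhibits \<open>l * bary q k\<close> as an element of the span.\<close>
  have "l * bary q k \<in> E" if "k \<le> ?n" for k
  proof -
    have "step_run ?n 1 a s (bary q) k \<in> E" if "k \<le> ?n" for s k
      using that
    proof (induction s arbitrary: k)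
      case (Suc s)
      then show ?case using ES(2) card_ge_1[where 'n='n] by (auto simp: step_lin_def)
    qed (simp add: bE)
    then show ?thesis using q(5)[OF that] that by metis
  qed
  then have "E \<subseteq> {x. l * x \<in> E}"
    using ES by (intro E_min subalgebra_RatsI) (auto simp: right_diff_distrib mult.left_commute)
  then have lK: "l \<in> ?K" by blast
  \<comment> \<open>Multiplication by a coordinate of q thus preserves E, which makes E closed under
    products and equal to its field of multipliers.\<close>
  have bK: "bary q k \<in> ?K" if "k \<le> ?n" for k
    by (rule M.periodic_in_subfield[OF q(2-6) K lK that])
  have "?K \<subseteq> E" using one by force
  moreover have "E \<subseteq> ?K"
    using ES bK by (intro E_min subalgebra_RatsI) (auto simp: left_diff_distrib mult.assoc)
  ultimately have EK: "subfield_of_reals E" using K by simp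
  \<comment> \<open>p and q generate the same field because coordinates pass both ways along the
    orbit.\<close>
  have "E = point_field p"
  proof
    let ?H = "\<rat> \<union> range (\<lambda>i. p $ i)"
    have F: "subfield (point_field p) real_ring"
      unfolding point_field_def by (rule field.generate_field_is_subfield[OF field_real_ring]) simp
    have H: "?H \<subseteq> point_field p" unfolding point_field_def by (auto intro: generate_field.incl)
    note FR = subfield_of_reals_real_ring[OF F]
    note FS = subfield_of_reals_simps[OF FR]
    have "\<forall>k\<le>?n. bary p k \<in> point_field p"
      using coords_closed_iff[of "point_field p" p] FS(1-3) H by blast
    then have "\<forall>k\<le>?n. bary q k \<in> point_field p"
      using M.subfield_funpow[OF FR p(1)] q(1) by simp
    then show "E \<subseteq> point_field p"
      using FS H by (intro E_min subalgebra_RatsI) auto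
    have "\<forall>k\<le>?n. bary p k \<in> E" using M.subfield_funpow[OF EK p(1), of t] bE q(1) by simp
    then have "\<forall>i. p $ i \<in> E"
      using coords_closed_iff[of E p] subfield_of_reals_simps(1-3)[OF EK] by blast
    moreover have "\<rat> \<subseteq> E" using ES(3)[OF _ one] by auto
    ultimately show "point_field p \<subseteq> E"
      unfolding point_field_def
      by (intro field.generate_field_min_subfield1[OF field_real_ring _ subfield_real_ring[OF EK]]) auto
  qed
  then show ?thesis
    using dimension_Span_le[of Us] by (simp add: degree_over_Q_le_def E_def Us_def)
qed

theorem theorem3p5:
  fixes p :: "'n::{finite,linorder} point"
  assumes "p \<in> Delta"
  shows
    "((rational_point p \<longleftrightarrow> EPO M_map p = {v1}) \<and>
      (EPO M_map p = {v1} \<longleftrightarrow> (\<exists>t. p \<in> complex_vertices (cylinder_complex M_map t)))) \<and>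
     ((dyadic_point p \<longleftrightarrow> EPO T_map p = {v1}) \<and>
      (EPO T_map p = {v1} \<longleftrightarrow> (\<exists>t. p \<in> complex_vertices (cylinder_complex T_map t)))) \<and>
     ({q \<in> Delta. rational_point q} = GO M_map (v1 :: 'n point) \<and>
      {q \<in> Delta. dyadic_point q} = GO T_map (v1 :: 'n point) \<and>
      bij_betw Phi {q \<in> Delta :: 'n point set. rational_point q} {q \<in> Delta. dyadic_point q}) \<and>
     (preperiodic M_map p \<longrightarrow> degree_over_Q_le (point_field p) (CARD('n) + 1)) \<and>
     (rational_point p \<longleftrightarrow> preperiodic T_map p)"
proof -
  have M: "rational_point q \<longleftrightarrow> (\<exists>t. (M_map ^^ t) q = v1)" if "q \<in> Delta" for q :: "'n point"
    using M_rational_reaches M.reaches_rational that by blast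
  have T: "dyadic_point q \<longleftrightarrow> (\<exists>t. (T_map ^^ t) q = v1)" if "q \<in> Delta" for q :: "'n point"
    using T_dyadic_reaches T_reaches_dyadic that by blast
  have GO_M: "{q \<in> Delta. rational_point q} = GO M_map (v1 :: 'n point)"
    using M by (auto simp: M.GO_v1_iff)
  have GO_T: "{q \<in> Delta. dyadic_point q} = GO T_map (v1 :: 'n point)"
    using T by (auto simp: T.GO_v1_iff)
  show ?thesis
    unfolding GO_M GO_T M[OF assms] T[OF assms] M.EPO_eq_v1_iff[OF assms] T.EPO_eq_v1_iff[OF assms]
      M.vertex_iff[OF assms] T.vertex_iff[OF assms]
    using bij_betw_Phi_GO M_preperiodic_degree[OF assms]
      T_rational_preperiodic[OF _ assms] T_preperiodic_rational[OF assms] M[OF assms] by blast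
qed

end
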